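(* For any $y_0\in\mathcal H$ the corresponding mild solution $y(t)$ of the initial value problem $y_t=\mathcal A y$, $y(0)=y_0$, is global in time, i.e. it exists on $[0,\infty)$. Furthermore, $t\mapsto H(y(t))$ is non-increasing on $[0,\infty)$, and $y(t)$ is uniformly bounded in $\mathcal H$ on $[0,\infty)$.
   Context: Throughout, $L,\rho,\Lambda,J,M>0$ are constants, $n_1,n_2\in\mathbb N$, a prime on a function of $x\in[0,L]$ denotes the $x$-derivative, $u^{(4)}$ is the fourth $x$-derivative, and a subscript $t$ denotes the time derivative. Standing assumptions, for $j=1,2$: (A1) $d_j\in C^2(\mathbb R;\mathbb R)$, $d_j(0)=0$, $d_j'(s)\ge 0$ for all $s\in\mathbb R$, and $d_j'(0)>0$. (A2) $k_j\in C^2(\mathbb R;\mathbb R)$, $k_j(0)=0$, $k_j'(0)>0$, and $\int_0^s k_j(\sigma)\,d\sigma>0$ for all $s\ne0$. (A3) There is $V_j\in C^2(\mathbb R^{n_j};\mathbb R)$ with $V_j(0)=0$, and $V_j(z)>0$ and $\nabla V_j(z)\cdot a_j(z)<0$ for all $z\neq0$, and $\nabla V_j(z)\cdot b_j(z)=c_j(z)$ for all $z$. (A4) $V_j(z)\to\infty$ as $|z|\to\infty$, and the Hessian $P_j:=\operatorname{Hess}(V_j)(0)$ is positive definite. (A5) $a_j,b_j\in C^2(\mathbb R^{n_j};\mathbb R^{n_j})$, $a_j(0)=0$, and the Jacobian $A_j:=J_{a_j}(0)$ satisfies $\det A_j\ne0$. (A6) $c_j\in C^2(\mathbb R^{n_j};\mathbb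 R)$, $c_j(0)=0$. Put $D_j:=d_j'(0)$, $K_j:=k_j'(0)$, $B_j:=b_j(0)$, $C_j:=\nabla c_j(0)$. For $n\ge2$, $\tilde H_0^n(0,L):=\{f\in H^n(0,L): f(0)=f'(0)=0\}$. The state space is the Hilbert space $\mathcal H=\tilde H_0^2(0,L)\times L^2(0,L)\times\mathbb R^{n_1}\times\mathbb R^{n_2}\times\mathbb R\times\mathbb R$, with elements $y=[u,v,z_1,z_2,\xi,\psi]^\top$ and inner product $$\langle y,\tilde y\rangle_{\mathcal H}=\Lambda\int_0^L u''\tilde u''\,dx+\rho\int_0^L v\tilde v\,dx+\tfrac1J\xi\tilde\xi+\tfrac1M\psi\tilde\psi+K_1u'(L)\tilde u'(L)+K_2u(L)\tilde u(L)+z_1^\top P_1\tilde z_1+z_2^\top P_2\tilde z_2.$$ The nonlinear operator $\mathcal A$ is $$\mathcal A y=\begin{bmatrix} v\\ -\frac{\Lambda}{\rho}u^{(4)}\\ a_1(z_1)+\frac1J b_1(z_1)\xi\\ a_2(z_2)+\frac1M b_2(z_2)\psi\\ -\Lambda u''(L)-[c_1(z_1)+d_1(\frac{\xi}{J})+k_1(u'(L))]\\ \Lambda u'''(L)-[c_2(z_2)+d_2(\frac{\psi}{M})+k_2(u(L))]\end{bmatrix}$$ with domain $D(\mathcal A)=\{y\in\mathcal H: u\in\tilde H_0^4(0,L),\ v\in\tilde H_0^2(0,L),\ \xi=Jv'(L),\ \psi=Mv(L)\}$. Its linearization at the origin is the linear operator $\mathcal L$ with $D(\mathcal L)=D(\mathcal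 A)$ obtained from the formula for $\mathcal A$ by replacing $a_j(z_j),b_j(z_j),c_j(z_j),d_j(s),k_j(s)$ by $A_jz_j,B_j,C_j\cdot z_j,D_js,K_js$; it generates a $C_0$-semigroup of contractions $(e^{t\mathcal L})_{t\ge0}$ on $\mathcal H$. The nonlinear remainder $\mathcal N:=\mathcal A-\mathcal L$ extends to the continuous map $\mathcal N:\mathcal H\to\mathcal H$ with first two components $0$ and remaining components $\alpha_1(z_1)+\frac1J\beta_1(z_1)\xi$, $\ \alpha_2(z_2)+\frac1M\beta_2(z_2)\psi$, $\ -\gamma_1(z_1)-\delta_1(\frac\xi J)-\kappa_1(u'(L))$, $\ -\gamma_2(z_2)-\delta_2(\frac\psi M)-\kappa_2(u(L))$, where $\alpha_j(z)=a_j(z)-A_jz$, $\beta_j(z)=b_j(z)-B_j$, $\gamma_j(z)=c_j(z)-C_j\cdot z$, $\delta_j(s)=d_j(s)-D_js$, $\kappa_j(s)=k_j(s)-K_js$. A mild solution of $y_t=\mathcal Ay$, $y(0)=y_0$ on an interval $[0,T)$ is a continuous function $y:[0,T)\to\mathcal H$ with $y(t)=e^{t\mathcal L}y_0+\int_0^te^{(t-s)\mathcal L}\mathcal N y(s)\,ds$. For each $y_0\in\mathcal H$ there is a unique maximal mild solution. The functional $H:\mathcal H\to\mathbb R$ is $$H(y)=\tfrac12\int_0^L(\Lambda|u''|^2+\rho|v|^2)\,dx+\tfrac{|\xi|^2}{2J}+\tfrac{|\psi|^2}{2M}+\int_0^{u'(L)}k_1(s)\,ds+\int_0^{u(L)}k_2(s)\,ds+V_1(z_1)+V_2(z_2).$$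 *)

theory Defs
  imports "HOL-Analysis.Analysis"
begin

section \<open>Lebesgue measurable functions modulo equality almost everywhere\<close>

definition ae_eq :: "(real \<Rightarrow> real) \<Rightarrow> (real \<Rightarrow> real) \<Rightarrow> bool" where
  "ae_eq f g \<longleftrightarrow> f \<in> borel_measurable lebesgue \<and> g \<in> borel_measurable lebesgue \<and>
     (AE x in lebesgue. f x = g x)"

quotient_type L0 = "real \<Rightarrow> real" / partial: ae_eq
proof (rule part_equivpI)
  show "\<exists>f. ae_eq f f"
    by (rule exI[of _ "\<lambda>_. 0"]) (simp add: ae_eq_def)
  show "symp ae_eq"
    by (rule sympI) (auto simp: ae_eq_def elim: eventually_mono)
  show "transp ae_eq"
    by (rule transpI) (auto simp: ae_eq_def elim: eventually_elim2)
qed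

instantiation L0 :: real_vector
begin

lift_definition zero_L0 :: L0 is "\<lambda>_. 0"
  by (simp add: ae_eq_def)

lift_definition plus_L0 :: "L0 \<Rightarrow> L0 \<Rightarrow> L0" is "\<lambda>f g x. f x + g x"
  by (auto simp: ae_eq_def elim: eventually_mono eventually_elim2)

lift_definition minus_L0 :: "L0 \<Rightarrow> L0 \<Rightarrow> L0" is "\<lambda>f g x. f x - g x"
  by (auto simp: ae_eq_def elim: eventually_mono eventually_elim2)

lift_definition uminus_L0 :: "L0 \<Rightarrow> L0" is "\<lambda>f x. - f x"
  by (auto simp: ae_eq_def elim: eventually_mono eventually_elim2)

lift_definition scaleR_L0 :: "real \<Rightarrow> L0 \<Rightarrow> L0" is "\<lambda>r f x. r * f x"
  by (auto simp: ae_eq_def elim: eventually_mono eventually_elim2)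

instance
proof
  fix a b c :: L0 and r s :: real
  show "a + b + c = a + (b + c)"
    by transfer (auto simp: ae_eq_def algebra_simps)
  show "a + b = b + a"
    by transfer (auto simp: ae_eq_def algebra_simps)
  show "0 + a = a"
    by transfer (auto simp: ae_eq_def)
  show "- a + a = 0"
    by transfer (auto simp: ae_eq_def)
  show "a - b = a + - b"
    by transfer (auto simp: ae_eq_def)
  show "r *\<^sub>R (a + b) = r *\<^sub>R a + r *\<^sub>R b"
    by transfer (auto simp: ae_eq_def algebra_simps)
  show "(r + s) *\<^sub>R a = r *\<^sub>R a + s *\<^sub>R a"
    by transfer (auto simp: ae_eq_def algebra_simps)
  show "r *\<^sub>R s *\<^sub>R a = (r * s) *\<^sub>R a"
    by transfer (auto simp: ae_eq_def algebra_simps)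
  show "1 *\<^sub>R a = a"
    by transfer (auto simp: ae_eq_def)
qed

end


section \<open>Lebesgue and Sobolev spaces on a bounded interval\<close>

text \<open>Functions on the interval \<open>(0, l)\<close> are represented by their extension by zero.  For a class
  \<^term>\<open>f :: L0\<close>, the function \<^term>\<open>rep_L0 f\<close> is some representative of it.\<close>

definition L2 :: "real \<Rightarrow> L0 set" where
  "L2 l = {f. integrable lebesgue (\<lambda>x. (rep_L0 f x)\<^sup>2) \<and>
              (AE x in lebesgue. x \<notin> {0<..<l} \<longrightarrow> rep_L0 f x = 0)}"

text \<open>Sobolev spaces in one dimension are used in their usual form: \<open>f\<close> has the derivative \<open>g\<close> if
  \<open>f\<close> has a representative \<open>F\<close> that is the indefinite Lebesgue integral of \<open>g\<close>, i.e. is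
  absolutely continuous on \<open>[0, l]\<close> with \<open>F' = g\<close> almost everywhere.\<close>

definition has_L2_deriv :: "real \<Rightarrow> L0 \<Rightarrow> L0 \<Rightarrow> bool" where
  "has_L2_deriv l f g \<longleftrightarrow> f \<in> L2 l \<and> g \<in> L2 l \<and>
     (\<exists>F. (AE x in lebesgue. x \<in> {0<..<l} \<longrightarrow> rep_L0 f x = F x) \<and>
          (\<forall>x\<in>{0..l}. F x = F 0 + (LINT s:{0..x}|lebesgue. rep_L0 g s)))"

definition Dx :: "real \<Rightarrow> L0 \<Rightarrow> L0" where
  "Dx l f = (THE g. has_L2_deriv l f g)"

primrec Sobolev :: "real \<Rightarrow> nat \<Rightarrow> L0 set" where
  "Sobolev l 0 = L2 l"
| "Sobolev l (Suc n) = {f \<in> L2 l. \<exists>g \<in> Sobolev l n. has_L2_deriv l f g}"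

text \<open>The value at \<open>x \<in> [0, l]\<close> of the continuous representative of a class.\<close>

definition val :: "real \<Rightarrow> L0 \<Rightarrow> real \<Rightarrow> real" where
  "val l f x = (THE y. \<exists>F. continuous_on {0..l} F \<and>
     (AE s in lebesgue. s \<in> {0<..<l} \<longrightarrow> rep_L0 f s = F s) \<and> y = F x)"

definition Sobolev0 :: "real \<Rightarrow> nat \<Rightarrow> L0 set" where
  "Sobolev0 l n = {f \<in> Sobolev l n. val l f 0 = 0 \<and> val l (Dx l f) 0 = 0}"

definition L2_inner :: "real \<Rightarrow> L0 \<Rightarrow> L0 \<Rightarrow> real" where
  "L2_inner l f g = (LINT x:{0..l}|lebesgue. rep_L0 f x * rep_L0 g x)"


section \<open>Differential calculus on Euclidean spaces\<close>

definition C2 :: "('a::euclidean_space \<Rightarrow> 'b::real_normed_vector) \<Rightarrow> bool" where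
  "C2 f \<longleftrightarrow> (\<exists>(f' :: 'a \<Rightarrow> 'a \<Rightarrow>\<^sub>L 'b) (f'' :: 'a \<Rightarrow> 'a \<Rightarrow>\<^sub>L 'a \<Rightarrow>\<^sub>L 'b).
     (\<forall>x. (f has_derivative blinfun_apply (f' x)) (at x)) \<and>
     (\<forall>x. (f' has_derivative blinfun_apply (f'' x)) (at x)) \<and>
     continuous_on UNIV f'')"

definition grad :: "('a::real_inner \<Rightarrow> real) \<Rightarrow> 'a \<Rightarrow> 'a" where
  "grad f x = (THE D. GDERIV f x :> D)"

definition hessian :: "(real^'n \<Rightarrow> real) \<Rightarrow> real^'n \<Rightarrow> real^'n^'n" where
  "hessian f x = jacobian (grad f) (at x)"

definition pos_def :: "real^'n^'n \<Rightarrow> bool" where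
  "pos_def P \<longleftrightarrow> transpose P = P \<and> (\<forall>z. z \<noteq> 0 \<longrightarrow> z \<bullet> (P *v z) > 0)"


section \<open>The coefficients of the system\<close>

record ('n::finite) controller =
  fa :: "real^'n \<Rightarrow> real^'n"
  fb :: "real^'n \<Rightarrow> real^'n"
  fc :: "real^'n \<Rightarrow> real"
  fd :: "real \<Rightarrow> real"
  fk :: "real \<Rightarrow> real"
  fV :: "real^'n \<Rightarrow> real"

definition cA :: "('n::finite) controller \<Rightarrow> real^'n^'n" where "cA C = jacobian (fa C) (at 0)"
definition cB :: "('n::finite) controller \<Rightarrow> real^'n" where "cB C = fb C 0"
definition cC :: "('n::finite) controller \<Rightarrow> real^'n" where "cC C = grad (fc C) 0"
definition cD :: "('n::finite) controller \<Rightarrow> real" where "cD C = deriv (fd C) 0"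
definition cK :: "('n::finite) controller \<Rightarrow> real" where "cK C = deriv (fk C) 0"
definition cP :: "('n::finite) controller \<Rightarrow> real^'n^'n" where "cP C = hessian (fV C) 0"

text \<open>The interval integral is oriented: \<^term>\<open>potential k s\<close> is minus the integral over
  \<open>[s, 0]\<close> for negative \<open>s\<close>.\<close>

definition potential :: "(real \<Rightarrow> real) \<Rightarrow> real \<Rightarrow> real" where
  "potential k s = (LBINT x=ereal 0..ereal s. k x)"

definition admissible :: "('n::finite) controller \<Rightarrow> bool" where
  "admissible C \<longleftrightarrow>
     C2 (fd C) \<and> fd C 0 = 0 \<and> (\<forall>s. deriv (fd C) s \<ge> 0) \<and> deriv (fd C) 0 > 0 \<and>
     C2 (fk C) \<and> fk C 0 = 0 \<and> deriv (fk C) 0 > 0 \<and> (\<forall>s. s \<noteq> 0 \<longrightarrow> potential (fk C) s > 0) \<and>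
     C2 (fV C) \<and> fV C 0 = 0 \<and>
     (\<forall>z. z \<noteq> 0 \<longrightarrow> fV C z > 0 \<and> grad (fV C) z \<bullet> fa C z < 0) \<and>
     (\<forall>z. grad (fV C) z \<bullet> fb C z = fc C z) \<and>
     filterlim (fV C) at_top at_infinity \<and> pos_def (hessian (fV C) 0) \<and>
     C2 (fa C) \<and> C2 (fb C) \<and> fa C 0 = 0 \<and> det (jacobian (fa C) (at 0)) \<noteq> 0 \<and>
     C2 (fc C) \<and> fc C 0 = 0"

definition linearized :: "('n::finite) controller \<Rightarrow> 'n controller" where
  "linearized C = C\<lparr>fa := \<lambda>z. cA C *v z, fb := \<lambda>_. cB C, fc := \<lambda>z. cC C \<bullet> z,
                    fd := \<lambda>s. cD C * s, fk := \<lambda>s. cK C * s\<rparr>"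

definition r\<alpha> :: "('n::finite) controller \<Rightarrow> real^'n \<Rightarrow> real^'n" where "r\<alpha> C z = fa C z - cA C *v z"
definition r\<beta> :: "('n::finite) controller \<Rightarrow> real^'n \<Rightarrow> real^'n" where "r\<beta> C z = fb C z - cB C"
definition r\<gamma> :: "('n::finite) controller \<Rightarrow> real^'n \<Rightarrow> real" where "r\<gamma> C z = fc C z - cC C \<bullet> z"
definition r\<delta> :: "('n::finite) controller \<Rightarrow> real \<Rightarrow> real" where "r\<delta> C s = fd C s - cD C * s"
definition r\<kappa> :: "('n::finite) controller \<Rightarrow> real \<Rightarrow> real" where "r\<kappa> C s = fk C s - cK C * s"

text \<open>The fields \<open>len\<close>, \<open>rho\<close>, \<open>Lam\<close>, \<open>inertia\<close>, \<open>mass\<close>, \<open>ctl1\<close>, \<open>ctl2\<close> stand for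
  \<open>L\<close>, \<open>\<rho>\<close>, \<open>\<Lambda>\<close>, \<open>J\<close>, \<open>M\<close> and the coefficient functions with index \<open>1\<close> and \<open>2\<close>.\<close>

record ('n::finite, 'm::finite) beam =
  len :: real
  rho :: real
  Lam :: real
  inertia :: real
  mass :: real
  ctl1 :: "'n controller"
  ctl2 :: "'m controller"

definition standing_assumptions :: "('n::finite, 'm::finite) beam \<Rightarrow> bool" where
  "standing_assumptions p \<longleftrightarrow>
     len p > 0 \<and> rho p > 0 \<and> Lam p > 0 \<and> inertia p > 0 \<and> mass p > 0 \<and>
     admissible (ctl1 p) \<and> admissible (ctl2 p)"


section \<open>State space and operators\<close>

text \<open>States are tuples \<open>(u, v, z\<^sub>1, z\<^sub>2, \<xi>, \<psi>)\<close>.\<close>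

type_synonym ('n, 'm) state = "L0 \<times> L0 \<times> (real^'n) \<times> (real^'m) \<times> real \<times> real"

definition state_space :: "('n::finite, 'm::finite) beam \<Rightarrow> ('n, 'm) state set" where
  "state_space p = {(u, v, z1, z2, \<xi>, \<psi>). u \<in> Sobolev0 (len p) 2 \<and> v \<in> L2 (len p)}"

fun inner_H :: "('n::finite, 'm::finite) beam \<Rightarrow> ('n, 'm) state \<Rightarrow> ('n, 'm) state \<Rightarrow> real" where
  "inner_H p (u, v, z1, z2, \<xi>, \<psi>) (u', v', z1', z2', \<xi>', \<psi>') =
     (let l = len p; D = Dx l in
       Lam p * L2_inner l (D (D u)) (D (D u')) + rho p * L2_inner l v v'
       + \<xi> * \<xi>' / inertia p + \<psi> * \<psi>' / mass p
       + cK (ctl1 p) * val l (D u) l * val l (D u') l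
       + cK (ctl2 p) * val l u l * val l u' l
       + z1 \<bullet> (cP (ctl1 p) *v z1') + z2 \<bullet> (cP (ctl2 p) *v z2'))"

definition norm_H :: "('n::finite, 'm::finite) beam \<Rightarrow> ('n, 'm) state \<Rightarrow> real" where
  "norm_H p y = sqrt (inner_H p y y)"

fun op_A :: "('n::finite, 'm::finite) beam \<Rightarrow> ('n, 'm) state \<Rightarrow> ('n, 'm) state" where
  "op_A p (u, v, z1, z2, \<xi>, \<psi>) =
     (let l = len p; D = Dx l; J = inertia p; M = mass p; c1 = ctl1 p; c2 = ctl2 p in
       (v,
        - (Lam p / rho p) *\<^sub>R D (D (D (D u))),
        fa c1 z1 + (1 / J * \<xi>) *\<^sub>R fb c1 z1,
        fa c2 z2 + (1 / M * \<psi>) *\<^sub>R fb c2 z2,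
        - Lam p * val l (D (D u)) l - (fc c1 z1 + fd c1 (\<xi> / J) + fk c1 (val l (D u) l)),
        Lam p * val l (D (D (D u))) l - (fc c2 z2 + fd c2 (\<psi> / M) + fk c2 (val l u l))))"

definition dom_A :: "('n::finite, 'm::finite) beam \<Rightarrow> ('n, 'm) state set" where
  "dom_A p = {(u, v, z1, z2, \<xi>, \<psi>). u \<in> Sobolev0 (len p) 4 \<and> v \<in> Sobolev0 (len p) 2 \<and>
     \<xi> = inertia p * val (len p) (Dx (len p) v) (len p) \<and> \<psi> = mass p * val (len p) v (len p)}"

definition op_L :: "('n::finite, 'm::finite) beam \<Rightarrow> ('n, 'm) state \<Rightarrow> ('n, 'm) state" where
  "op_L p = op_A (p\<lparr>ctl1 := linearized (ctl1 p), ctl2 := linearized (ctl2 p)\<rparr>)"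

text \<open>On \<^const>\<open>dom_A\<close> this is \<^const>\<open>op_A\<close> minus \<^const>\<open>op_L\<close>; it is defined on the whole state space.\<close>

fun op_N :: "('n::finite, 'm::finite) beam \<Rightarrow> ('n, 'm) state \<Rightarrow> ('n, 'm) state" where
  "op_N p (u, v, z1, z2, \<xi>, \<psi>) =
     (let l = len p; D = Dx l; J = inertia p; M = mass p; c1 = ctl1 p; c2 = ctl2 p in
       (0,
        0,
        r\<alpha> c1 z1 + (1 / J * \<xi>) *\<^sub>R r\<beta> c1 z1,
        r\<alpha> c2 z2 + (1 / M * \<psi>) *\<^sub>R r\<beta> c2 z2,
        - r\<gamma> c1 z1 - r\<delta> c1 (\<xi> / J) - r\<kappa> c1 (val l (D u) l),
        - r\<gamma> c2 z2 - r\<delta> c2 (\<psi> / M) - r\<kappa> c2 (val l u l)))"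

fun energy :: "('n::finite, 'm::finite) beam \<Rightarrow> ('n, 'm) state \<Rightarrow> real" where
  "energy p (u, v, z1, z2, \<xi>, \<psi>) =
     (let l = len p; D = Dx l in
       1 / 2 * (LINT x:{0..l}|lebesgue.
                  Lam p * (rep_L0 (D (D u)) x)\<^sup>2 + rho p * (rep_L0 v x)\<^sup>2)
       + \<xi>\<^sup>2 / (2 * inertia p) + \<psi>\<^sup>2 / (2 * mass p)
       + potential (fk (ctl1 p)) (val l (D u) l) + potential (fk (ctl2 p)) (val l u l)
       + fV (ctl1 p) z1 + fV (ctl2 p) z2)"


section \<open>Semigroups and mild solutions\<close>

text \<open>The norm of the state space depends on the parameters of the system, so it is not the norm of
  a type.  The following notions are therefore relative to a linear subspace \<open>X\<close> of a vector space
  and a norm \<open>N\<close> on \<open>X\<close>.\<close>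

definition C0_contraction_semigroup ::
    "'a::real_vector set \<Rightarrow> ('a \<Rightarrow> real) \<Rightarrow> (real \<Rightarrow> 'a \<Rightarrow> 'a) \<Rightarrow> bool" where
  "C0_contraction_semigroup X N S \<longleftrightarrow>
     (\<forall>t\<ge>0. \<forall>x\<in>X. S t x \<in> X \<and> N (S t x) \<le> N x) \<and>
     (\<forall>t\<ge>0. \<forall>x\<in>X. \<forall>y\<in>X. S t (x + y) = S t x + S t y) \<and>
     (\<forall>t\<ge>0. \<forall>r. \<forall>x\<in>X. S t (r *\<^sub>R x) = r *\<^sub>R S t x) \<and>
     (\<forall>x\<in>X. S 0 x = x) \<and>
     (\<forall>s\<ge>0. \<forall>t\<ge>0. \<forall>x\<in>X. S (s + t) x = S s (S t x)) \<and>
     (\<forall>x\<in>X. ((\<lambda>t. N (S t x - x)) \<longlongrightarrow> 0) (at_right 0))"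

text \<open>\<open>G\<close> with domain \<open>D\<close> is the infinitesimal generator of \<open>S\<close>.\<close>

definition is_generator ::
    "'a::real_vector set \<Rightarrow> ('a \<Rightarrow> real) \<Rightarrow> (real \<Rightarrow> 'a \<Rightarrow> 'a) \<Rightarrow> 'a set \<Rightarrow> ('a \<Rightarrow> 'a) \<Rightarrow> bool" where
  "is_generator X N S D G \<longleftrightarrow>
     (\<forall>x\<in>X. \<forall>w\<in>X. ((\<lambda>h. N ((1 / h) *\<^sub>R (S h x - x) - w)) \<longlongrightarrow> 0) (at_right 0)
        \<longleftrightarrow> x \<in> D \<and> w = G x)"

text \<open>This is the definition of \<^const>\<open>has_integral\<close> on a compact interval (see
  \<open>has_integral_real\<close>) with \<open>N\<close> in place of the norm of a type.  For integrands that are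
  continuous with respect to \<open>N\<close> it is the usual vector-valued integral.\<close>

definition has_integral_wrt ::
    "('a::real_vector \<Rightarrow> real) \<Rightarrow> (real \<Rightarrow> 'a) \<Rightarrow> 'a \<Rightarrow> real \<Rightarrow> real \<Rightarrow> bool" where
  "has_integral_wrt N f I a b \<longleftrightarrow>
     (\<forall>e>0. \<exists>\<gamma>. gauge \<gamma> \<and>
        (\<forall>\<D>. \<D> tagged_division_of {a..b} \<and> \<gamma> fine \<D> \<longrightarrow>
           N ((\<Sum>(x, k)\<in>\<D>. measure lborel k *\<^sub>R f x) - I) < e))"

text \<open>\<open>y\<close> is a mild solution on \<open>[0, T)\<close>, where \<open>T\<close> may be infinite; \<open>S\<close> is the semigroup generated
  by \<^term>\<open>op_L p\<close>.\<close>

definition mild_solution ::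
    "('n::finite, 'm::finite) beam \<Rightarrow> (real \<Rightarrow> ('n, 'm) state \<Rightarrow> ('n, 'm) state) \<Rightarrow>
     ('n, 'm) state \<Rightarrow> ereal \<Rightarrow> (real \<Rightarrow> ('n, 'm) state) \<Rightarrow> bool" where
  "mild_solution p S y0 T y \<longleftrightarrow>
     (\<forall>t. 0 \<le> t \<and> ereal t < T \<longrightarrow>
        y t \<in> state_space p \<and>
        ((\<lambda>s. norm_H p (y s - y t)) \<longlongrightarrow> 0) (at t within {s. 0 \<le> s \<and> ereal s < T}) \<and>
        has_integral_wrt (norm_H p) (\<lambda>s. S (t - s) (op_N p (y s))) (y t - S t y0) 0 t)"

definition maximal_mild_solution ::
    "('n::finite, 'm::finite) beam \<Rightarrow> (real \<Rightarrow> ('n, 'm) state \<Rightarrow> ('n, 'm) state) \<Rightarrow>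
     ('n, 'm) state \<Rightarrow> ereal \<Rightarrow> (real \<Rightarrow> ('n, 'm) state) \<Rightarrow> bool" where
  "maximal_mild_solution p S y0 T y \<longleftrightarrow> 0 < T \<and> mild_solution p S y0 T y \<and>
     \<not> (\<exists>T' w. T < T' \<and> mild_solution p S y0 T' w \<and> (\<forall>t. 0 \<le> t \<and> ereal t < T \<longrightarrow> w t = y t))"

end

theory Submission
  imports Defs
begin

text \<open>
  Replacing \<open>u\<close> by \<open>u''\<close> embeds the state space, with an equivalent norm, as a closed subspace of
  the Hilbert space \<open>L\<^sup>2 \<times> L\<^sup>2 \<times> \<real>\<^sup>n \<times> \<real>\<^sup>m \<times> \<real> \<times> \<real>\<close>.

  Integration by parts shows that on the domain of the linear generator the derivative of \<open>H\<close> along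
  the linear flow is a function of the finite-dimensional quantities
  \<open>z\<^sub>1, z\<^sub>2, \<xi>, \<psi>, u'(L), u(L)\<close> alone.  It therefore extends continuously to all states, and by density of
  the domain it is the right derivative of \<open>H\<close> along the linear flow from every initial state.  For a mild
  solution the remainder adds the term \<open>dH(y) (N y)\<close>, so that the right derivative of \<open>H(y(t))\<close> is
  \<open>\<nabla>V\<^sub>1 \<cdot> a\<^sub>1 + \<nabla>V\<^sub>2 \<cdot> a\<^sub>2 - (\<xi>/J) d\<^sub>1(\<xi>/J) - (\<psi>/M) d\<^sub>2(\<psi>/M) \<le> 0\<close> without any regularity of the solution.

  Since \<open>H\<close> is coercive, the solution of the equation with the remainder cut off outside a large ball
  never leaves that ball, which gives a global bounded mild solution; every other mild solution is a
  restriction of it by uniqueness.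
\<close>

section \<open>Square integrable functions\<close>

text \<open>The obstacle is the unbounded fourth derivative in the generator: a mild solution with
  general data is not differentiable in time, so the chain rule for \<open>H\<close> does not apply
  to it. Classical approximations are used for the linear flow only, where the domain is invariant;
  the remainder, a continuous function of time along the solution, is split off by restarting the
  solution at each time. Right derivatives suffice, since a mean value inequality for them needs no
  more than continuity.

  A type for the Hilbert space cannot depend on the length of the beam. It therefore consists of
  classes on the whole line, functions on the beam are the range of a projection, and the semigroup
  theory is developed for families whose value at time 0 is that projection.

  Closed balls of the state space are not compact. But the remainder sees a state only through a
  bounded linear map into a finite-dimensional space (the values at the tip are bounded functionals
  of \<open>u''\<close>), and on balls of that space C2 coefficients are bounded and
  Lipschitz.\<close>

lemma ae_eq_rep_L0: "ae_eq (rep_L0 f) (rep_L0 f)"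
  by (rule Quotient_rep_reflp[OF Quotient_L0])

lemma rep_L0_measurable [measurable, simp]: "rep_L0 f \<in> borel_measurable lebesgue"
  using ae_eq_rep_L0[of f] by (simp add: ae_eq_def)

lemma L0_eqI:
  assumes "AE x in lebesgue. rep_L0 f x = rep_L0 g x"
  shows "f = g"
  using assms Quotient_rel_rep[OF Quotient_L0, of f g] by (simp add: ae_eq_def)

lemma rep_abs_L0:
  assumes "f \<in> borel_measurable lebesgue"
  shows "AE x in lebesgue. rep_L0 (abs_L0 f) x = f x"
  using Quotient_rep_abs[OF Quotient_L0, of f] assms by (auto simp: ae_eq_def)

lemma abs_rep_L0: "abs_L0 (rep_L0 f) = f"
  by (rule Quotient_abs_rep[OF Quotient_L0])

lemma rep_L0_zero: "AE x in lebesgue. rep_L0 0 x = 0"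
  unfolding zero_L0_def by (rule rep_abs_L0) simp

lemma rep_L0_plus: "AE x in lebesgue. rep_L0 (f + g) x = rep_L0 f x + rep_L0 g x"
proof -
  have "f + g = abs_L0 (\<lambda>x. rep_L0 f x + rep_L0 g x)"
    using plus_L0.abs_eq[of "rep_L0 f" "rep_L0 g"] ae_eq_rep_L0 by (simp add: abs_rep_L0)
  then show ?thesis by (simp add: rep_abs_L0)
qed

lemma rep_L0_scaleR: "AE x in lebesgue. rep_L0 (r *\<^sub>R f) x = r * rep_L0 f x"
proof -
  have "r *\<^sub>R f = abs_L0 (\<lambda>x. r * rep_L0 f x)"
    using scaleR_L0.abs_eq[of "rep_L0 f" r] ae_eq_rep_L0 by (simp add: abs_rep_L0)
  then show ?thesis by (simp add: rep_abs_L0)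
qed

definition sq_integrable :: "(real \<Rightarrow> real) \<Rightarrow> bool" where
  "sq_integrable f \<longleftrightarrow> f \<in> borel_measurable lebesgue \<and> integrable lebesgue (\<lambda>x. (f x)\<^sup>2)"

lemma sq_integrable_mult:
  assumes "sq_integrable f" "sq_integrable g"
  shows "integrable lebesgue (\<lambda>x. f x * g x)"
proof (rule Bochner_Integration.integrable_bound)
  show "integrable lebesgue (\<lambda>x. (f x)\<^sup>2 + (g x)\<^sup>2)"
    using assms by (auto simp: sq_integrable_def)
  show "(\<lambda>x. f x * g x) \<in> borel_measurable lebesgue"
    using assms by (auto simp: sq_integrable_def)
  have "\<bar>a * b\<bar> \<le> a\<^sup>2 + b\<^sup>2" for a b :: real
    using sum_squares_bound[of a b] sum_squares_bound[of a "-b"] sum_squares_ge_zero[of a b]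
    by (auto simp: abs_if power2_eq_square)
  then show "AE x in lebesgue. norm (f x * g x) \<le> norm ((f x)\<^sup>2 + (g x)\<^sup>2)"
    by (auto intro!: AE_I2 order_trans[OF _ abs_ge_self])
qed

lemma sq_integrable_plus:
  assumes "sq_integrable f" "sq_integrable g"
  shows "sq_integrable (\<lambda>x. f x + g x)"
  using assms sq_integrable_mult[OF assms]
  by (auto simp: sq_integrable_def power2_sum mult.assoc)

lemma sq_integrable_scale:
  assumes "sq_integrable f"
  shows "sq_integrable (\<lambda>x. r * f x)"
  using assms by (auto simp: sq_integrable_def power_mult_distrib)

lemma sq_integrable_cong_AE:
  assumes "sq_integrable f" "g \<in> borel_measurable lebesgue" "AE x in lebesgue. g x = f x"
  shows "sq_integrable g"
proof -
  have "integrable lebesgue (\<lambda>x. (g x)\<^sup>2) = integrable lebesgue (\<lambda>x. (f x)\<^sup>2)"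
    using assms by (intro integrable_cong_AE) (auto simp: sq_integrable_def)
  then show ?thesis using assms by (simp add: sq_integrable_def)
qed

lemma sq_integrable_indicator_mult:
  assumes "sq_integrable f" "A \<in> sets lebesgue"
  shows "sq_integrable (\<lambda>x. indicat_real A x * f x)"
proof -
  have "integrable lebesgue (\<lambda>x. indicat_real A x *\<^sub>R (f x)\<^sup>2)"
    using assms by (intro integrable_mult_indicator) (auto simp: sq_integrable_def)
  moreover have "(indicat_real A x * f x)\<^sup>2 = indicat_real A x *\<^sub>R (f x)\<^sup>2" for x
    by (auto simp: indicator_def)
  moreover have "(\<lambda>x. indicat_real A x * f x) \<in> borel_measurable lebesgue"
  proof (rule borel_measurable_times)
    show "f \<in> borel_measurable lebesgue" using assms(1) by (simp add: sq_integrable_def)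
  qed (rule borel_measurable_indicator[OF assms(2)])
  ultimately show ?thesis
    by (simp add: sq_integrable_def)
qed

lemma sq_integrable_rep_L0:
  shows "sq_integrable (rep_L0 0)"
    and "sq_integrable (rep_L0 f) \<Longrightarrow> sq_integrable (rep_L0 g) \<Longrightarrow> sq_integrable (rep_L0 (f + g))"
    and "sq_integrable (rep_L0 f) \<Longrightarrow> sq_integrable (rep_L0 (r *\<^sub>R f))"
proof -
  show "sq_integrable (rep_L0 0)"
    by (rule sq_integrable_cong_AE[OF _ _ rep_L0_zero]) (auto simp: sq_integrable_def)
  show "sq_integrable (rep_L0 f) \<Longrightarrow> sq_integrable (rep_L0 g) \<Longrightarrow> sq_integrable (rep_L0 (f + g))"
    by (rule sq_integrable_cong_AE[OF _ _ rep_L0_plus]) (auto simp: sq_integrable_plus)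
  show "sq_integrable (rep_L0 f) \<Longrightarrow> sq_integrable (rep_L0 (r *\<^sub>R f))"
    by (rule sq_integrable_cong_AE[OF _ _ rep_L0_scaleR]) (auto simp: sq_integrable_scale)
qed

text \<open>Classes on the whole line, because a type cannot depend on the length; vanishing outside
  the beam is imposed later by the projection \<open>cut\<close>.\<close>

typedef l2 = "{f. sq_integrable (rep_L0 f)}"
  using sq_integrable_rep_L0(1) by blast

setup_lifting type_definition_l2

definition rep2 :: "l2 \<Rightarrow> real \<Rightarrow> real" where "rep2 f = rep_L0 (Rep_l2 f)"

lemma sq_integrable_rep2: "sq_integrable (rep2 f)"
  using Rep_l2[of f] by (simp add: rep2_def)

lemma rep2_measurable [measurable, simp]: "rep2 f \<in> borel_measurable lebesgue"
  by (simp add: rep2_def)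

lemma l2_eqI: "(AE x in lebesgue. rep2 f x = rep2 g x) \<Longrightarrow> f = g"
  unfolding rep2_def by (metis L0_eqI Rep_l2_inject)

instantiation l2 :: real_vector
begin

lift_definition zero_l2 :: l2 is 0
  by (rule sq_integrable_rep_L0)

lift_definition plus_l2 :: "l2 \<Rightarrow> l2 \<Rightarrow> l2" is "(+)"
  by (rule sq_integrable_rep_L0)

lift_definition scaleR_l2 :: "real \<Rightarrow> l2 \<Rightarrow> l2" is "(*\<^sub>R)"
  by (rule sq_integrable_rep_L0)

lift_definition minus_l2 :: "l2 \<Rightarrow> l2 \<Rightarrow> l2" is "(-)"
  using sq_integrable_rep_L0(2)[OF _ sq_integrable_rep_L0(3)[of _ "-1"]] by simp

lift_definition uminus_l2 :: "l2 \<Rightarrow> l2" is "uminus"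
  using sq_integrable_rep_L0(3)[of _ "-1"] by simp

instance
  by standard (transfer; simp add: algebra_simps)+

end

lemma rep2_zero: "AE x in lebesgue. rep2 0 x = 0"
  unfolding rep2_def zero_l2.rep_eq by (rule rep_L0_zero)

lemma rep2_plus: "AE x in lebesgue. rep2 (f + g) x = rep2 f x + rep2 g x"
  unfolding rep2_def plus_l2.rep_eq by (rule rep_L0_plus)

lemma rep2_scaleR: "AE x in lebesgue. rep2 (r *\<^sub>R f) x = r * rep2 f x"
  unfolding rep2_def scaleR_l2.rep_eq by (rule rep_L0_scaleR)

lemma rep2_minus: "AE x in lebesgue. rep2 (f - g) x = rep2 f x - rep2 g x"
  using rep2_plus[of f "(-1) *\<^sub>R g"] rep2_scaleR[of "-1" g] by (simp, eventually_elim) simp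

instantiation l2 :: real_inner
begin

definition inner_l2 :: "l2 \<Rightarrow> l2 \<Rightarrow> real" where
  "inner_l2 f g = (LINT x|lebesgue. rep2 f x * rep2 g x)"

definition norm_l2 :: "l2 \<Rightarrow> real" where "norm_l2 f = sqrt (inner f f)"
definition dist_l2 :: "l2 \<Rightarrow> l2 \<Rightarrow> real" where "dist_l2 f g = norm (f - g)"
definition sgn_l2 :: "l2 \<Rightarrow> l2" where "sgn_l2 f = inverse (norm f) *\<^sub>R f"
definition uniformity_l2 :: "(l2 \<times> l2) filter" where
  "uniformity_l2 = (INF e\<in>{0<..}. principal {(x, y). dist x y < e})"
definition open_l2 :: "l2 set \<Rightarrow> bool" where
  "open_l2 U = (\<forall>x\<in>U. \<forall>\<^sub>F (x', y) in uniformity. x' = x \<longrightarrow> y \<in> U)"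

instance
proof
  fix f g h :: l2 and r :: real
  note [simp] = sq_integrable_mult[OF sq_integrable_rep2 sq_integrable_rep2]
  show "inner f g = inner g f" by (simp add: inner_l2_def mult.commute)
  have "inner (f + g) h = (LINT x|lebesgue. rep2 f x * rep2 h x + rep2 g x * rep2 h x)"
    unfolding inner_l2_def
  proof (rule integral_cong_AE)
    show "AE x in lebesgue. rep2 (f + g) x * rep2 h x = rep2 f x * rep2 h x + rep2 g x * rep2 h x"
      using rep2_plus[of f g] by eventually_elim (simp add: algebra_simps)
  qed simp_all
  also have "\<dots> = inner f h + inner g h"
    unfolding inner_l2_def by (rule Bochner_Integration.integral_add) auto
  finally show "inner (f + g) h = inner f h + inner g h" .
  have "inner (r *\<^sub>R f) g = (LINT x|lebesgue. r * (rep2 f x * rep2 g x))"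
    unfolding inner_l2_def
  proof (rule integral_cong_AE)
    show "AE x in lebesgue. rep2 (r *\<^sub>R f) x * rep2 g x = r * (rep2 f x * rep2 g x)"
      using rep2_scaleR[of r f] by eventually_elim simp
  qed simp_all
  then show "inner (r *\<^sub>R f) g = r * inner f g"
    by (simp add: inner_l2_def)
  show "0 \<le> inner f f"
    by (simp add: inner_l2_def)
  show "inner f f = 0 \<longleftrightarrow> f = 0"
  proof
    assume "inner f f = 0"
    then have "AE x in lebesgue. rep2 f x * rep2 f x = 0"
      unfolding inner_l2_def using integral_nonneg_eq_0_iff_AE[of lebesgue "\<lambda>x. rep2 f x * rep2 f x"]
      by simp
    then have "AE x in lebesgue. rep2 f x = rep2 0 x"
      using rep2_zero by eventually_elim simp
    then show "f = 0" by (rule l2_eqI)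
  next
    assume f: "f = 0"
    show "inner f f = 0"
      unfolding inner_l2_def f
      by (rule integral_eq_zero_AE) (use rep2_zero in eventually_elim, simp)
  qed
qed (simp_all add: norm_l2_def dist_l2_def sgn_l2_def uniformity_l2_def open_l2_def)

end

section \<open>Completeness of the space of square integrable classes\<close>

definition to_l2 :: "(real \<Rightarrow> real) \<Rightarrow> l2" where "to_l2 f = Abs_l2 (abs_L0 f)"

lemma rep2_to_l2:
  assumes "sq_integrable f"
  shows "AE x in lebesgue. rep2 (to_l2 f) x = f x"
proof -
  have m: "f \<in> borel_measurable lebesgue" using assms by (simp add: sq_integrable_def)
  have "sq_integrable (rep_L0 (abs_L0 f))"
    using assms by (rule sq_integrable_cong_AE) (auto intro: rep_abs_L0 m)
  then show ?thesis
    using rep_abs_L0[OF m] by (simp add: rep2_def to_l2_def Abs_l2_inverse)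
qed

lemma inner_to_l2:
  assumes "sq_integrable g"
  shows "inner f (to_l2 g) = (LINT x|lebesgue. rep2 f x * g x)"
  unfolding inner_l2_def
  by (rule integral_cong_AE)
    (use assms in \<open>auto simp: sq_integrable_def intro!: eventually_mono[OF rep2_to_l2[OF assms]]\<close>)

text \<open>As a nonnegative integral the norm admits summation under the integral and Fatou's lemma
  before integrability of the limit is known.\<close>

lemma nn_integral_rep2_diff:
  "(\<integral>\<^sup>+x. ennreal ((rep2 f x - rep2 g x)\<^sup>2) \<partial>lebesgue) = ennreal ((norm (f - g))\<^sup>2)"
proof -
  have "(\<integral>\<^sup>+x. ennreal ((rep2 f x - rep2 g x)\<^sup>2) \<partial>lebesgue)
      = (\<integral>\<^sup>+x. ennreal ((rep2 (f - g) x)\<^sup>2) \<partial>lebesgue)"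
    by (rule nn_integral_cong_AE) (auto intro!: eventually_mono[OF rep2_minus[of f g]])
  also have "\<dots> = ennreal (LINT x|lebesgue. (rep2 (f - g) x)\<^sup>2)"
    using sq_integrable_rep2 by (intro nn_integral_eq_integral) (auto simp: sq_integrable_def)
  also have "(LINT x|lebesgue. (rep2 (f - g) x)\<^sup>2) = (norm (f - g))\<^sup>2"
    unfolding power2_norm_eq_inner inner_l2_def by (simp add: power2_eq_square)
  finally show ?thesis .
qed

text \<open>A bound \<open>C\<close> on the terms of the weighted series forces increments of size
  at most \<open>sqrt C / 2^n\<close>, which are summable. The weight \<open>4^n\<close> thus
  replaces a Minkowski inequality for infinite sums.\<close>

lemma convergent_of_summable_sq_diff:
  fixes a :: "nat \<Rightarrow> real"
  assumes "(\<Sum>n. ennreal (4 ^ n * (a (Suc n) - a n)\<^sup>2)) \<noteq> \<infinity>"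
  shows "convergent a"
proof -
  have s: "summable (\<lambda>n. 4 ^ n * (a (Suc n) - a n)\<^sup>2)"
    using assms by (intro summable_suminf_not_top) (auto simp: top_unique)
  then obtain C where C: "\<And>n. norm (4 ^ n * (a (Suc n) - a n)\<^sup>2) \<le> C"
    using summable_imp_Bseq[OF s] by (auto simp: Bseq_def)
  have "norm (a (Suc n) - a n) \<le> sqrt C * (1 / 2) ^ n" for n
  proof -
    have "(2 ^ n * \<bar>a (Suc n) - a n\<bar>)\<^sup>2 = 4 ^ n * (a (Suc n) - a n)\<^sup>2"
    proof -
      have "(2 ^ n)\<^sup>2 = (4::real) ^ n"
      proof -
        have "(2 ^ n)\<^sup>2 = ((2::real)\<^sup>2) ^ n"
          by (metis power_mult mult.commute)
        also have "(2::real)\<^sup>2 = 4" by simp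
        finally show ?thesis .
      qed
      then show ?thesis by (simp add: power_mult_distrib)
    qed
    also have "\<dots> \<le> C" using C[of n] by simp
    finally have "2 ^ n * \<bar>a (Suc n) - a n\<bar> \<le> sqrt C"
      by (simp add: real_le_rsqrt)
    then show ?thesis by (simp add: field_simps power_divide)
  qed
  then have "summable (\<lambda>n. a (Suc n) - a n)"
    by (rule summable_comparison_test'[rotated]) (auto intro!: summable_mult summable_geometric)
  then have "convergent (\<lambda>n. \<Sum>i<n. a (Suc i) - a i)"
    by (simp add: summable_iff_convergent)
  then have "convergent (\<lambda>n. a n - a 0)"
    by (simp add: sum_lessThan_telescope)
  then have "convergent (\<lambda>n. a n - a 0 + a 0)"
    by (intro convergent_add convergent_const)
  then show ?thesis by simp
qed

text \<open>The Riesz-Fischer argument. A subsequence with increments below \<open>(1/4)^k\<close>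
  has weighted squared increments with integrals at most \<open>4^k * ((1/4)^k)^2 = (1/4)^k\<close>,
  so the weighted series is finite almost everywhere and the representatives converge there. Fatou's
  lemma then turns the pointwise limit into a limit in norm.\<close>

instance l2 :: complete_space
proof
  fix X :: "nat \<Rightarrow> l2"
  assume X: "Cauchy X"
  have "\<exists>N. \<forall>m\<ge>N. \<forall>n\<ge>N. dist (X m) (X n) < (1 / 4) ^ k" for k
    using X unfolding Cauchy_def by (simp add: metric_CauchyD)
  then obtain N where N: "\<And>k m n. m \<ge> N k \<Longrightarrow> n \<ge> N k \<Longrightarrow> dist (X m) (X n) < (1 / 4) ^ k"
    by metis
  \<comment> \<open>The sum makes \<open>r k\<close> at least \<open>N k\<close>, and the summand
    \<open>k\<close> makes \<open>r\<close> strictly increasing even where \<open>N\<close> is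
    0.\<close>
  define r where "r k = (\<Sum>i\<le>k. N i) + k" for k
  have r_ge: "r k \<ge> N k" for k
    unfolding r_def using member_le_sum[of k "{..k}" N] by simp
  have r_Suc: "r k < r (Suc k)" for k by (simp add: r_def)
  then have sr: "strict_mono r" by (simp add: strict_mono_Suc_iff)
  define Y where "Y = X \<circ> r"
  have dY: "norm (Y (Suc k) - Y k) \<le> (1 / 4) ^ k" for k
    using N[of k "r (Suc k)" "r k"] r_ge[of k] r_Suc[of k] by (simp add: Y_def dist_norm)
  have CY: "Cauchy Y"
    unfolding Y_def using X sr by (rule Cauchy_subseq_Cauchy)
  define s where "s x = (\<Sum>n. ennreal (4 ^ n * (rep2 (Y (Suc n)) x - rep2 (Y n) x)\<^sup>2))" for x
  have "(\<integral>\<^sup>+x. s x \<partial>lebesgue)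
      = (\<Sum>n. \<integral>\<^sup>+x. ennreal (4 ^ n * (rep2 (Y (Suc n)) x - rep2 (Y n) x)\<^sup>2) \<partial>lebesgue)"
    unfolding s_def by (rule nn_integral_suminf) simp
  also have "\<dots> = (\<Sum>n. ennreal (4 ^ n * (norm (Y (Suc n) - Y n))\<^sup>2))"
    by (simp add: ennreal_mult nn_integral_cmult nn_integral_rep2_diff)
  also have "\<dots> \<le> (\<Sum>n. ennreal ((1 / 4) ^ n))"
  proof (rule suminf_le)
    fix n
    have "4 ^ n * (norm (Y (Suc n) - Y n))\<^sup>2 \<le> 4 ^ n * ((1 / 4) ^ n)\<^sup>2"
      using dY by (intro mult_left_mono power_mono) auto
    also have "\<dots> = (4 * (1/4)^2) ^ n"
      by (simp only: power_mult_distrib mult.commute[of _ 2] flip: power_mult)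
    finally show "ennreal (4 ^ n * (norm (Y (Suc n) - Y n))\<^sup>2) \<le> ennreal ((1 / 4) ^ n)"
      by (intro ennreal_leI) (simp add: power2_eq_square)
  qed auto
  also have "\<dots> = ennreal (\<Sum>n. (1 / 4) ^ n)"
    by (rule suminf_ennreal2) (auto intro!: summable_geometric)
  also have "\<dots> < \<infinity>" by simp
  finally have "AE x in lebesgue. s x \<noteq> \<infinity>"
    by (intro nn_integral_PInf_AE) (auto simp: s_def)
  then have conv: "AE x in lebesgue. convergent (\<lambda>n. rep2 (Y n) x)"
    by eventually_elim (auto simp: s_def intro: convergent_of_summable_sq_diff)
  define F where "F x = lim (\<lambda>n. rep2 (Y n) x)" for x
  have Fm [measurable]: "F \<in> borel_measurable lebesgue"
    unfolding F_def by (rule borel_measurable_lim_metric) simp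
  have lim: "AE x in lebesgue. (\<lambda>n. rep2 (Y n) x) \<longlonglongrightarrow> F x"
    using conv by eventually_elim (simp add: F_def convergent_LIMSEQ_iff)
  have fatou: "(\<integral>\<^sup>+x. ennreal ((F x - rep2 (Y n) x)\<^sup>2) \<partial>lebesgue) \<le> ennreal (e\<^sup>2)"
    if n: "\<And>m. m \<ge> n \<Longrightarrow> norm (Y m - Y n) \<le> e" for n e
  proof -
    have "(\<integral>\<^sup>+x. ennreal ((F x - rep2 (Y n) x)\<^sup>2) \<partial>lebesgue)
        = (\<integral>\<^sup>+x. liminf (\<lambda>m. ennreal ((rep2 (Y m) x - rep2 (Y n) x)\<^sup>2)) \<partial>lebesgue)"
    proof (rule nn_integral_cong_AE)
      show "AE x in lebesgue. ennreal ((F x - rep2 (Y n) x)\<^sup>2)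
          = liminf (\<lambda>m. ennreal ((rep2 (Y m) x - rep2 (Y n) x)\<^sup>2))"
        using lim
      proof eventually_elim
        case (elim x)
        then have "(\<lambda>m. ennreal ((rep2 (Y m) x - rep2 (Y n) x)\<^sup>2))
            \<longlonglongrightarrow> ennreal ((F x - rep2 (Y n) x)\<^sup>2)"
          by (intro tendsto_intros)
        then show ?case by (rule lim_imp_Liminf[OF trivial_limit_sequentially, symmetric])
      qed
    qed
    also have "\<dots> \<le> liminf (\<lambda>m. \<integral>\<^sup>+x. ennreal ((rep2 (Y m) x - rep2 (Y n) x)\<^sup>2) \<partial>lebesgue)"
      by (rule nn_integral_liminf) simp
    also have "\<dots> = liminf (\<lambda>m. ennreal ((norm (Y m - Y n))\<^sup>2))"
      by (simp add: nn_integral_rep2_diff)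
    also have "\<dots> \<le> liminf (\<lambda>m. ennreal (e\<^sup>2))"
      by (rule Liminf_mono)
        (auto simp: eventually_sequentially intro!: exI[of _ n] ennreal_leI power_mono n)
    also have "\<dots> = ennreal (e\<^sup>2)" by (simp add: Liminf_const)
    finally show ?thesis .
  qed
  have e: "\<exists>n0. \<forall>n\<ge>n0. \<forall>m\<ge>n. norm (Y m - Y n) \<le> e" if e: "e > 0" for e
  proof -
    obtain n0 where "\<forall>m\<ge>n0. \<forall>n\<ge>n0. dist (Y m) (Y n) < e"
      using metric_CauchyD[OF CY e] by blast
    then show ?thesis by (intro exI[of _ n0]) (auto simp: dist_norm intro: less_imp_le)
  qed
  obtain n1 where n1: "\<And>m. m \<ge> n1 \<Longrightarrow> norm (Y m - Y n1) \<le> 1"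
    using e[OF zero_less_one] by blast
  have "integrable lebesgue (\<lambda>x. (F x - rep2 (Y n1) x)\<^sup>2)"
  proof (rule integrableI_bounded)
    have "(\<integral>\<^sup>+x. ennreal ((F x - rep2 (Y n1) x)\<^sup>2) \<partial>lebesgue) \<le> ennreal (1\<^sup>2)"
      using n1 by (rule fatou)
    also have "\<dots> < \<infinity>" by simp
    finally show "(\<integral>\<^sup>+x. ennreal (norm ((F x - rep2 (Y n1) x)\<^sup>2)) \<partial>lebesgue) < \<infinity>" by simp
  qed simp
  \<comment> \<open>Fatou's lemma controls only the difference to one fixed member of the sequence;
    adding that member back gives square integrability of \<open>F\<close> itself.\<close>
  then have "sq_integrable (\<lambda>x. F x - rep2 (Y n1) x)" by (simp add: sq_integrable_def)
  from sq_integrable_plus[OF this sq_integrable_rep2[of "Y n1"]]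
  have F: "sq_integrable F" by simp
  have "norm (Y n - to_l2 F) \<le> e" if "\<And>m. m \<ge> n \<Longrightarrow> norm (Y m - Y n) \<le> e" "e > 0" for n e
  proof -
    have "ennreal ((norm (to_l2 F - Y n))\<^sup>2)
        = (\<integral>\<^sup>+x. ennreal ((F x - rep2 (Y n) x)\<^sup>2) \<partial>lebesgue)"
      unfolding nn_integral_rep2_diff[symmetric]
    proof (rule nn_integral_cong_AE)
      show "AE x in lebesgue. ennreal ((rep2 (to_l2 F) x - rep2 (Y n) x)\<^sup>2)
          = ennreal ((F x - rep2 (Y n) x)\<^sup>2)"
        using rep2_to_l2[OF F] by eventually_elim simp
    qed
    also have "\<dots> \<le> ennreal (e\<^sup>2)" by (rule fatou[OF that(1)])
    finally have "(norm (to_l2 F - Y n))\<^sup>2 \<le> e\<^sup>2"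
      by (rule iffD1[OF ennreal_le_iff[OF zero_le_power2]])
    then have "norm (to_l2 F - Y n) \<le> e"
      by (rule power2_le_imp_le[OF _ less_imp_le[OF that(2)]])
    then show ?thesis using norm_minus_commute[of "to_l2 F" "Y n"] by argo
  qed
  note * = this
  have lim_le: "\<And>d. d > 0 \<Longrightarrow> \<exists>n0. \<forall>n\<ge>n0. norm (Y n - to_l2 F) \<le> d"
  proof -
    fix d :: real assume d: "d > 0"
    obtain n0 where n0: "\<forall>n\<ge>n0. \<forall>m\<ge>n. norm (Y m - Y n) \<le> d"
      using e[OF d] ..
    have "norm (Y n - to_l2 F) \<le> d" if "n \<ge> n0" for n
      using *[OF _ d] n0 that by blast
    then show "\<exists>n0. \<forall>n\<ge>n0. norm (Y n - to_l2 F) \<le> d" by blast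
  qed
  have "Y \<longlonglongrightarrow> to_l2 F"
  proof (rule LIMSEQ_I)
    fix d :: real assume "d > 0"
    then obtain n0 where "\<forall>n\<ge>n0. norm (Y n - to_l2 F) \<le> d / 2"
      using lim_le[OF half_gt_zero] by blast
    moreover have "d / 2 < d" using \<open>d > 0\<close> by simp
    ultimately show "\<exists>n0. \<forall>n\<ge>n0. norm (Y n - to_l2 F) < d"
      using le_less_trans by blast
  qed
  then have "X \<longlonglongrightarrow> to_l2 F"
    unfolding Y_def by (rule Cauchy_converges_subseq[OF X sr])
  then show "convergent X" by (rule convergentI)
qed

instance l2 :: banach ..

section \<open>Lebesgue integrals over triangles and intervals\<close>

text \<open>A countable Borel cover of finite measure serves the completed measure as well; Fubini's
  theorem is applied to the latter.\<close>

lemma sigma_finite_lebesgue: "sigma_finite_measure (lebesgue :: real measure)"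
proof
  obtain A :: "real set set" where A: "countable A" "A \<subseteq> sets lborel" "\<Union>A = space lborel"
      "\<forall>a\<in>A. emeasure lborel a \<noteq> \<infinity>"
    using sigma_finite_measure.sigma_finite_countable[OF sigma_finite_lborel] by blast
  then have "a \<in> sets lebesgue" "emeasure lebesgue a \<noteq> \<infinity>" if "a \<in> A" for a
    using that by (auto simp: subset_iff)
  with A show "\<exists>A::real set set. countable A \<and> A \<subseteq> sets lebesgue \<and> \<Union>A = space lebesgue \<and>
      (\<forall>a\<in>A. emeasure lebesgue a \<noteq> \<infinity>)"
    by (intro exI[of _ A]) auto
qed

interpretation lebesgue_pair: pair_sigma_finite "lebesgue :: real measure" "lebesgue :: real measure"
  by (intro pair_sigma_finite.intro sigma_finite_lebesgue)

lemma measurable_triangle [measurable]: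
  "Measurable.pred (lebesgue \<Otimes>\<^sub>M lebesgue) (\<lambda>p. snd p \<in> {..fst p :: real})"
  "Measurable.pred (lebesgue \<Otimes>\<^sub>M lebesgue) (\<lambda>p. snd p \<in> {fst p :: real..})"
proof -
  have id: "(\<lambda>x::real. x) \<in> borel_measurable lebesgue" by (intro measurable_completion) simp
  have [measurable]: "(\<lambda>p. fst p) \<in> borel_measurable ((lebesgue :: real measure) \<Otimes>\<^sub>M (lebesgue :: real measure))"
    by (rule measurable_compose[OF measurable_fst id])
  have [measurable]: "(\<lambda>p. snd p) \<in> borel_measurable ((lebesgue :: real measure) \<Otimes>\<^sub>M (lebesgue :: real measure))"
    by (rule measurable_compose[OF measurable_snd id])
  show "Measurable.pred (lebesgue \<Otimes>\<^sub>M lebesgue) (\<lambda>p. snd p \<in> {..fst p :: real})"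
    "Measurable.pred (lebesgue \<Otimes>\<^sub>M lebesgue) (\<lambda>p. snd p \<in> {fst p :: real..})"
    by simp_all
qed

text \<open>Integration by parts in integrated form: with \<open>A\<close> and \<open>B\<close> the
  primitives of \<open>a\<close> and \<open>b\<close> from minus infinity, the left side is the
  integral of \<open>A' B + A B'\<close>. After Fubini the second term is an integral over the
  triangle above the diagonal, and the two triangles cover the plane with only a null set in
  common.\<close>

lemma fubini_triangle:
  fixes a b :: "real \<Rightarrow> real"
  assumes a: "integrable lebesgue a" and b: "integrable lebesgue b"
  shows "(LINT x|lebesgue. a x * (LINT y|lebesgue. indicator {..x} y * b y))
       + (LINT x|lebesgue. b x * (LINT y|lebesgue. indicator {..x} y * a y))
       = (LINT x|lebesgue. a x) * (LINT x|lebesgue. b x)"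
proof -
  have [measurable]: "a \<in> borel_measurable lebesgue" "b \<in> borel_measurable lebesgue"
    using a b by (auto dest: borel_measurable_integrable)
  have int: "integrable (lebesgue \<Otimes>\<^sub>M lebesgue) (\<lambda>(x, y). f x * h y)"
    if f: "integrable lebesgue f" and h: "integrable lebesgue h" for f h :: "real \<Rightarrow> real"
  proof (rule lebesgue_pair.Fubini_integrable)
    have [measurable]: "f \<in> borel_measurable lebesgue" "h \<in> borel_measurable lebesgue"
      using f h by (auto dest: borel_measurable_integrable)
    show "(\<lambda>(x, y). f x * h y) \<in> borel_measurable (lebesgue \<Otimes>\<^sub>M lebesgue)" by measurable
    show "integrable lebesgue (\<lambda>x. LINT y|lebesgue. norm (case (x, y) of (x, y) \<Rightarrow> f x * h y))"
      using f by (simp add: abs_mult)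
    show "AE x in lebesgue. integrable lebesgue (\<lambda>y. case (x, y) of (x, y) \<Rightarrow> f x * h y)"
      using h by simp
  qed
  have intA: "integrable (lebesgue \<Otimes>\<^sub>M lebesgue) (\<lambda>(x, y). f x * (indicator (A x) y * h y))"
    if f: "integrable lebesgue f" and h: "integrable lebesgue h"
      and A: "Measurable.pred (lebesgue \<Otimes>\<^sub>M lebesgue) (\<lambda>p. snd p \<in> A (fst p))"
    for f h :: "real \<Rightarrow> real" and A
  proof (rule Bochner_Integration.integrable_bound[OF int[OF f h]])
    have [measurable]: "f \<in> borel_measurable lebesgue" "h \<in> borel_measurable lebesgue"
      using f h by (auto dest: borel_measurable_integrable)
    note A [measurable]
    show "(\<lambda>(x, y). f x * (indicat_real (A x) y * h y)) \<in> borel_measurable (lebesgue \<Otimes>\<^sub>M lebesgue)"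
      by measurable
    show "AE p in lebesgue \<Otimes>\<^sub>M lebesgue. norm (case p of (x, y) \<Rightarrow> f x * (indicat_real (A x) y * h y))
        \<le> norm (case p of (x, y) \<Rightarrow> f x * h y)"
      by (rule AE_I2) (auto simp: indicator_def)
  qed
  note g = intA[OF b a measurable_triangle(1)]
  have ib: "integrable lebesgue (\<lambda>y. indicat_real A y * b y)" if "A \<in> sets lebesgue" for A
    using integrable_mult_indicator[of A lebesgue b] that b by simp
  have "(LINT x|lebesgue. b x * (LINT y|lebesgue. indicator {..x} y * a y))
      = (LINT x|lebesgue. (LINT y|lebesgue. b x * (indicator {..x} y * a y)))"
    by simp
  also have "\<dots> = (LINT y|lebesgue. (LINT x|lebesgue. b x * (indicator {..x} y * a y)))"
    using lebesgue_pair.Fubini_integral[OF g] by simp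
  also have "\<dots> = (LINT y|lebesgue. a y * (LINT x|lebesgue. indicator {y..} x * b x))"
    by (subst integral_mult_right_zero[symmetric], intro Bochner_Integration.integral_cong refl)
      (auto simp: indicator_def)
  finally have 1: "(LINT x|lebesgue. b x * (LINT y|lebesgue. indicator {..x} y * a y))
      = (LINT x|lebesgue. a x * (LINT y|lebesgue. indicator {x..} y * b y))" .
  have iL: "integrable lebesgue (\<lambda>x. a x * (LINT y|lebesgue. indicator {..x} y * b y))"
    and iR: "integrable lebesgue (\<lambda>x. a x * (LINT y|lebesgue. indicator {x..} y * b y))"
    using lebesgue_pair.integrable_fst[OF intA[OF a b measurable_triangle(1)]]
      lebesgue_pair.integrable_fst[OF intA[OF a b measurable_triangle(2)]] by simp_all
  have "(LINT x|lebesgue. a x * (LINT y|lebesgue. indicator {..x} y * b y))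
      + (LINT x|lebesgue. b x * (LINT y|lebesgue. indicator {..x} y * a y))
      = (LINT x|lebesgue. a x * (LINT y|lebesgue. indicator {..x} y * b y)
                      + a x * (LINT y|lebesgue. indicator {x..} y * b y))"
    unfolding 1 using iL iR by simp
  also have "\<dots> = (LINT x|lebesgue. a x * (LINT y|lebesgue. b y))"
  proof (rule Bochner_Integration.integral_cong)
    fix x
    have "(LINT y|lebesgue. indicator {..x} y * b y) + (LINT y|lebesgue. indicator {x..} y * b y)
        = (LINT y|lebesgue. indicator {..x} y * b y + indicator {x..} y * b y)"
      using ib by simp
    also have "\<dots> = (LINT y|lebesgue. b y)"
    proof (rule integral_cong_AE)
      show "AE y in lebesgue. indicator {..x} y * b y + indicator {x..} y * b y = b y"
        using AE_completion[OF AE_lborel_singleton[of x]] by eventually_elim (auto simp: indicator_def)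
      show "(\<lambda>y. indicator {..x} y * b y + indicator {x..} y * b y) \<in> borel_measurable lebesgue"
        by (intro borel_measurable_add borel_measurable_integrable ib) simp_all
    qed simp
    finally show "a x * (LINT y|lebesgue. indicator {..x} y * b y)
        + a x * (LINT y|lebesgue. indicator {x..} y * b y) = a x * (LINT y|lebesgue. b y)"
      by (metis distrib_left)
  qed simp
  finally show ?thesis by simp
qed

text \<open>Closed intervals generate the Borel sets, and the sets over which \<open>h\<close>
  integrates to 0 are closed under disjoint countable unions and, because the total integral
  vanishes, under complements. A Lebesgue set differs from a Borel set by a null set.\<close>

lemma AE_zero_if_integral_Icc_zero:
  fixes h :: "real \<Rightarrow> real"
  assumes h: "integrable lebesgue h" and total: "(LINT x|lebesgue. h x) = 0"
    and Icc: "\<And>a b. a \<le> b \<Longrightarrow> (LINT x:{a..b}|lebesgue. h x) = 0"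
  shows "AE x in lebesgue. h x = 0"
proof (rule sigma_finite_measure.density_zero[OF sigma_finite_lebesgue h])
  have si: "set_integrable lebesgue A h" if "A \<in> sets lebesgue" for A
    unfolding set_integrable_def by (rule integrable_mult_indicator[OF that h])
  have borel: "(LINT x:A|lebesgue. h x) = 0" if "A \<in> sets borel" for A
    using that
  proof (induction A rule: borel_set_induct)
    case (compl A)
    have "(LINT x:-A|lebesgue. h x) = (LINT x|lebesgue. h x - indicator A x *\<^sub>R h x)"
      unfolding set_lebesgue_integral_def
      by (intro Bochner_Integration.integral_cong) (auto simp: indicator_def)
    also have "\<dots> = 0"
      using h si[of A] compl total
      by (subst Bochner_Integration.integral_diff) (auto simp: set_integrable_def set_lebesgue_integral_def)
    finally show ?case .
  next
    case (union f)
    then have "(LINT x:(\<Union>i. f i)|lebesgue. h x) = (\<Sum>i. LINT x:f i|lebesgue. h x)"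
      by (intro lebesgue_integral_countable_add si) (auto simp: disjoint_family_on_def)
    then show ?case using union by simp
  qed (simp add: set_lebesgue_integral_def, rule Icc)
  fix A :: "real set" assume A: "A \<in> sets lebesgue"
  then obtain B N N' where B: "A = B \<union> N" "N \<subseteq> N'" "N' \<in> null_sets lborel" "B \<in> sets lborel"
    by (rule sets_completionE)
  have "(LINT x:A|lebesgue. h x) = (LINT x:B|lebesgue. h x)"
    unfolding set_lebesgue_integral_def
  proof (rule integral_cong_AE)
    show "AE x in lebesgue. indicator A x *\<^sub>R h x = indicator B x *\<^sub>R h x"
      using AE_completion[OF AE_not_in[OF B(3)]] by eventually_elim (use B in \<open>auto simp: indicator_def\<close>)
  qed (use si[of A] si[of B] A B in \<open>auto simp: set_integrable_def intro: borel_measurable_integrable\<close>)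
  then show "(LINT x:A|lebesgue. h x) = 0" using borel B(4) by simp
qed

section \<open>Sobolev functions on an interval\<close>

lemma L2_iff: "f \<in> L2 l \<longleftrightarrow> sq_integrable (rep_L0 f) \<and>
    (AE x in lebesgue. x \<notin> {0<..<l} \<longrightarrow> rep_L0 f x = 0)"
  by (auto simp: L2_def sq_integrable_def)

lemma integrable_indicator_Ioo: "integrable lebesgue (indicat_real {a<..<b::real})"
proof (rule integrable_real_indicator)
  show "emeasure lebesgue {a<..<b} < \<infinity>"
    using emeasure_bounded_finite[OF bounded_Ioo[of a b]] by simp
qed simp

lemma sq_integrable_indicator: "sq_integrable (indicat_real {a<..<b})"
proof -
  have "(\<lambda>x. (indicat_real {a<..<b} x)\<^sup>2) = indicat_real {a<..<b}"
    by (auto simp: indicator_def)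
  then show ?thesis
    by (simp add: sq_integrable_def borel_measurable_indicator integrable_indicator_Ioo)
qed

lemma L2_integrable:
  assumes "f \<in> L2 l"
  shows "integrable lebesgue (rep_L0 f)"
proof -
  have "integrable lebesgue (\<lambda>x. indicator {0<..<l} x * rep_L0 f x)"
    using assms by (intro sq_integrable_mult sq_integrable_indicator) (simp add: L2_iff)
  moreover have "AE x in lebesgue. indicator {0<..<l} x * rep_L0 f x = rep_L0 f x"
    using assms unfolding L2_iff by (elim conjE eventually_mono) (auto simp: indicator_def)
  ultimately show ?thesis
    by (subst integrable_cong_AE[where g="\<lambda>x. indicator {0<..<l} x * rep_L0 f x"])
      (auto simp: borel_measurable_integrable elim: eventually_mono)
qed

lemma measurable_indicator_rep_L0 [simp]:
  assumes "A \<in> sets lebesgue"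
  shows "(\<lambda>x. indicat_real A x * rep_L0 f x) \<in> borel_measurable lebesgue"
  by (rule borel_measurable_times[OF borel_measurable_indicator[OF assms] rep_L0_measurable])

lemma L2_set_integrable:
  assumes "f \<in> L2 l" "A \<in> sets lebesgue"
  shows "set_integrable lebesgue A (rep_L0 f)"
  unfolding set_integrable_def
  by (rule integrable_mult_indicator[OF assms(2) L2_integrable[OF assms(1)]])

lemma L2_zero: "0 \<in> L2 l"
  using rep_L0_zero by (simp add: L2_iff sq_integrable_rep_L0) (elim eventually_mono, simp)

lemma L2_plus:
  assumes "f \<in> L2 l" "g \<in> L2 l"
  shows "f + g \<in> L2 l"
proof -
  have "AE x in lebesgue. x \<notin> {0<..<l} \<longrightarrow> rep_L0 (f + g) x = 0"
    using assms[unfolded L2_iff, THEN conjunct2] rep_L0_plus[of f g] by eventually_elim simp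
  then show ?thesis using assms by (simp add: L2_iff sq_integrable_rep_L0)
qed

lemma L2_scaleR:
  assumes "f \<in> L2 l"
  shows "r *\<^sub>R f \<in> L2 l"
proof -
  have "AE x in lebesgue. x \<notin> {0<..<l} \<longrightarrow> rep_L0 (r *\<^sub>R f) x = 0"
    using assms[unfolded L2_iff, THEN conjunct2] rep_L0_scaleR[of r f] by eventually_elim simp
  then show ?thesis using assms by (simp add: L2_iff sq_integrable_rep_L0)
qed

lemma abs_L0_L2:
  assumes "sq_integrable f" "\<And>x. x \<notin> {0<..<l} \<Longrightarrow> f x = 0"
  shows "abs_L0 f \<in> L2 l"
proof -
  have ae: "AE x in lebesgue. rep_L0 (abs_L0 f) x = f x"
    using assms by (intro rep_abs_L0) (simp add: sq_integrable_def)
  then have "sq_integrable (rep_L0 (abs_L0 f))"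
    by (intro sq_integrable_cong_AE[OF assms(1)]) auto
  moreover have "AE x in lebesgue. x \<notin> {0<..<l} \<longrightarrow> rep_L0 (abs_L0 f) x = 0"
    using ae by eventually_elim (simp add: assms(2))
  ultimately show ?thesis by (simp add: L2_iff)
qed

definition prim :: "L0 \<Rightarrow> real \<Rightarrow> real" where
  "prim g x = (LINT s:{0..x}|lebesgue. rep_L0 g s)"

lemma prim_0: "prim g 0 = 0"
proof -
  have "AE x in lebesgue. x \<noteq> (0::real)"
    by (rule AE_completion) (rule AE_lborel_singleton)
  then show ?thesis
    unfolding prim_def set_lebesgue_integral_def
    by (intro integral_eq_zero_AE) (elim eventually_mono, simp)
qed

text \<open>The half-line form is the one that fits \<open>fubini_triangle\<close>; it agrees
  because members of \<open>L2 l\<close> vanish to the left of 0.\<close>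

lemma prim_eq_atMost:
  assumes "g \<in> L2 l"
  shows "prim g x = (LINT s|lebesgue. indicator {..x} s * rep_L0 g s)"
  unfolding prim_def set_lebesgue_integral_def
proof (rule integral_cong_AE)
  show "AE s in lebesgue. indicat_real {0..x} s *\<^sub>R rep_L0 g s = indicator {..x} s * rep_L0 g s"
    using assms[unfolded L2_iff, THEN conjunct2] by eventually_elim (auto simp: indicator_def)
qed simp_all

lemma prim_eq_l:
  assumes "g \<in> L2 l" "l \<le> x"
  shows "prim g x = (LINT s|lebesgue. rep_L0 g s)"
  unfolding prim_eq_atMost[OF assms(1)]
proof (rule integral_cong_AE)
  show "AE s in lebesgue. indicator {..x} s * rep_L0 g s = rep_L0 g s"
    using assms(1)[unfolded L2_iff, THEN conjunct2]
    by eventually_elim (use assms(2) in \<open>auto simp: indicator_def\<close>)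
qed simp_all

lemma prim_neg:
  assumes "x \<le> 0"
  shows "prim g x = 0"
  using assms by (cases "x = 0") (auto simp: prim_0, simp add: prim_def set_lebesgue_integral_def)

lemma continuous_on_prim:
  assumes "g \<in> L2 l"
  shows "continuous_on {0..l} (prim g)"
proof -
  have "prim g x = integral {0..x} (rep_L0 g)" for x
    unfolding prim_def by (rule set_lebesgue_integral_eq_integral(2)[OF L2_set_integrable[OF assms]]) simp
  moreover have "rep_L0 g integrable_on {0..l}"
    by (rule set_lebesgue_integral_eq_integral(1)[OF L2_set_integrable[OF assms]]) simp
  ultimately show ?thesis
    using indefinite_integral_continuous_1 by (simp cong: continuous_on_cong)
qed

text \<open>Uniqueness of the weak derivative: primitives that are equal on \<open>[0, l]\<close>
  are constant outside it, hence equal everywhere, and their increments are the integrals over all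
  intervals.\<close>

lemma L2_eq_if_prim_eq:
  assumes f: "f \<in> L2 l" and g: "g \<in> L2 l" and eq: "\<And>x. x \<in> {0..l} \<Longrightarrow> prim f x = prim g x" and l: "0 < l"
  shows "f = g"
proof (rule L0_eqI)
  have if': "integrable lebesgue (rep_L0 f)" and ig: "integrable lebesgue (rep_L0 g)"
    using f g by (auto intro: L2_integrable)
  have eq': "prim f x = prim g x" for x
  proof -
    consider "x \<le> 0" | "x \<in> {0..l}" | "x \<ge> l" by fastforce
    then show ?thesis
    proof cases
      case 3
      then have "prim f x = prim f l" "prim g x = prim g l"
        using f g by (simp_all add: prim_eq_l)
      then show ?thesis using eq[of l] l by simp
    qed (auto simp: prim_neg eq)
  qed
  have tot: "(LINT s|lebesgue. rep_L0 f s) = (LINT s|lebesgue. rep_L0 g s)"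
    using eq'[of l] f g by (simp add: prim_eq_l)
  have "AE x in lebesgue. rep_L0 f x - rep_L0 g x = 0"
  proof (rule AE_zero_if_integral_Icc_zero)
    show "integrable lebesgue (\<lambda>x. rep_L0 f x - rep_L0 g x)" using if' ig by simp
    show "(LINT x|lebesgue. rep_L0 f x - rep_L0 g x) = 0" using if' ig tot by simp
    fix a b :: real assume ab: "a \<le> b"
    have i: "integrable lebesgue (\<lambda>s. indicator {..x} s * rep_L0 h s)" if "integrable lebesgue (rep_L0 h)" for h x
      using integrable_mult_indicator[of "{..x}" lebesgue "rep_L0 h"] that by simp
    have "(LINT y:{a..b}|lebesgue. rep_L0 f y - rep_L0 g y)
        = (LINT y|lebesgue. (indicator {..b} y * rep_L0 f y - indicator {..b} y * rep_L0 g y)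
            - (indicator {..a} y * rep_L0 f y - indicator {..a} y * rep_L0 g y))"
      unfolding set_lebesgue_integral_def
    proof (rule integral_cong_AE)
      show "AE y in lebesgue. indicat_real {a..b} y *\<^sub>R (rep_L0 f y - rep_L0 g y)
          = (indicator {..b} y * rep_L0 f y - indicator {..b} y * rep_L0 g y)
            - (indicator {..a} y * rep_L0 f y - indicator {..a} y * rep_L0 g y)"
        using AE_completion[OF AE_lborel_singleton[of a]]
        by eventually_elim (use ab in \<open>auto simp: indicator_def\<close>)
    qed (auto intro!: borel_measurable_diff simp: right_diff_distrib)
    also have "\<dots> = 0"
      using if' ig eq'[of a] eq'[of b] by (simp add: i prim_eq_atMost[OF f] prim_eq_atMost[OF g])
    finally show "(LINT y:{a..b}|lebesgue. rep_L0 f y - rep_L0 g y) = 0" .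
  qed
  then show "AE x in lebesgue. rep_L0 f x = rep_L0 g x" by eventually_elim simp
qed

text \<open>The coincidence set is closed and contains almost every point of the open interval,
  hence the whole interval and its end points. This makes \<open>val\<close> well defined at the end
  points too.\<close>

lemma continuous_eq_if_AE_eq:
  fixes F G :: "real \<Rightarrow> real"
  assumes F: "continuous_on {0..l} F" and G: "continuous_on {0..l} G" and l: "0 < l"
    and ae: "AE x in lebesgue. x \<in> {0<..<l} \<longrightarrow> F x = G x" and x: "x \<in> {0..l}"
  shows "F x = G x"
proof -
  let ?C = "{x \<in> {0..l}. F x - G x = 0}"
  have c: "closed ?C"
    using continuous_closed_preimage_constant[OF continuous_on_diff[OF F G], of 0] by simp
  have "AE x \<in> {0<..<l} in lebesgue. x \<in> ?C"
    using ae by eventually_elim auto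
  then have "y \<in> ?C" if "y \<in> {0<..<l}" for y
    using mem_closed_if_AE_lebesgue_open[OF open_greaterThanLessThan c] that by blast
  then have "{0<..<l} \<subseteq> ?C" by blast
  then have "closure {0<..<l} \<subseteq> ?C" using c by (simp add: closure_minimal)
  then show ?thesis using x l by (auto simp: closure_greaterThanLessThan)
qed

lemma val_eq:
  assumes F: "continuous_on {0..l} F" and l: "0 < l"
    and ae: "AE s in lebesgue. s \<in> {0<..<l} \<longrightarrow> rep_L0 f s = F s" and x: "x \<in> {0..l}"
  shows "val l f x = F x"
  unfolding val_def
proof (rule the_equality)
  show "\<exists>F'. continuous_on {0..l} F' \<and> (AE s in lebesgue. s \<in> {0<..<l} \<longrightarrow> rep_L0 f s = F' s) \<and> F x = F' x"
    using F ae by blast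
next
  fix y
  assume "\<exists>F'. continuous_on {0..l} F' \<and> (AE s in lebesgue. s \<in> {0<..<l} \<longrightarrow> rep_L0 f s = F' s) \<and> y = F' x"
  then obtain F' where F': "continuous_on {0..l} F'"
      "AE s in lebesgue. s \<in> {0<..<l} \<longrightarrow> rep_L0 f s = F' s" and y: "y = F' x" by blast
  have "AE s in lebesgue. s \<in> {0<..<l} \<longrightarrow> F s = F' s"
    using ae F'(2) by eventually_elim auto
  then show "y = F x" unfolding y using continuous_eq_if_AE_eq[OF F F'(1) l _ x] by simp
qed

lemma has_L2_derivI:
  assumes "f \<in> L2 l" "g \<in> L2 l" "AE s in lebesgue. s \<in> {0<..<l} \<longrightarrow> rep_L0 f s = c + prim g s"
  shows "has_L2_deriv l f g"
  unfolding has_L2_deriv_def using assms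
  by (intro conjI exI[of _ "\<lambda>x. c + prim g x"]) (simp_all add: prim_0 flip: prim_def)

context
  fixes l :: real
  assumes l: "0 < l"
begin

lemma has_L2_derivD:
  assumes "has_L2_deriv l f g"
  shows "f \<in> L2 l" "g \<in> L2 l"
    and "x \<in> {0..l} \<Longrightarrow> val l f x = val l f 0 + prim g x"
    and "AE s in lebesgue. s \<in> {0<..<l} \<longrightarrow> rep_L0 f s = val l f 0 + prim g s"
proof -
  show fg: "f \<in> L2 l" "g \<in> L2 l" using assms by (auto simp: has_L2_deriv_def)
  obtain F where F: "AE s in lebesgue. s \<in> {0<..<l} \<longrightarrow> rep_L0 f s = F s"
      "\<forall>x\<in>{0..l}. F x = F 0 + prim g x"
    using assms unfolding has_L2_deriv_def prim_def by blast
  have "continuous_on {0..l} (\<lambda>x. F 0 + prim g x)"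
    by (intro continuous_intros continuous_on_prim fg)
  moreover have ae: "AE s in lebesgue. s \<in> {0<..<l} \<longrightarrow> rep_L0 f s = F 0 + prim g s"
    using F(1)
  proof eventually_elim
    case (elim s)
    then show ?case using F(2)[rule_format, of s] by auto
  qed
  ultimately have v: "val l f x = F 0 + prim g x" if "x \<in> {0..l}" for x
    using that l by (intro val_eq) auto
  then have "val l f 0 = F 0" using l by (simp add: prim_0)
  then show "x \<in> {0..l} \<Longrightarrow> val l f x = val l f 0 + prim g x"
    "AE s in lebesgue. s \<in> {0<..<l} \<longrightarrow> rep_L0 f s = val l f 0 + prim g s"
    using v ae by auto
qed

lemma has_L2_deriv_unique:
  assumes "has_L2_deriv l f g" "has_L2_deriv l f g'"
  shows "g = g'"
proof (rule L2_eq_if_prim_eq[OF has_L2_derivD(2)[OF assms(1)] has_L2_derivD(2)[OF assms(2)] _ l])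
  fix x assume x: "x \<in> {0..l}"
  show "prim g x = prim g' x"
    using has_L2_derivD(3)[OF assms(1) x] has_L2_derivD(3)[OF assms(2) x] by simp
qed

lemma Dx_eq: "has_L2_deriv l f g \<Longrightarrow> Dx l f = g"
  unfolding Dx_def by (rule the_equality) (auto dest: has_L2_deriv_unique)

lemma prim_plus:
  assumes "f \<in> L2 l" "g \<in> L2 l"
  shows "prim (f + g) x = prim f x + prim g x"
proof -
  have "prim (f + g) x = (LINT s|lebesgue. indicator {0..x} s *\<^sub>R rep_L0 f s + indicator {0..x} s *\<^sub>R rep_L0 g s)"
    unfolding prim_def set_lebesgue_integral_def
  proof (rule integral_cong_AE)
    show "AE s in lebesgue. indicator {0..x} s *\<^sub>R rep_L0 (f + g) s
        = indicator {0..x} s *\<^sub>R rep_L0 f s + indicator {0..x} s *\<^sub>R rep_L0 g s"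
      using rep_L0_plus[of f g] by eventually_elim (simp add: algebra_simps)
  qed (simp_all add: borel_measurable_add)
  also have "\<dots> = prim f x + prim g x"
    unfolding prim_def set_lebesgue_integral_def
    using L2_set_integrable[OF assms(1), of "{0..x}"] L2_set_integrable[OF assms(2), of "{0..x}"]
    by (intro Bochner_Integration.integral_add) (auto simp: set_integrable_def)
  finally show ?thesis .
qed

lemma prim_scaleR: "prim (r *\<^sub>R f) x = r * prim f x"
proof -
  have "prim (r *\<^sub>R f) x = (LINT s|lebesgue. r * (indicator {0..x} s *\<^sub>R rep_L0 f s))"
    unfolding prim_def set_lebesgue_integral_def
  proof (rule integral_cong_AE)
    show "AE s in lebesgue. indicator {0..x} s *\<^sub>R rep_L0 (r *\<^sub>R f) s = r * (indicator {0..x} s *\<^sub>R rep_L0 f s)"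
      using rep_L0_scaleR[of r f] by eventually_elim simp
  qed (simp_all add: borel_measurable_times)
  then show ?thesis by (simp add: prim_def set_lebesgue_integral_def)
qed

lemma has_L2_deriv_lincomb:
  assumes "has_L2_deriv l f f'" "has_L2_deriv l g g'"
  shows "has_L2_deriv l (f + r *\<^sub>R g) (f' + r *\<^sub>R g')"
    and "x \<in> {0..l} \<Longrightarrow> val l (f + r *\<^sub>R g) x = val l f x + r * val l g x"
proof -
  note f = has_L2_derivD[OF assms(1)] and g = has_L2_derivD[OF assms(2)]
  note L2 = L2_plus[OF f(1) L2_scaleR[OF g(1)]] L2_plus[OF f(2) L2_scaleR[OF g(2)]]
  have prim: "prim (f' + r *\<^sub>R g') s = prim f' s + r * prim g' s" for s
    by (simp add: prim_plus[OF f(2) L2_scaleR[OF g(2)]] prim_scaleR)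
  have ae: "AE s in lebesgue. s \<in> {0<..<l} \<longrightarrow>
      rep_L0 (f + r *\<^sub>R g) s = (val l f 0 + r * val l g 0) + prim (f' + r *\<^sub>R g') s"
    using f(4) g(4) rep_L0_plus[of f "r *\<^sub>R g"] rep_L0_scaleR[of r g]
    by eventually_elim (simp add: prim algebra_simps)
  show "has_L2_deriv l (f + r *\<^sub>R g) (f' + r *\<^sub>R g')"
    by (rule has_L2_derivI[OF L2 ae])
  have c: "continuous_on {0..l} (\<lambda>s. (val l f 0 + r * val l g 0) + prim (f' + r *\<^sub>R g') s)"
    by (intro continuous_intros continuous_on_prim[OF L2(2)])
  show "val l (f + r *\<^sub>R g) x = val l f x + r * val l g x" if "x \<in> {0..l}"
    using val_eq[OF c l ae that] f(3)[OF that] g(3)[OF that] by (simp add: prim algebra_simps)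
qed

lemma Sobolev_SucD:
  assumes "f \<in> Sobolev l (Suc n)"
  shows "has_L2_deriv l f (Dx l f)" "Dx l f \<in> Sobolev l n"
  using assms Dx_eq by auto

lemma L2_antiderivative:
  assumes g: "g \<in> L2 l"
  shows "\<exists>f. has_L2_deriv l f g \<and> val l f 0 = 0"
proof -
  define F where "F x = indicator {0<..<l} x * prim g x" for x
  have c: "continuous_on {0..l} (prim g)" by (rule continuous_on_prim[OF g])
  have "continuous_on {0<..<l} (prim g)" by (rule continuous_on_subset[OF c]) auto
  then have "(\<lambda>x. indicator {0<..<l} x *\<^sub>R prim g x) \<in> borel_measurable borel"
    by (intro borel_measurable_continuous_on_indicator) auto
  then have Fm: "F \<in> borel_measurable lebesgue"
    unfolding F_def by (intro measurable_completion) simp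
  obtain C where C: "\<And>x. x \<in> {0..l} \<Longrightarrow> norm (prim g x) \<le> C"
    using compact_imp_bounded[OF compact_continuous_image[OF c compact_Icc]] unfolding bounded_iff by blast
  have "sq_integrable F"
    unfolding sq_integrable_def
  proof (rule conjI[OF Fm], rule Bochner_Integration.integrable_bound)
    show "integrable lebesgue (\<lambda>x. C\<^sup>2 * indicat_real {0<..<l} x)"
      by (simp add: integrable_indicator_Ioo)
    show "AE x in lebesgue. norm ((F x)\<^sup>2) \<le> norm (C\<^sup>2 * indicat_real {0<..<l} x)"
    proof (rule AE_I2)
      fix x
      show "norm ((F x)\<^sup>2) \<le> norm (C\<^sup>2 * indicat_real {0<..<l} x)"
      proof (cases "x \<in> {0<..<l}")
        case True
        then have "\<bar>prim g x\<bar> \<le> C" using C[of x] by auto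
        then have "(prim g x)\<^sup>2 \<le> C\<^sup>2" by (metis abs_ge_zero power2_abs power_mono)
        then show ?thesis using True by (simp add: F_def)
      qed (simp add: F_def)
    qed
  qed (use Fm in simp_all)
  then have "abs_L0 F \<in> L2 l" by (rule abs_L0_L2) (simp add: F_def)
  moreover have ae: "AE s in lebesgue. s \<in> {0<..<l} \<longrightarrow> rep_L0 (abs_L0 F) s = 0 + prim g s"
    using rep_abs_L0[OF Fm] by eventually_elim (auto simp: F_def)
  ultimately have "has_L2_deriv l (abs_L0 F) g" using g by (intro has_L2_derivI) auto
  moreover have "val l (abs_L0 F) 0 = 0"
    using val_eq[OF _ l ae, of 0] c l by (simp add: prim_0)
  ultimately show ?thesis by blast
qed

lemma L2_inner_eq:
  assumes "f \<in> L2 l" "g \<in> L2 l"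
  shows "L2_inner l f g = (LINT x|lebesgue. rep_L0 f x * rep_L0 g x)"
  unfolding L2_inner_def set_lebesgue_integral_def
proof (rule integral_cong_AE)
  show "AE x in lebesgue. indicator {0..l} x *\<^sub>R (rep_L0 f x * rep_L0 g x) = rep_L0 f x * rep_L0 g x"
    using assms(1)[unfolded L2_iff, THEN conjunct2] by eventually_elim (auto simp: indicator_def)
qed (simp_all add: borel_measurable_times borel_measurable_indicator)

lemma L2_inner_eq_inner:
  assumes "f \<in> L2 l" "g \<in> L2 l"
  shows "L2_inner l f g = inner (Abs_l2 f) (Abs_l2 g)"
  using assms by (simp add: L2_inner_eq inner_l2_def rep2_def Abs_l2_inverse L2_iff)

text \<open>Each undifferentiated factor is its value at 0 plus a primitive. The constants give
  boundary terms, and the products with primitives are the two triangles of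
  \<open>fubini_triangle\<close>.\<close>

lemma L2_inner_by_parts:
  assumes f: "has_L2_deriv l f f'" and g: "has_L2_deriv l g g'"
  shows "L2_inner l f' g + L2_inner l f g' = val l f l * val l g l - val l f 0 * val l g 0"
proof -
  note f = has_L2_derivD[OF f] and g = has_L2_derivD[OF g]
  have m: "(\<lambda>x. LINT s|lebesgue. indicator {..x} s * rep_L0 h s) \<in> borel_measurable lebesgue" for h
    by measurable
  have half: "L2_inner l h' k = val l k 0 * prim h' l + (LINT x|lebesgue. rep_L0 h' x * (LINT s|lebesgue. indicator {..x} s * rep_L0 k' s))"
    if k: "has_L2_deriv l k k'" and h': "h' \<in> L2 l" for h' k k'
  proof -
    note k = has_L2_derivD[OF k]
    have ae: "AE x in lebesgue. rep_L0 h' x * rep_L0 k x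
       = val l k 0 * rep_L0 h' x + rep_L0 h' x * (LINT s|lebesgue. indicator {..x} s * rep_L0 k' s)"
      using h'[unfolded L2_iff, THEN conjunct2] k(4)
      by eventually_elim (auto simp: prim_eq_atMost[OF k(2)] algebra_simps)
    have i1: "integrable lebesgue (\<lambda>x. val l k 0 * rep_L0 h' x)"
      using L2_integrable[OF h'] by simp
    have "integrable lebesgue (\<lambda>x. rep_L0 h' x * rep_L0 k x)"
      using h' k(1) by (intro sq_integrable_mult) (auto simp: L2_iff)
    then have "integrable lebesgue (\<lambda>x. val l k 0 * rep_L0 h' x + rep_L0 h' x * (LINT s|lebesgue. indicator {..x} s * rep_L0 k' s))"
      by (rule integrable_cong_AE_imp)
        (use ae in \<open>auto intro!: borel_measurable_add borel_measurable_times m k elim: eventually_mono\<close>)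
    from Bochner_Integration.integrable_diff[OF this i1]
    have i2: "integrable lebesgue (\<lambda>x. rep_L0 h' x * (LINT s|lebesgue. indicator {..x} s * rep_L0 k' s))"
      by simp
    have "L2_inner l h' k = (LINT x|lebesgue. val l k 0 * rep_L0 h' x + rep_L0 h' x * (LINT s|lebesgue. indicator {..x} s * rep_L0 k' s))"
      unfolding L2_inner_eq[OF h' k(1)]
      by (rule integral_cong_AE[OF _ _ ae]) (auto intro!: borel_measurable_add borel_measurable_times m k)
    also have "\<dots> = val l k 0 * prim h' l + (LINT x|lebesgue. rep_L0 h' x * (LINT s|lebesgue. indicator {..x} s * rep_L0 k' s))"
      using i1 i2 by (simp add: prim_eq_l[OF h'])
    finally show ?thesis .
  qed
  have "L2_inner l f g' = L2_inner l g' f" by (simp add: L2_inner_def mult.commute)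
  then have "L2_inner l f' g + L2_inner l f g'
      = val l g 0 * prim f' l + val l f 0 * prim g' l + prim f' l * prim g' l"
    using half[OF assms(2) f(2)] half[OF assms(1) g(2)]
      fubini_triangle[OF L2_integrable[OF f(2)] L2_integrable[OF g(2)]]
    by (simp add: prim_eq_l[OF f(2)] prim_eq_l[OF g(2)])
  moreover have "val l f l = val l f 0 + prim f' l" "val l g l = val l g 0 + prim g' l"
    using f(3)[of l] g(3)[of l] l by auto
  ultimately show ?thesis by (simp add: algebra_simps)
qed

end

section \<open>Derivatives from the right\<close>

lemma has_vector_derivative_at_right_iff:
  fixes f :: "real \<Rightarrow> 'a::real_normed_vector"
  shows "(f has_vector_derivative w) (at_right a) \<longleftrightarrow>
    ((\<lambda>k. (f (a + k) - f a) /\<^sub>R k) \<longlongrightarrow> w) (at_right 0)"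
proof -
  have "(f has_vector_derivative w) (at_right a) \<longleftrightarrow>
      ((\<lambda>u. (f u - (f a + (u - a) *\<^sub>R w)) /\<^sub>R norm (u - a)) \<longlongrightarrow> 0) (at_right a)"
    by (simp add: has_vector_derivative_def has_derivative_within bounded_linear_scaleR_left divide_inverse)
  also have "\<dots> \<longleftrightarrow> ((\<lambda>u. (f u - f a) /\<^sub>R (u - a) - w) \<longlongrightarrow> 0) (at_right a)"
  proof (rule tendsto_cong)
    have "(f u - (f a + (u - a) *\<^sub>R w)) /\<^sub>R norm (u - a) = (f u - f a) /\<^sub>R (u - a) - w" if "u > a" for u
      using that by (simp add: scaleR_diff_right scaleR_add_right)
    then show "\<forall>\<^sub>F u in at_right a. (f u - (f a + (u - a) *\<^sub>R w)) /\<^sub>R norm (u - a) = (f u - f a) /\<^sub>R (u - a) - w"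
      by (auto simp: eventually_at_filter intro!: always_eventually)
  qed
  also have "\<dots> \<longleftrightarrow> ((\<lambda>u. (f u - f a) /\<^sub>R (u - a)) \<longlongrightarrow> w) (at_right a)"
    by (rule LIM_zero_iff)
  also have "\<dots> \<longleftrightarrow> ((\<lambda>k. (f (a + k) - f a) /\<^sub>R k) \<longlongrightarrow> w) (at_right 0)"
    by (subst filterlim_at_right_to_0) (simp add: add.commute)
  finally show ?thesis .
qed

lemma right_derivative_chain:
  fixes H :: "'a::real_normed_vector \<Rightarrow> real"
  assumes H: "(H has_derivative H') (at x)"
    and g: "((\<lambda>k. (g k - x) /\<^sub>R k) \<longlongrightarrow> v) (at_right 0)"
  shows "((\<lambda>k. (H (g k) - H x) / k) \<longlongrightarrow> H' v) (at_right 0)"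
proof -
  \<comment> \<open>The value of \<open>g\<close> at 0 is not prescribed, while the chain rule needs
    a function whose value at 0 is \<open>x\<close>.\<close>
  define G where "G k = (if k \<le> 0 then x else g k)" for k :: real
  have "((\<lambda>k. (G k - G 0) /\<^sub>R k) \<longlongrightarrow> v) (at_right 0)"
    by (rule Lim_transform_eventually[OF g]) (auto simp: G_def eventually_at_right_field intro!: exI[of _ 1])
  then have "(G has_vector_derivative v) (at_right 0)"
    by (simp add: has_vector_derivative_at_right_iff)
  moreover have "(H has_derivative H') (at (G 0) within G ` {0<..})"
    using H by (simp add: G_def has_derivative_at_withinI)
  ultimately have "((H \<circ> G) has_vector_derivative H' v) (at_right 0)"
    by (rule vector_derivative_diff_chain_within)
  then have "((\<lambda>k. (H (G k) - H (G 0)) /\<^sub>R k) \<longlongrightarrow> H' v) (at_right 0)" by (simp add: has_vector_derivative_at_right_iff)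
  then show ?thesis
    by (rule Lim_transform_eventually)
      (auto simp: G_def eventually_at_right_field divide_inverse mult.commute intro!: exI[of _ 1])
qed

lemma tendsto_at_right_0_cong:
  assumes "(f \<longlongrightarrow> a) (at_right (0::real))" "\<And>k. k > 0 \<Longrightarrow> f k = g k"
  shows "(g \<longlongrightarrow> a) (at_right 0)"
  by (rule Lim_transform_eventually[OF assms(1)]) (auto simp: eventually_at_filter assms(2))

text \<open>At the last point where \<phi> lies on or below the line of slope \<open>c\<close>
  through its starting value, the hypothesis carries the comparison a little further to the right,
  unless that point is \<open>b\<close>.\<close>

lemma right_dini_increment_le:
  fixes \<phi> :: "real \<Rightarrow> real"
  assumes cont: "continuous_on {a..b} \<phi>" and "a \<le> b"
    and dini: "\<And>t. t \<in> {a..<b} \<Longrightarrow> \<exists>\<delta>>0. \<forall>k. 0 < k \<and> k < \<delta> \<longrightarrow> \<phi> (t + k) \<le> \<phi> t + c * k"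
  shows "\<phi> b \<le> \<phi> a + c * (b - a)"
proof (rule ccontr)
  assume neg: "\<not> ?thesis"
  define \<psi> where "\<psi> s = \<phi> s - \<phi> a - c * (s - a)" for s
  have \<psi>: "continuous_on {a..b} \<psi>"
    unfolding \<psi>_def by (intro continuous_intros cont)
  define A where "A = {s \<in> {a..b}. \<psi> s \<le> 0}"
  have A: "compact A" "A \<noteq> {}"
  proof -
    have "A = {a..b} \<inter> {s \<in> {a..b}. \<psi> s \<le> 0}" by (auto simp: A_def)
    moreover have "closed {s \<in> {a..b}. \<psi> s \<le> 0}"
      by (intro continuous_closed_preimage_constant continuous_on_closed_Collect_le \<psi> continuous_on_const closed_atLeastAtMost)
    ultimately show "compact A" by (metis compact_Int_closed compact_Icc)
    have "a \<in> A" using \<open>a \<le> b\<close> by (auto simp: A_def \<psi>_def)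
    then show "A \<noteq> {}" by blast
  qed
  then obtain s where s: "s \<in> A" "\<And>r. r \<in> A \<Longrightarrow> r \<le> s"
    using compact_attains_sup by metis
  have "b \<notin> A" using neg by (simp add: A_def \<psi>_def)
  then have "s < b" using s(1) by (auto simp: A_def less_le)
  then have "s \<in> {a..<b}" using s(1) by (auto simp: A_def)
  from dini[OF this] obtain \<delta> where \<delta>: "\<delta> > 0" "\<And>k. 0 < k \<Longrightarrow> k < \<delta> \<Longrightarrow> \<phi> (s + k) \<le> \<phi> s + c * k"
    by blast
  define k where "k = min (\<delta> / 2) (b - s)"
  have k: "0 < k" "k < \<delta>" "s + k \<le> b" using \<delta>(1) \<open>s < b\<close> by (auto simp: k_def)
  have "\<psi> (s + k) \<le> \<psi> s" using \<delta>(2)[OF k(1,2)] by (simp add: \<psi>_def algebra_simps)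
  then have "s + k \<in> A" using s(1) k by (auto simp: A_def)
  then show False using s(2) k(1) by force
qed

lemma right_derivative_increment_le:
  fixes \<phi> :: "real \<Rightarrow> real"
  assumes cont: "continuous_on {a..b} \<phi>" and ab: "a \<le> b"
    and der: "\<And>t. t \<in> {a..<b} \<Longrightarrow> ((\<lambda>k. (\<phi> (t + k) - \<phi> t) / k) \<longlongrightarrow> g t) (at_right 0)"
    and le: "\<And>t. t \<in> {a..<b} \<Longrightarrow> g t \<le> c"
  shows "\<phi> b \<le> \<phi> a + c * (b - a)"
proof (rule field_le_epsilon)
  fix e :: real assume e: "e > 0"
  \<comment> \<open>The added 1 keeps the denominator positive when \<open>a = b\<close>. The slack
    is there because a derivative at most \<open>c\<close> bounds nearby quotients only by numbers
    above \<open>c\<close>.\<close>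
  define e' where "e' = e / (b - a + 1)"
  have e': "e' > 0" "e' * (b - a) \<le> e" using e ab by (auto simp: e'_def field_simps)
  have "\<phi> b \<le> \<phi> a + (c + e') * (b - a)"
  proof (rule right_dini_increment_le[OF cont ab])
    fix t assume t: "t \<in> {a..<b}"
    have "\<forall>\<^sub>F k in at_right 0. (\<phi> (t + k) - \<phi> t) / k < c + e'"
      using der[OF t] le[OF t] e' by (intro order_tendstoD) auto
    then obtain d where "d > 0" "\<And>k. 0 < k \<Longrightarrow> k < d \<Longrightarrow> (\<phi> (t + k) - \<phi> t) / k < c + e'"
      unfolding eventually_at_right_field by auto
    then show "\<exists>\<delta>>0. \<forall>k. 0 < k \<and> k < \<delta> \<longrightarrow> \<phi> (t + k) \<le> \<phi> t + (c + e') * k"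
      by (intro exI[of _ d]) (auto simp: field_simps less_imp_le)
  qed
  then show "\<phi> b \<le> \<phi> a + c * (b - a) + e" using e' by (simp add: algebra_simps)
qed

section \<open>Semigroups and mild solutions\<close>

text \<open>\<^term>\<open>S 0\<close> is only a projection: a semigroup on a closed subspace is extended to
  the whole space by composition with a bounded projection onto that subspace.\<close>

locale bounded_semigroup =
  fixes S :: "real \<Rightarrow> 'h::banach \<Rightarrow> 'h" and M :: real
  assumes M_pos: "M > 0"
    and lin: "t \<ge> 0 \<Longrightarrow> linear (S t)"
    and bound: "t \<ge> 0 \<Longrightarrow> norm (S t x) \<le> M * norm x"
    and semigroup: "s \<ge> 0 \<Longrightarrow> t \<ge> 0 \<Longrightarrow> S (s + t) x = S s (S t x)"
    and right_cont: "((\<lambda>t. S t x) \<longlongrightarrow> S 0 x) (at_right 0)"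
begin

lemma blin: "t \<ge> 0 \<Longrightarrow> bounded_linear (S t)"
  using lin bound by (intro bounded_linear_intro[where K=M]) (auto simp: linear_add linear_scale mult.commute)

lemma S_diff: "t \<ge> 0 \<Longrightarrow> S t (x - y) = S t x - S t y"
  by (rule linear_diff[OF lin])

text \<open>Two times \<open>a \<le> b\<close> are compared by pulling \<open>S a\<close> out in
  front, so right continuity at 0 and the uniform bound give continuity from both sides.\<close>

lemma cont: "continuous_on {0..} (\<lambda>t. S t x)"
  unfolding continuous_on_iff
proof (intro ballI allI impI)
  fix t e :: real assume t: "t \<in> {0..}" and e: "e > 0"
  have "e / M > 0" using e M_pos by simp
  with right_cont[of x] obtain d where d: "d > 0" "\<And>h. 0 < h \<Longrightarrow> h < d \<Longrightarrow> dist (S h x) (S 0 x) < e / M"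
    unfolding tendsto_iff eventually_at_right_field by (metis add_0)
  have *: "norm (S h x - S 0 x) * M < e" if "0 \<le> h" "h < d" for h
    using d(2)[of h] that e M_pos by (cases "h = 0") (auto simp: dist_norm field_simps)
  show "\<exists>d>0. \<forall>t'\<in>{0..}. dist t' t < d \<longrightarrow> dist (S t' x) (S t x) < e"
  proof (intro exI[of _ d] conjI ballI impI d(1))
    fix t' :: real assume t': "t' \<in> {0..}" and dt: "dist t' t < d"
    have main: "norm (S b x - S a x) < e" if "0 \<le> a" "a \<le> b" "b - a < d" for a b
    proof -
      have "S b x - S a x = S a (S (b - a) x - S 0 x)"
        using semigroup[of a "b - a" x] semigroup[of a 0 x] that by (simp add: S_diff)
      then have "norm (S b x - S a x) \<le> M * norm (S (b - a) x - S 0 x)"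
        using bound[OF that(1)] by simp
      also have "\<dots> < e" using *[of "b - a"] that by (simp add: mult.commute)
      finally show ?thesis .
    qed
    show "dist (S t' x) (S t x) < e"
    proof (cases "t \<le> t'")
      case True then show ?thesis using main[of t t'] t dt by (simp add: dist_norm)
    next
      case False then show ?thesis using main[of t' t] t' dt by (simp add: dist_norm norm_minus_commute)
    qed
  qed
qed

text \<open>The bound \<open>M\<close> does not depend on time, so moving the vector costs at most
  \<open>M\<close> times its displacement; strong continuity handles the fixed vector.\<close>

lemma continuous_on_S:
  assumes g: "continuous_on U g" and f: "continuous_on U f" and pos: "\<And>u. u \<in> U \<Longrightarrow> g u \<ge> 0"
  shows "continuous_on U (\<lambda>u. S (g u) (f u))"
  unfolding continuous_on_def
proof
  fix a assume a: "a \<in> U"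
  have 1: "((\<lambda>u. S (g u) (f a)) \<longlongrightarrow> S (g a) (f a)) (at a within U)"
    using continuous_on_compose2[OF cont g, of "f a"] pos a by (auto simp: continuous_on_def)
  have f0: "((\<lambda>u. M * norm (f u - f a)) \<longlongrightarrow> 0) (at a within U)"
    using f a by (auto simp: continuous_on_def intro!: tendsto_mult_right_zero tendsto_norm_zero LIM_zero)
  have 2: "((\<lambda>u. S (g u) (f u - f a)) \<longlongrightarrow> 0) (at a within U)"
  proof (rule Lim_null_comparison[OF _ f0])
    show "\<forall>\<^sub>F u in at a within U. norm (S (g u) (f u - f a)) \<le> M * norm (f u - f a)"
      by (auto simp: eventually_at_filter intro!: always_eventually bound pos)
  qed
  have "((\<lambda>u. S (g u) (f u - f a) + S (g u) (f a)) \<longlongrightarrow> 0 + S (g a) (f a)) (at a within U)"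
    by (intro tendsto_add 1 2)
  moreover have "\<forall>\<^sub>F u in at a within U. S (g u) (f u - f a) + S (g u) (f a) = S (g u) (f u)"
    by (auto simp: eventually_at_filter S_diff pos intro!: always_eventually)
  ultimately show "((\<lambda>u. S (g u) (f u)) \<longlongrightarrow> S (g a) (f a)) (at a within U)"
    by (simp add: tendsto_cong)
qed

section \<open>The Duhamel integral of variation of constants\<close>

definition conv :: "(real \<Rightarrow> 'h) \<Rightarrow> real \<Rightarrow> 'h" where
  "conv f t = integral {0..t} (\<lambda>s. S (t - s) (f s))"

lemma conv_0 [simp]: "conv f 0 = 0"
  by (simp add: conv_def)

lemma conv_continuous_integrand:
  "continuous_on {a..b} f \<Longrightarrow> b \<le> t \<Longrightarrow> continuous_on {a..b} (\<lambda>s. S (t - s) (f s))"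
  by (intro continuous_on_S continuous_intros) auto

lemma conv_integrable:
  "continuous_on {a..b} f \<Longrightarrow> b \<le> t \<Longrightarrow> (\<lambda>s. S (t - s) (f s)) integrable_on {a..b}"
  by (intro integrable_continuous_real conv_continuous_integrand)

lemma conv_diff:
  assumes "continuous_on {0..t} f" "continuous_on {0..t} g" "t \<ge> 0"
  shows "conv f t - conv g t = conv (\<lambda>s. f s - g s) t"
proof -
  have "conv f t - conv g t = integral {0..t} (\<lambda>s. S (t - s) (f s) - S (t - s) (g s))"
    unfolding conv_def using assms by (intro Henstock_Kurzweil_Integration.integral_diff[symmetric] conv_integrable) auto
  also have "\<dots> = conv (\<lambda>s. f s - g s) t"
    unfolding conv_def by (rule integral_cong) (simp add: S_diff)
  finally show ?thesis .
qed

lemma conv_cong: "(\<And>s. s \<in> {0..t} \<Longrightarrow> f s = g s) \<Longrightarrow> conv f t = conv g t"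
  unfolding conv_def by (rule integral_cong) simp

text \<open>The Duhamel integral stays in the subspace on which the original semigroup acts, the
  range of the projection \<open>S 0\<close>.\<close>

lemma S_0_conv:
  assumes "continuous_on {0..t} f" "t \<ge> 0"
  shows "S 0 (conv f t) = conv f t"
proof -
  have "S 0 (conv f t) = integral {0..t} (S 0 \<circ> (\<lambda>s. S (t - s) (f s)))"
    unfolding conv_def using assms by (intro integral_linear[symmetric] conv_integrable blin) auto
  also have "\<dots> = conv f t"
    unfolding conv_def
  proof (rule integral_cong)
    fix s assume "s \<in> {0..t}"
    then show "(S 0 \<circ> (\<lambda>s. S (t - s) (f s))) s = S (t - s) (f s)"
      using semigroup[of 0 "t - s" "f s"] by simp
  qed
  finally show ?thesis .
qed

text \<open>Lets a mild solution be restarted at time \<open>t\<close>: the past is transported by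
  the linear flow, and only the forcing after \<open>t\<close> is convolved anew.\<close>

lemma conv_cocycle:
  assumes f: "continuous_on {0..} f" and t: "t \<ge> 0" "k \<ge> 0"
  shows "conv f (t + k) = S k (conv f t) + conv (\<lambda>s. f (t + s)) k"
proof -
  have "conv f (t + k) = integral {0..t} (\<lambda>s. S (t + k - s) (f s)) + integral {t..t + k} (\<lambda>s. S (t + k - s) (f s))"
    unfolding conv_def
    using t by (intro Henstock_Kurzweil_Integration.integral_combine[symmetric] conv_integrable continuous_on_subset[OF f]) auto
  moreover have "integral {0..t} (\<lambda>s. S (t + k - s) (f s)) = S k (conv f t)"
  proof -
    have "S k (conv f t) = integral {0..t} (S k \<circ> (\<lambda>s. S (t - s) (f s)))"
      unfolding conv_def
      using t by (intro integral_linear[symmetric] conv_integrable blin continuous_on_subset[OF f]) auto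
    also have "\<dots> = integral {0..t} (\<lambda>s. S (t + k - s) (f s))"
    proof (rule integral_cong)
      fix s assume "s \<in> {0..t}"
      then show "(S k \<circ> (\<lambda>s. S (t - s) (f s))) s = S (t + k - s) (f s)"
        using semigroup[of k "t - s" "f s"] t by (simp add: algebra_simps)
    qed
    finally show ?thesis by simp
  qed
  moreover have "integral {t..t + k} (\<lambda>s. S (t + k - s) (f s)) = conv (\<lambda>s. f (t + s)) k"
  proof -
    have "integral {0 + t..k + t} (\<lambda>s. S (t + k - s) (f s)) = integral {0..k} ((\<lambda>s. S (t + k - s) (f s)) \<circ> (+) t)"
      by (rule integral_shift_Icc_real[symmetric])
    then show ?thesis by (simp add: conv_def o_def add.commute)
  qed
  ultimately show ?thesis by simp
qed

lemma continuous_on_conv: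
  assumes f: "continuous_on {0..} f"
  shows "continuous_on {0..} (conv f)"
proof -
  \<comment> \<open>Rescaling to the fixed interval \<open>[0, 1]\<close> turns the moving upper
    limit into a parameter of the integrand.\<close>
  have eq: "conv f t = t *\<^sub>R integral (cbox 0 1) (\<lambda>\<sigma>. S (t - t * \<sigma>) (f (t * \<sigma>)))" if "t \<in> {0..}" for t
  proof (cases "t = 0")
    case False
    then have t: "t > 0" using that by auto
    have "((\<lambda>s. S (t - s) (f s)) has_integral conv f t) (cbox 0 t)"
      unfolding conv_def using conv_integrable[of 0 t f t] continuous_on_subset[OF f] t
      by (auto intro!: integrable_integral)
    from has_integral_affinity'[OF this t, of 0]
    have "((\<lambda>\<sigma>. S (t - t * \<sigma>) (f (t * \<sigma>))) has_integral (conv f t /\<^sub>R t)) (cbox 0 1)"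
      using t by simp
    then show ?thesis using t by (simp add: integral_unique)
  qed simp
  have c: "continuous_on {0..} (\<lambda>t. t *\<^sub>R integral (cbox 0 1) (\<lambda>\<sigma>. S (t - t * \<sigma>) (f (t * \<sigma>))))"
  proof (intro continuous_intros integral_continuous_on_param)
    have "continuous_on ({0..} \<times> cbox 0 1) (\<lambda>u. S (fst u - fst u * snd u) (f (fst u * snd u)))"
      by (intro continuous_on_S continuous_on_compose2[OF f] continuous_intros)
        (auto simp: mult_left_le)
    then show "continuous_on ({0..} \<times> cbox 0 1) (\<lambda>(t, \<sigma>). S (t - t * \<sigma>) (f (t * \<sigma>)))"
      by (simp add: case_prod_unfold)
  qed
  show ?thesis by (rule continuous_on_eq[OF c]) (rule eq[symmetric])
qed

text \<open>By joint continuity the integrand \<open>S (k - s) (f s)\<close> is close to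
  \<open>S 0 (f 0)\<close> for all small \<open>k\<close> and \<open>s\<close>, so its mean over
  \<open>[0, k]\<close> tends to that value.\<close>

lemma conv_right_derivative:
  assumes f: "continuous_on {0..} f"
  shows "((\<lambda>k. conv f k /\<^sub>R k) \<longlongrightarrow> S 0 (f 0)) (at_right 0)"
proof (rule tendstoI)
  fix e :: real assume e: "e > 0"
  let ?U = "{0..} \<times> {0..} :: (real \<times> real) set"
  have "continuous_on ?U (\<lambda>u. S (fst u) (f (snd u)))"
    by (intro continuous_on_S continuous_on_compose2[OF f] continuous_intros) auto
  then obtain d where d: "d > 0"
    "\<And>u. u \<in> ?U \<Longrightarrow> dist u (0, 0) < d \<Longrightarrow> dist (S (fst u) (f (snd u))) (S 0 (f 0)) < e / 2"
    unfolding continuous_on_iff using e by (metis (no_types, lifting) SigmaI atLeast_iff fst_conv half_gt_zero order_refl snd_conv)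
  have "dist (conv f k /\<^sub>R k) (S 0 (f 0)) < e" if k: "0 < k" "k < d / 2" for k
  proof -
    have i: "(\<lambda>s. S (k - s) (f s)) integrable_on {0..k}"
      using k by (intro conv_integrable continuous_on_subset[OF f]) auto
    have "conv f k - k *\<^sub>R S 0 (f 0) = integral {0..k} (\<lambda>s. S (k - s) (f s) - S 0 (f 0))"
      using i k by (subst Henstock_Kurzweil_Integration.integral_diff) (auto simp: conv_def)
    also have "norm \<dots> \<le> integral {0..k} (\<lambda>s. e / 2)"
    proof (rule integral_norm_bound_integral)
      show "(\<lambda>s. S (k - s) (f s) - S 0 (f 0)) integrable_on {0..k}"
        using i by (intro integrable_diff) auto
      fix s assume s: "s \<in> {0..k}"
      have "dist (k - s, s) (0, 0) \<le> \<bar>k - s\<bar> + \<bar>s\<bar>"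
        using norm_Pair_le[of "k - s" s] by (simp add: dist_norm)
      also have "\<dots> < d" using s k by simp
      finally show "norm (S (k - s) (f s) - S 0 (f 0)) \<le> e / 2"
        using d(2)[of "(k - s, s)"] s by (auto simp: dist_norm intro: less_imp_le)
    qed auto
    also have "\<dots> = k * (e / 2)" using k by simp
    finally have "norm (conv f k - k *\<^sub>R S 0 (f 0)) / k \<le> e / 2" using k by (simp add: field_simps)
    moreover have "norm (conv f k - k *\<^sub>R S 0 (f 0)) / k = norm ((conv f k - k *\<^sub>R S 0 (f 0)) /\<^sub>R k)"
      using k by (subst norm_scaleR) (simp add: field_simps)
    moreover have "(conv f k - k *\<^sub>R S 0 (f 0)) /\<^sub>R k = conv f k /\<^sub>R k - S 0 (f 0)"
      using k by (simp add: scaleR_diff_right)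
    ultimately show ?thesis using e by (simp add: dist_norm)
  qed
  then show "\<forall>\<^sub>F k in at_right 0. dist (conv f k /\<^sub>R k) (S 0 (f 0)) < e"
    using d(1) by (auto simp: eventually_at_right_field intro!: exI[of _ "d / 2"])
qed

text \<open>The factor \<open>1 / \<mu>\<close> gained in an exponentially weighted norm is what
  makes the Picard map contract on time intervals of any length.\<close>

lemma conv_exp_bound:
  assumes f: "continuous_on {0..t} f" and t: "t \<ge> 0" and l: "\<mu> > 0" and K: "K \<ge> 0"
    and le: "\<And>s. s \<in> {0..t} \<Longrightarrow> norm (f s) \<le> K * exp (\<mu> * s)"
  shows "norm (conv f t) \<le> M * K / \<mu> * exp (\<mu> * t)"
proof -
  have "((\<lambda>s. M * K * exp (\<mu> * s)) has_integral (M * K / \<mu> * exp (\<mu> * t) - M * K / \<mu> * exp (\<mu> * 0))) {0..t}"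
    using l by (intro fundamental_theorem_of_calculus t)
      (auto intro!: derivative_eq_intros simp flip: has_real_derivative_iff_has_vector_derivative)
  then have g: "(\<lambda>s. M * K * exp (\<mu> * s)) integrable_on {0..t}"
    and gi: "integral {0..t} (\<lambda>s. M * K * exp (\<mu> * s)) = M * K / \<mu> * exp (\<mu> * t) - M * K / \<mu>"
    by (auto simp: has_integral_iff)
  have "norm (conv f t) \<le> integral {0..t} (\<lambda>s. M * K * exp (\<mu> * s))"
    unfolding conv_def
  proof (rule integral_norm_bound_integral[OF _ g])
    show "(\<lambda>s. S (t - s) (f s)) integrable_on {0..t}" by (rule conv_integrable[OF f]) simp
    fix s assume s: "s \<in> {0..t}"
    have "norm (S (t - s) (f s)) \<le> M * norm (f s)" using s by (intro bound) auto
    also have "\<dots> \<le> M * (K * exp (\<mu> * s))" using le[OF s] M_pos by simp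
    finally show "norm (S (t - s) (f s)) \<le> M * K * exp (\<mu> * s)" by (simp add: mult.assoc)
  qed
  also have "\<dots> \<le> M * K / \<mu> * exp (\<mu> * t)"
    unfolding gi using M_pos K l by simp
  finally show ?thesis .
qed

text \<open>At a maximum point of the weighted difference \<open>d\<close>, the integral equation
  bounds \<open>d\<close> by half of itself.\<close>

lemma mild_unique:
  assumes F: "C-lipschitz_on UNIV F" and T: "T \<ge> 0"
    and y: "continuous_on {0..T} y" "\<And>t. t \<in> {0..T} \<Longrightarrow> y t = S t x + conv (\<lambda>s. F (y s)) t"
    and z: "continuous_on {0..T} z" "\<And>t. t \<in> {0..T} \<Longrightarrow> z t = S t x + conv (\<lambda>s. F (z s)) t"
  shows "t \<in> {0..T} \<Longrightarrow> y t = z t"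
proof -
  note C = lipschitz_on_nonneg[OF F]
  \<comment> \<open>Twice \<open>M * C\<close> yields the factor 1/2; the added 1 keeps the rate
    positive when \<open>C = 0\<close>.\<close>
  define \<mu> where "\<mu> = 2 * M * C + 1"
  have \<mu>: "\<mu> > 0" "M * C / \<mu> \<le> 1 / 2" using C M_pos by (auto simp: \<mu>_def field_simps add_pos_nonneg)
  define d where "d s = exp (- \<mu> * s) * norm (y s - z s)" for s
  have dc: "continuous_on {0..T} d" unfolding d_def by (intro continuous_intros y z)
  obtain t0 where t0: "t0 \<in> {0..T}" "\<And>s. s \<in> {0..T} \<Longrightarrow> d s \<le> d t0"
    using continuous_attains_sup[OF compact_Icc _ dc] T by auto
  have d0: "d t0 \<ge> 0" by (simp add: d_def)
  have Fy: "continuous_on {0..t0} (\<lambda>s. F (y s))" and Fz: "continuous_on {0..t0} (\<lambda>s. F (z s))"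
    using t0(1) by (auto intro!: continuous_on_compose2[OF lipschitz_on_continuous_on[OF F]]
        continuous_on_subset[OF y(1)] continuous_on_subset[OF z(1)])
  have "y t0 - z t0 = conv (\<lambda>s. F (y s) - F (z s)) t0"
    using y(2)[OF t0(1)] z(2)[OF t0(1)] conv_diff[OF Fy Fz] t0(1) by simp
  also have "norm \<dots> \<le> M * (C * d t0) / \<mu> * exp (\<mu> * t0)"
  proof (rule conv_exp_bound)
    show "continuous_on {0..t0} (\<lambda>s. F (y s) - F (z s))" by (intro continuous_intros Fy Fz)
    fix s assume s: "s \<in> {0..t0}"
    then have s': "s \<in> {0..T}" using t0(1) by auto
    have "norm (F (y s) - F (z s)) \<le> C * norm (y s - z s)" by (rule lipschitz_on_normD[OF F UNIV_I UNIV_I])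
    also have "norm (y s - z s) = d s * exp (\<mu> * s)" by (simp add: d_def mult_exp_exp flip: exp_add)
    also have "d s * exp (\<mu> * s) \<le> d t0 * exp (\<mu> * s)" using t0(2)[OF s'] by simp
    finally show "norm (F (y s) - F (z s)) \<le> C * d t0 * exp (\<mu> * s)" using C by (simp add: mult.assoc mult_left_mono)
  qed (use t0 C d0 \<mu> in auto)
  finally have "norm (y t0 - z t0) \<le> (M * C / \<mu>) * d t0 * exp (\<mu> * t0)" by (simp add: mult_ac)
  then have "norm (y t0 - z t0) * exp (- \<mu> * t0) \<le> (M * C / \<mu>) * d t0 * exp (\<mu> * t0) * exp (- \<mu> * t0)"
    by (intro mult_right_mono) auto
  also have "\<dots> = (M * C / \<mu>) * d t0" by (simp add: mult.assoc flip: exp_add)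
  also have "\<dots> \<le> 1 / 2 * d t0" using \<mu> d0 by (intro mult_right_mono) auto
  finally have "d t0 \<le> 1 / 2 * d t0" by (simp add: d_def mult.commute)
  then have "d t0 \<le> 0" by simp
  then show "t \<in> {0..T} \<Longrightarrow> y t = z t" using t0(2)[of t] by (simp add: d_def mult_le_0_iff)
qed

text \<open>The Picard map is a contraction for the norm \<open>sup\<^sub>t e\<^sup>-\<^sup>\<mu>\<^sup>t |y t|\<close>; since \<^term>\<open>F\<close> is bounded, one
  fixed point argument gives the solution on the whole half line.\<close>

lemma mild_exists:
  fixes F :: "'h \<Rightarrow> 'h"
  assumes F: "C-lipschitz_on UNIV F" and bounded: "bounded (range F)"
  shows "\<exists>y. continuous_on {0..} y \<and> (\<forall>t\<ge>0. y t = S t x + conv (\<lambda>s. F (y s)) t)"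
proof -
  note C = lipschitz_on_nonneg[OF F]
  obtain B where B: "\<And>x. norm (F x) \<le> B" using bounded by (auto simp: bounded_iff)
  define \<mu> where "\<mu> = 2 * M * C + 1"
  have \<mu>: "\<mu> > 0" "M * C / \<mu> \<le> 1 / 2" using C M_pos by (auto simp: \<mu>_def field_simps add_pos_nonneg)
  have B0: "B \<ge> 0" using B[of 0] norm_ge_zero order_trans by blast
  \<comment> \<open>The unknown is the rescaled function \<phi>, and the solution is
    \<open>exp (\<mu> * s)\<close> times \<open>\<phi> s\<close>. The plain supremum norm of \<phi>
    is then the weighted norm of the solution.\<close>
  define G where "G \<phi> s = F (exp (\<mu> * s) *\<^sub>R apply_bcontfun \<phi> s)" for \<phi> :: "real \<Rightarrow>\<^sub>C 'h" and s
  have Gc: "continuous_on U (G \<phi>)" for \<phi> U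
    unfolding G_def by (intro continuous_on_compose2[OF lipschitz_on_continuous_on[OF F]] continuous_intros) auto
  define P where "P \<phi> t = exp (- \<mu> * t) *\<^sub>R (S t x + conv (G \<phi>) t)" for \<phi> t
  have Pc: "continuous_on {0..} (P \<phi>)" for \<phi>
    unfolding P_def by (intro continuous_intros cont continuous_on_conv Gc)
  have Pb: "norm (P \<phi> t) \<le> M * norm x + M * B / \<mu>" if t: "t \<ge> 0" for \<phi> t
  proof -
    have "norm (conv (G \<phi>) t) \<le> M * B / \<mu> * exp (\<mu> * t)"
    proof (rule conv_exp_bound[OF Gc t \<mu>(1) B0])
      fix s assume s: "s \<in> {0..t}"
      have "norm (G \<phi> s) \<le> B * 1" using B by (simp add: G_def)
      also have "\<dots> \<le> B * exp (\<mu> * s)" using B0 s \<mu>(1) by (intro mult_left_mono) auto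
      finally show "norm (G \<phi> s) \<le> B * exp (\<mu> * s)" .
    qed
    then have "norm (S t x + conv (G \<phi>) t) \<le> M * norm x * exp (\<mu> * t) + M * B / \<mu> * exp (\<mu> * t)"
    proof -
      assume a: "norm (conv (G \<phi>) t) \<le> M * B / \<mu> * exp (\<mu> * t)"
      have "norm (S t x) \<le> M * norm x * 1" using bound[OF t] by simp
      also have "\<dots> \<le> M * norm x * exp (\<mu> * t)"
        using M_pos t \<mu>(1) by (intro mult_left_mono) auto
      finally show ?thesis using a norm_triangle_ineq[of "S t x" "conv (G \<phi>) t"] by linarith
    qed
    then have "exp (- \<mu> * t) * norm (S t x + conv (G \<phi>) t)
        \<le> exp (- \<mu> * t) * ((M * norm x + M * B / \<mu>) * exp (\<mu> * t))"
      by (intro mult_left_mono) (auto simp: algebra_simps)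
    also have "\<dots> = M * norm x + M * B / \<mu>" by (simp add: mult.assoc mult.left_commute flip: exp_add)
    finally show ?thesis by (simp add: P_def)
  qed
  \<comment> \<open>Elements of the function space live on the whole line, so the image is continued
    to negative times by its value at 0.\<close>
  define \<Theta> where "\<Theta> \<phi> = Bcontfun (\<lambda>t. P \<phi> (max 0 t))" for \<phi>
  have \<Theta>: "apply_bcontfun (\<Theta> \<phi>) t = P \<phi> (max 0 t)" for \<phi> t
  proof -
    have "(\<lambda>t. P \<phi> (max 0 t)) \<in> bcontfun"
      by (rule bcontfun_normI[OF continuous_on_compose2[OF Pc]]) (auto intro!: continuous_intros Pb)
    then show ?thesis by (simp add: \<Theta>_def Bcontfun_inverse)
  qed
  have "\<exists>!\<phi>. \<Theta> \<phi> = \<phi>"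
  proof (rule banach_fix_type[of "1/2"])
    show "\<forall>\<phi> \<psi>. dist (\<Theta> \<phi>) (\<Theta> \<psi>) \<le> 1 / 2 * dist \<phi> \<psi>"
    proof (intro allI dist_bound)
      fix \<phi> \<psi> and t' :: real
      define t where "t = max 0 t'"
      have t: "t \<ge> 0" by (simp add: t_def)
      have "P \<phi> t - P \<psi> t = exp (- \<mu> * t) *\<^sub>R conv (\<lambda>s. G \<phi> s - G \<psi> s) t"
        by (simp add: P_def conv_diff[OF Gc Gc t, symmetric] algebra_simps)
      also have "norm \<dots> \<le> exp (- \<mu> * t) * (M * (C * dist \<phi> \<psi>) / \<mu> * exp (\<mu> * t))"
        unfolding norm_scaleR
      proof (intro mult_mono conv_exp_bound)
        fix s
        have "norm (G \<phi> s - G \<psi> s) \<le> C * norm (exp (\<mu> * s) *\<^sub>R apply_bcontfun \<phi> s - exp (\<mu> * s) *\<^sub>R apply_bcontfun \<psi> s)"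
          unfolding G_def by (rule lipschitz_on_normD[OF F UNIV_I UNIV_I])
        also have "\<dots> = C * exp (\<mu> * s) * dist (apply_bcontfun \<phi> s) (apply_bcontfun \<psi> s)"
          by (simp add: dist_norm flip: scaleR_diff_right)
        also have "\<dots> \<le> C * exp (\<mu> * s) * dist \<phi> \<psi>"
          using C by (intro mult_left_mono dist_bounded) auto
        finally show "norm (G \<phi> s - G \<psi> s) \<le> C * dist \<phi> \<psi> * exp (\<mu> * s)" by (simp add: mult_ac)
      qed (use t \<mu> C in \<open>auto intro!: continuous_intros Gc\<close>)
      also have "\<dots> = M * C / \<mu> * dist \<phi> \<psi>" by (simp add: mult.assoc mult.left_commute flip: exp_add)
      also have "\<dots> \<le> 1 / 2 * dist \<phi> \<psi>" using \<mu>(2) by (intro mult_right_mono) auto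
      finally show "dist (apply_bcontfun (\<Theta> \<phi>) t') (apply_bcontfun (\<Theta> \<psi>) t') \<le> 1 / 2 * dist \<phi> \<psi>"
        by (simp add: \<Theta> dist_norm t_def)
    qed
  qed auto
  then obtain \<phi> where \<phi>: "\<Theta> \<phi> = \<phi>" by blast
  define y where "y t = exp (\<mu> * t) *\<^sub>R apply_bcontfun \<phi> t" for t
  have "continuous_on {0..} y" unfolding y_def by (intro continuous_intros) auto
  moreover have "y t = S t x + conv (\<lambda>s. F (y s)) t" if "t \<ge> 0" for t
  proof -
    have "apply_bcontfun \<phi> t = P \<phi> t" using \<Theta>[of \<phi> t] that by (simp add: \<phi>)
    then have "y t = exp (\<mu> * t) *\<^sub>R exp (- \<mu> * t) *\<^sub>R (S t x + conv (G \<phi>) t)"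
      by (simp add: y_def P_def)
    then have "y t = S t x + conv (G \<phi>) t" by (simp flip: exp_add)
    then show ?thesis by (simp add: G_def[abs_def] y_def[abs_def])
  qed
  ultimately show ?thesis by blast
qed

section \<open>Time averages of orbits and density of the domain\<close>

lemma S_0_S: "t \<ge> 0 \<Longrightarrow> S 0 (S t x) = S t x"
  using semigroup[of 0 t x] by simp

definition orbit_integral :: "'h \<Rightarrow> real \<Rightarrow> 'h" where
  "orbit_integral x h = integral {0..h} (\<lambda>r. S r x)"

lemma S_integrable: "0 \<le> a \<Longrightarrow> (\<lambda>r. S r x) integrable_on {a..b}"
  by (intro integrable_continuous_real continuous_on_subset[OF cont]) auto

lemma orbit_integral_derivative:
  assumes "h \<ge> 0"
  shows "((\<lambda>k. (orbit_integral x (h + k) - orbit_integral x h) /\<^sub>R k) \<longlongrightarrow> S h x) (at_right 0)"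
proof -
  have "((\<lambda>u. integral {0..u} (\<lambda>r. S r x)) has_vector_derivative S h x) (at h within {0..h + 1})"
    using assms by (intro integral_has_vector_derivative continuous_on_subset[OF cont]) auto
  then have "((\<lambda>u. integral {0..u} (\<lambda>r. S r x)) has_vector_derivative S h x) (at h within {h..h + 1})"
    by (rule has_vector_derivative_within_subset) (use assms in auto)
  then have "((\<lambda>u. integral {0..u} (\<lambda>r. S r x)) has_vector_derivative S h x) (at_right h)"
    by (simp add: at_within_Icc_at_right)
  then show ?thesis
    by (simp add: has_vector_derivative_at_right_iff orbit_integral_def)
qed

lemma S_orbit_integral:
  assumes "h \<ge> 0" "k \<ge> 0"
  shows "S k (orbit_integral x h) = orbit_integral x (h + k) - orbit_integral x k"
proof -
  have "S k (orbit_integral x h) = integral {0..h} (S k \<circ> (\<lambda>r. S r x))"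
    unfolding orbit_integral_def
    using assms by (intro integral_linear[symmetric] S_integrable blin) auto
  also have "\<dots> = integral {0..h} ((\<lambda>r. S r x) \<circ> (+) k)"
    by (rule integral_cong) (use assms semigroup in auto)
  also have "\<dots> = integral {0 + k..h + k} (\<lambda>r. S r x)" by (rule integral_shift_Icc_real)
  also have "\<dots> = orbit_integral x (h + k) - orbit_integral x k"
    using Henstock_Kurzweil_Integration.integral_combine[of 0 k "h + k" "\<lambda>r. S r x"] assms S_integrable[of 0 x "h + k"]
    by (simp add: orbit_integral_def algebra_simps)
  finally show ?thesis .
qed

text \<open>Averages of the orbit of \<open>x\<close> over \<open>[0, h]\<close> tend to
  \<open>x\<close> with \<open>h\<close>. Shifting such an average by \<open>S k\<close> changes
  only its two ends, so it has the right derivative \<open>(S h x - x) /\<^sub>R h\<close>. No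
  generator is given here: the pair of \<open>J\<close> and \<open>w\<close> stands for a member of
  a domain and its image.\<close>

lemma domain_dense:
  assumes x: "S 0 x = x" and e: "e > 0"
  shows "\<exists>J w. dist J x < e \<and> S 0 J = J \<and> S 0 w = w \<and>
    ((\<lambda>k. (S k J - J) /\<^sub>R k) \<longlongrightarrow> w) (at_right 0)"
proof -
  have "((\<lambda>h. orbit_integral x h /\<^sub>R h) \<longlongrightarrow> x) (at_right 0)"
    using orbit_integral_derivative[of 0 x] x by (simp add: orbit_integral_def)
  then have "\<forall>\<^sub>F h in at_right 0. dist (orbit_integral x h /\<^sub>R h) x < e"
    using e by (rule tendstoD)
  then obtain d where d: "d > 0" "\<And>h. 0 < h \<Longrightarrow> h < d \<Longrightarrow> dist (orbit_integral x h /\<^sub>R h) x < e"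
    unfolding eventually_at_right_field by auto
  define h where "h = d / 2"
  have h: "h > 0" "h < d" using d by (auto simp: h_def)
  define J where "J = orbit_integral x h /\<^sub>R h"
  define w where "w = (S h x - x) /\<^sub>R h"
  have SJ: "S k J = (orbit_integral x (h + k) - orbit_integral x k) /\<^sub>R h" if "k \<ge> 0" for k
    using S_orbit_integral[of h k x] h that by (simp add: J_def linear_scale[OF lin])
  have "((\<lambda>k. ((orbit_integral x (h + k) - orbit_integral x h) /\<^sub>R k
      - (orbit_integral x (0 + k) - orbit_integral x 0) /\<^sub>R k) /\<^sub>R h) \<longlongrightarrow> (S h x - S 0 x) /\<^sub>R h) (at_right 0)"
    using h by (intro tendsto_intros orbit_integral_derivative) auto
  then have "((\<lambda>k. (S k J - J) /\<^sub>R k) \<longlongrightarrow> (S h x - S 0 x) /\<^sub>R h) (at_right 0)"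
    by (rule tendsto_at_right_0_cong)
      (simp add: SJ, simp add: J_def orbit_integral_def[of x 0] algebra_simps)
  then have "((\<lambda>k. (S k J - J) /\<^sub>R k) \<longlongrightarrow> w) (at_right 0)"
    using x by (simp add: w_def)
  moreover have "S 0 J = J" using SJ[of 0] by (simp add: J_def orbit_integral_def[of x 0])
  moreover have "S 0 w = w"
    using h x by (simp add: w_def linear_scale[OF lin] S_diff S_0_S)
  moreover have "dist J x < e" using d(2)[OF h] by (simp add: J_def)
  ultimately show ?thesis by blast
qed

section \<open>Rates of change along the linear flow and along mild solutions\<close>

lemma S_tendsto_0:
  assumes "S 0 x = x"
  shows "((\<lambda>k. S k x) \<longlongrightarrow> x) (at_right 0)"
  using right_cont[of x] assms by simp

text \<open>For starting points in \<open>D\<close> the derivative is known along the whole orbit,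
  as \<open>D\<close> is invariant, and the mean value inequality gives the increment
  \<open>\<psi> x * k\<close> up to an error \<open>e * k\<close>. The range of admissible
  \<open>k\<close> depends on \<open>x\<close> alone and not on the starting point near it. The
  bound therefore survives the limit of starting points with \<open>k\<close> fixed, and only
  afterwards does \<open>k\<close> tend to 0.\<close>

lemma right_derivative_extend:
  fixes \<phi> \<psi> :: "'h \<Rightarrow> real"
  assumes \<phi>: "continuous_on UNIV \<phi>" and \<psi>: "continuous_on UNIV \<psi>"
    and D0: "\<And>x. x \<in> D \<Longrightarrow> S 0 x = x" and inv: "\<And>x t. x \<in> D \<Longrightarrow> t \<ge> 0 \<Longrightarrow> S t x \<in> D"
    and der: "\<And>x. x \<in> D \<Longrightarrow> ((\<lambda>k. (\<phi> (S k x) - \<phi> x) / k) \<longlongrightarrow> \<psi> x) (at_right 0)"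
    and x: "S 0 x = x" "x \<in> closure D"
  shows "((\<lambda>k. (\<phi> (S k x) - \<phi> x) / k) \<longlongrightarrow> \<psi> x) (at_right 0)"
proof (rule tendstoI)
  fix e0 :: real assume e0: "e0 > 0"
  define e where "e = e0 / 2"
  have e: "e > 0" "e < e0" using e0 by (auto simp: e_def)
  obtain \<eta> where \<eta>: "\<eta> > 0" "\<And>w. dist w x < \<eta> \<Longrightarrow> dist (\<psi> w) (\<psi> x) < e"
    using \<psi> e(1) unfolding continuous_on_iff by (metis UNIV_I)
  have "\<forall>\<^sub>F k in at_right 0. dist (S k x) x < \<eta> / 2"
    using S_tendsto_0[OF x(1)] \<eta>(1) by (intro tendstoD) auto
  then obtain \<delta> where \<delta>: "\<delta> > 0" "\<And>k. 0 < k \<Longrightarrow> k < \<delta> \<Longrightarrow> dist (S k x) x < \<eta> / 2"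
    unfolding eventually_at_right_field by auto
  have \<delta>': "dist (S k x) x < \<eta> / 2" if "0 \<le> k" "k < \<delta>" for k
    using \<delta>(2)[of k] that x(1) \<eta>(1) by (cases "k = 0") auto
  obtain X where X: "\<And>n. X n \<in> D" "X \<longlonglongrightarrow> x"
    using x(2) unfolding closure_sequential by blast
  have main: "\<bar>\<phi> (S k x) - \<phi> x - \<psi> x * k\<bar> \<le> e * k" if k: "0 < k" "k < \<delta>" for k
  proof -
    \<comment> \<open>One half of \<eta> is spent on the orbit of \<open>x\<close>, the other on the
      distance between the two orbits, which the semigroup magnifies by at most
      \<open>M\<close>.\<close>
    have "\<forall>\<^sub>F n in sequentially. dist (X n) x < \<eta> / (2 * M)"
      using X(2) \<eta>(1) M_pos by (intro tendstoD) auto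
    then have ev: "\<forall>\<^sub>F n in sequentially. \<bar>\<phi> (S k (X n)) - \<phi> (X n) - \<psi> x * k\<bar> \<le> e * k"
    proof eventually_elim
      case (elim n)
      have near: "dist (\<psi> (S s (X n))) (\<psi> x) < e" if s: "0 \<le> s" "s < \<delta>" for s
      proof (rule \<eta>(2))
        have "dist (S s (X n)) (S s x) \<le> M * dist (X n) x"
          using bound[OF s(1), of "X n - x"] s by (simp add: dist_norm S_diff)
        also have "\<dots> < \<eta> / 2" using elim M_pos by (simp add: field_simps)
        finally show "dist (S s (X n)) x < \<eta>"
          using \<delta>'[OF s] dist_triangle[of "S s (X n)" x "S s x"] by simp
      qed
      have c: "continuous_on {0..k} (\<lambda>s. \<phi> (S s (X n)))"
        by (intro continuous_on_compose2[OF \<phi>] continuous_on_subset[OF cont]) auto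
      have d: "((\<lambda>h. (\<phi> (S (t + h) (X n)) - \<phi> (S t (X n))) / h) \<longlongrightarrow> \<psi> (S t (X n))) (at_right 0)" if t: "0 \<le> t" for t
        by (rule tendsto_at_right_0_cong[OF der[OF inv[OF X(1) t]]])
          (simp add: t semigroup[symmetric] add.commute)
      have "\<phi> (S k (X n)) \<le> \<phi> (S 0 (X n)) + (\<psi> x + e) * (k - 0)"
      proof (rule right_derivative_increment_le[OF c _ d])
        fix t assume "t \<in> {0..<k}"
        then show "\<psi> (S t (X n)) \<le> \<psi> x + e" using near[of t] k by (auto simp: dist_real_def)
      qed (use k in auto)
      moreover have "- \<phi> (S k (X n)) \<le> - \<phi> (S 0 (X n)) + (- \<psi> x + e) * (k - 0)"
      proof (rule right_derivative_increment_le[where g="\<lambda>t. - \<psi> (S t (X n))" and \<phi>="\<lambda>s. - \<phi> (S s (X n))"])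
        show "continuous_on {0..k} (\<lambda>s. - \<phi> (S s (X n)))" by (intro continuous_intros c)
        fix t assume t: "t \<in> {0..<k}"
        then show "- \<psi> (S t (X n)) \<le> - \<psi> x + e" using near[of t] k by (auto simp: dist_real_def)
        show "((\<lambda>h. (- \<phi> (S (t + h) (X n)) - - \<phi> (S t (X n))) / h) \<longlongrightarrow> - \<psi> (S t (X n))) (at_right 0)"
          using tendsto_minus[OF d[of t]] t by (simp add: minus_divide_left)
      qed (use k in auto)
      ultimately show ?case using D0[OF X(1)] by (simp add: abs_le_iff algebra_simps)
    qed
    have isc: "isCont \<phi> w" for w using \<phi> by (simp add: continuous_on_eq_continuous_at)
    have "(\<lambda>n. S k (X n)) \<longlonglongrightarrow> S k x"
      using bounded_linear.tendsto[OF blin X(2)] k by simp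
    then have "(\<lambda>n. \<bar>\<phi> (S k (X n)) - \<phi> (X n) - \<psi> x * k\<bar>) \<longlonglongrightarrow> \<bar>\<phi> (S k x) - \<phi> x - \<psi> x * k\<bar>"
      by (intro tendsto_intros isCont_tendsto_compose[OF isc] X(2))
    then show ?thesis using ev by (intro tendsto_upperbound) auto
  qed
  have "dist ((\<phi> (S k x) - \<phi> x) / k) (\<psi> x) < e0" if k: "0 < k" "k < \<delta>" for k
  proof -
    have "(\<phi> (S k x) - \<phi> x) / k - \<psi> x = (\<phi> (S k x) - \<phi> x - \<psi> x * k) / k"
      using k by (simp add: field_simps)
    then have "dist ((\<phi> (S k x) - \<phi> x) / k) (\<psi> x) = \<bar>\<phi> (S k x) - \<phi> x - \<psi> x * k\<bar> / k"
      using k by (simp add: dist_real_def)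
    also have "\<dots> \<le> e" using main[OF k] k by (simp add: field_simps)
    finally show ?thesis using e by simp
  qed
  then show "\<forall>\<^sub>F k in at_right 0. dist ((\<phi> (S k x) - \<phi> x) / k) (\<psi> x) < e0"
    unfolding eventually_at_right_field using \<delta>(1) by auto
qed

lemma S_0_mild:
  assumes "continuous_on {0..} f" "t \<ge> 0"
  shows "S 0 (S t x + conv f t) = S t x + conv f t"
  using assms S_0_conv[of t f] continuous_on_subset[OF assms(1), of "{0..t}"]
  by (simp add: linear_add[OF lin] S_0_S)

text \<open>After a restart at time \<open>t\<close> the solution is the linear orbit of
  \<open>x = y t\<close> plus \<open>w k\<close>, where \<open>w k / k\<close> tends to
  \<open>f t\<close>. The linear orbit need not be differentiable, so the chain rule cannot be
  applied to the sum. Its share of the increment of \<open>H\<close> is given by \<psi>, and the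
  mean value theorem covers the step from \<open>S k x\<close> to \<open>S k x + w k\<close>. There
  the base point of the derivative moves with \<open>k\<close>, hence the joint continuity in
  \<open>H'c\<close>.\<close>

lemma mild_right_derivative:
  fixes H :: "'h \<Rightarrow> real"
  assumes H: "\<And>x. (H has_derivative H' x) (at x)"
    and H'c: "continuous_on UNIV (\<lambda>(x, v). H' x v)"
    and \<psi>: "\<And>x. S 0 x = x \<Longrightarrow> ((\<lambda>k. (H (S k x) - H x) / k) \<longlongrightarrow> \<psi> x) (at_right 0)"
    and f: "continuous_on {0..} f" and f0: "S 0 (f t) = f t"
    and y: "\<And>t. t \<ge> 0 \<Longrightarrow> y t = S t x0 + conv f t" and t: "t \<ge> 0"
  shows "((\<lambda>k. (H (y (t + k)) - H (y t)) / k) \<longlongrightarrow> \<psi> (y t) + H' (y t) (f t)) (at_right 0)"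
proof -
  define x where "x = y t"
  have x0: "S 0 x = x" unfolding x_def y[OF t] by (rule S_0_mild[OF f t])
  define w where "w k = conv (\<lambda>s. f (t + s)) k" for k
  have yt: "y (t + k) = S k x + w k" if "k \<ge> 0" for k
    using that t y[of "t + k"] y[OF t] semigroup[of k t x0] conv_cocycle[OF f t that]
    by (simp add: x_def w_def linear_add[OF lin] add.commute add.assoc)
  have fs: "continuous_on {0..} (\<lambda>s. f (t + s))"
    using t by (intro continuous_on_compose2[OF f] continuous_intros) auto
  have w1: "((\<lambda>k. w k /\<^sub>R k) \<longlongrightarrow> f t) (at_right 0)"
    using conv_right_derivative[OF fs] f0 by (simp add: w_def)
  have "((\<lambda>k. k *\<^sub>R (w k /\<^sub>R k)) \<longlongrightarrow> 0 *\<^sub>R f t) (at_right 0)"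
    by (intro tendsto_intros w1)
  then have "(w \<longlongrightarrow> 0 *\<^sub>R f t) (at_right 0)" by (rule tendsto_at_right_0_cong) simp
  then have w0: "(w \<longlongrightarrow> 0) (at_right 0)" by simp
  have "\<exists>\<theta>. 0 \<le> \<theta> \<and> \<theta> \<le> 1 \<and> H (S k x + w k) - H (S k x) = H' (S k x + \<theta> *\<^sub>R w k) (w k)" for k
  proof -
    have "((\<lambda>u. H (S k x + u *\<^sub>R w k)) has_derivative (\<lambda>h. H' (S k x + u *\<^sub>R w k) (h *\<^sub>R w k))) (at u within {0..1})" for u
      by (rule has_derivative_compose[OF _ H]) (auto intro!: derivative_eq_intros)
    from mvt_simple[OF zero_less_one this] obtain u where "u \<in> {0<..<1}" "H (S k x + 1 *\<^sub>R w k) - H (S k x + 0 *\<^sub>R w k)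
        = H' (S k x + u *\<^sub>R w k) ((1 - 0) *\<^sub>R w k)" by blast
    then show ?thesis by (intro exI[of _ u]) simp
  qed
  then obtain \<theta> where \<theta>: "\<And>k. 0 \<le> \<theta> k" "\<And>k. \<theta> k \<le> 1"
    "\<And>k. H (S k x + w k) - H (S k x) = H' (S k x + \<theta> k *\<^sub>R w k) (w k)" by metis
  have "((\<lambda>k. norm (w k)) \<longlongrightarrow> 0) (at_right 0)" using w0 by (rule tendsto_norm_zero)
  then have "((\<lambda>k. \<theta> k *\<^sub>R w k) \<longlongrightarrow> 0) (at_right 0)"
    by (rule Lim_null_comparison[rotated]) (auto intro!: always_eventually mult_left_le_one_le simp: \<theta>)
  then have "((\<lambda>k. S k x + \<theta> k *\<^sub>R w k) \<longlongrightarrow> x + 0) (at_right 0)"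
    by (intro tendsto_add S_tendsto_0 x0)
  then have "((\<lambda>k. (S k x + \<theta> k *\<^sub>R w k, w k /\<^sub>R k)) \<longlongrightarrow> (x, f t)) (at_right 0)"
    using w1 by (auto intro: tendsto_Pair)
  moreover have "isCont (\<lambda>(x, v). H' x v) (x, f t)"
    using H'c by (simp add: continuous_on_eq_continuous_at)
  ultimately have "((\<lambda>k. case (S k x + \<theta> k *\<^sub>R w k, w k /\<^sub>R k) of (x, v) \<Rightarrow> H' x v) \<longlongrightarrow> (case (x, f t) of (x, v) \<Rightarrow> H' x v)) (at_right 0)"
    by (rule isCont_tendsto_compose[rotated])
  then have "((\<lambda>k. (H (S k x) - H x) / k + H' (S k x + \<theta> k *\<^sub>R w k) (w k /\<^sub>R k)) \<longlongrightarrow> \<psi> x + H' x (f t)) (at_right 0)"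
    by (intro tendsto_add \<psi> x0) simp
  then show ?thesis
    unfolding x_def[symmetric]
  proof (rule tendsto_at_right_0_cong)
    show "(H (S k x) - H x) / k + H' (S k x + \<theta> k *\<^sub>R w k) (w k /\<^sub>R k) = (H (y (t + k)) - H x) / k" if "k > 0" for k
    proof -
      have "H' (S k x + \<theta> k *\<^sub>R w k) (w k /\<^sub>R k) = H' (S k x + \<theta> k *\<^sub>R w k) (w k) / k"
        using linear_scale[OF has_derivative_linear[OF H]] by (simp add: divide_inverse_commute)
      also have "\<dots> = (H (y (t + k)) - H (S k x)) / k"
        using \<theta>(3)[of k] yt[of k] that by simp
      finally show ?thesis by (simp add: diff_divide_distrib)
    qed
  qed
qed

end

section \<open>The state space inside a Hilbert space\<close>

lemma Rep_Abs_L2: "f \<in> L2 l \<Longrightarrow> Rep_l2 (Abs_l2 f) = f"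
  by (simp add: Abs_l2_inverse L2_iff)

lemma Abs_l2_plus: "f \<in> L2 l \<Longrightarrow> g \<in> L2 l \<Longrightarrow> Abs_l2 (f + g) = Abs_l2 f + Abs_l2 g"
  by (metis Rep_Abs_L2 Rep_l2_inject L2_plus plus_l2.rep_eq)

lemma Abs_l2_scaleR: "f \<in> L2 l \<Longrightarrow> Abs_l2 (r *\<^sub>R f) = r *\<^sub>R Abs_l2 f"
  by (metis Rep_Abs_L2 Rep_l2_inject L2_scaleR scaleR_l2.rep_eq)

text \<open>The orthogonal projection onto the classes that vanish outside the interval; its range
  is the copy of \<open>L2 l\<close> in the type \<open>l2\<close>.\<close>

definition cut :: "real \<Rightarrow> l2 \<Rightarrow> l2" where
  "cut l f = to_l2 (\<lambda>x. indicator {0<..<l} x * rep2 f x)"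

lemma rep2_cut: "AE x in lebesgue. rep2 (cut l f) x = indicator {0<..<l} x * rep2 f x"
  unfolding cut_def by (intro rep2_to_l2 sq_integrable_indicator_mult sq_integrable_rep2) simp

lemma Rep_cut_L2: "Rep_l2 (cut l f) \<in> L2 l"
proof -
  have "AE x in lebesgue. x \<notin> {0<..<l} \<longrightarrow> rep2 (cut l f) x = 0"
    using rep2_cut[of l f] by eventually_elim simp
  then show ?thesis using sq_integrable_rep2[of "cut l f"] by (simp add: L2_iff rep2_def)
qed

lemma cut_eq_self:
  assumes "Rep_l2 f \<in> L2 l"
  shows "cut l f = f"
proof (rule l2_eqI)
  have "AE x in lebesgue. x \<notin> {0<..<l} \<longrightarrow> rep2 f x = 0"
    using assms by (simp add: L2_iff rep2_def)
  with rep2_cut[of l f] show "AE x in lebesgue. rep2 (cut l f) x = rep2 f x"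
    by eventually_elim (auto simp: indicator_def)
qed

lemma bounded_linear_cut: "bounded_linear (cut l)"
proof (rule bounded_linear_intro[where K=1])
  fix f g :: l2 and r :: real
  show "cut l (f + g) = cut l f + cut l g"
  proof (rule l2_eqI)
    show "AE x in lebesgue. rep2 (cut l (f + g)) x = rep2 (cut l f + cut l g) x"
      using rep2_cut[of l f] rep2_cut[of l g] rep2_cut[of l "f + g"] rep2_plus[of f g] rep2_plus[of "cut l f" "cut l g"]
      by eventually_elim (simp add: algebra_simps)
  qed
  show "cut l (r *\<^sub>R f) = r *\<^sub>R cut l f"
  proof (rule l2_eqI)
    show "AE x in lebesgue. rep2 (cut l (r *\<^sub>R f)) x = rep2 (r *\<^sub>R cut l f) x"
      using rep2_cut[of l f] rep2_cut[of l "r *\<^sub>R f"] rep2_scaleR[of r f] rep2_scaleR[of r "cut l f"]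
      by eventually_elim simp
  qed
  have "(LINT x|lebesgue. rep2 (cut l f) x * rep2 (cut l f) x) \<le> (LINT x|lebesgue. rep2 f x * rep2 f x)"
  proof (rule integral_mono_AE)
    show "AE x in lebesgue. rep2 (cut l f) x * rep2 (cut l f) x \<le> rep2 f x * rep2 f x"
      using rep2_cut[of l f] by eventually_elim (auto simp: indicator_def)
  qed (intro sq_integrable_mult sq_integrable_rep2)+
  then have "inner (cut l f) (cut l f) \<le> inner f f" by (simp add: inner_l2_def)
  then show "norm (cut l f) \<le> norm f * 1" by (simp add: norm_eq_sqrt_inner)
qed

section \<open>Functions with two zero initial values and their second derivative\<close>

lemma Sobolev0_2_iff:
  assumes l: "0 < l"
  shows "u \<in> Sobolev0 l 2 \<longleftrightarrow> has_L2_deriv l u (Dx l u) \<and> has_L2_deriv l (Dx l u) (Dx l (Dx l u)) \<and>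
    val l u 0 = 0 \<and> val l (Dx l u) 0 = 0"
proof
  assume "u \<in> Sobolev0 l 2"
  then have s: "u \<in> Sobolev l (Suc (Suc 0))" and v: "val l u 0 = 0" "val l (Dx l u) 0 = 0"
    by (auto simp: Sobolev0_def numeral_2_eq_2)
  show "has_L2_deriv l u (Dx l u) \<and> has_L2_deriv l (Dx l u) (Dx l (Dx l u)) \<and>
    val l u 0 = 0 \<and> val l (Dx l u) 0 = 0"
    using Sobolev_SucD[OF l s] Sobolev_SucD(1)[OF l Sobolev_SucD(2)[OF l s]] v by simp
next
  assume a: "has_L2_deriv l u (Dx l u) \<and> has_L2_deriv l (Dx l u) (Dx l (Dx l u)) \<and>
    val l u 0 = 0 \<and> val l (Dx l u) 0 = 0"
  then show "u \<in> Sobolev0 l 2"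
    using has_L2_derivD(1,2)[OF l] by (fastforce simp: Sobolev0_def numeral_2_eq_2)
qed

lemma Sobolev0_4D:
  assumes l: "0 < l" and u: "u \<in> Sobolev0 l 4"
  shows "u \<in> Sobolev0 l 2"
    "has_L2_deriv l (Dx l (Dx l u)) (Dx l (Dx l (Dx l u)))"
    "has_L2_deriv l (Dx l (Dx l (Dx l u))) (Dx l (Dx l (Dx l (Dx l u))))"
proof -
  have s: "u \<in> Sobolev l (Suc (Suc (Suc (Suc 0))))" and v: "val l u 0 = 0" "val l (Dx l u) 0 = 0"
    using u by (auto simp: Sobolev0_def numeral_eq_Suc)
  note s1 = Sobolev_SucD[OF l s]
  note s2 = Sobolev_SucD[OF l s1(2)]
  note s3 = Sobolev_SucD[OF l s2(2)]
  note s4 = Sobolev_SucD[OF l s3(2)]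
  show "u \<in> Sobolev0 l 2" unfolding Sobolev0_2_iff[OF l] using s1(1) s2(1) v by simp
  show "has_L2_deriv l (Dx l (Dx l u)) (Dx l (Dx l (Dx l u)))"
    "has_L2_deriv l (Dx l (Dx l (Dx l u))) (Dx l (Dx l (Dx l (Dx l u))))"
    using s3(1) s4(1) by auto
qed

lemma Sobolev0_2_lincomb:
  assumes l: "0 < l" and u: "u \<in> Sobolev0 l 2" and w: "w \<in> Sobolev0 l 2"
  shows "u + r *\<^sub>R w \<in> Sobolev0 l 2"
    "Dx l (Dx l (u + r *\<^sub>R w)) = Dx l (Dx l u) + r *\<^sub>R Dx l (Dx l w)"
proof -
  note u' = u[unfolded Sobolev0_2_iff[OF l]] and w' = w[unfolded Sobolev0_2_iff[OF l]]
  note d1 = has_L2_deriv_lincomb[OF l conjunct1[OF u'] conjunct1[OF w'], where r=r]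
  note d2 = has_L2_deriv_lincomb[OF l conjunct1[OF conjunct2[OF u']] conjunct1[OF conjunct2[OF w']], where r=r]
  note D1 = Dx_eq[OF l d1(1)] note D2 = Dx_eq[OF l d2(1)]
  show "Dx l (Dx l (u + r *\<^sub>R w)) = Dx l (Dx l u) + r *\<^sub>R Dx l (Dx l w)" by (simp only: D1 D2)
  show "u + r *\<^sub>R w \<in> Sobolev0 l 2"
    unfolding Sobolev0_2_iff[OF l] D1 D2 using d1(1) d1(2)[of 0] d2(1) d2(2)[of 0] u' w' l by simp
qed

text \<open>Both integrations leading back from \<open>u''\<close> are fixed by an initial value 0.
  This is the injectivity of the embedding in its first component.\<close>

lemma Sobolev0_2_eq_iff:
  assumes l: "0 < l" and u: "u \<in> Sobolev0 l 2" and w: "w \<in> Sobolev0 l 2"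
    and eq: "Dx l (Dx l u) = Dx l (Dx l w)"
  shows "u = w"
proof -
  note u' = u[unfolded Sobolev0_2_iff[OF l]] and w' = w[unfolded Sobolev0_2_iff[OF l]]
  have *: "f = g" if "has_L2_deriv l f h" "has_L2_deriv l g h" "val l f 0 = 0" "val l g 0 = 0" for f g h
  proof (rule L0_eqI)
    have "AE x in lebesgue. x \<notin> {0<..<l} \<longrightarrow> rep_L0 f x = 0" "AE x in lebesgue. x \<notin> {0<..<l} \<longrightarrow> rep_L0 g x = 0"
      using has_L2_derivD(1)[OF l that(1)] has_L2_derivD(1)[OF l that(2)] by (auto simp: L2_iff)
    then show "AE x in lebesgue. rep_L0 f x = rep_L0 g x"
      using has_L2_derivD(4)[OF l that(1)] has_L2_derivD(4)[OF l that(2)]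
      by eventually_elim (use that(3,4) in \<open>metis add_0\<close>)
  qed
  have "Dx l u = Dx l w" by (rule *) (use u' w' eq in auto)
  then show ?thesis by (intro *[of u "Dx l u" w]) (use u' w' in auto)
qed

text \<open>Surjectivity of the passage to \<open>u''\<close>: because of it the embedded state
  space is the full range of a bounded projection, hence closed.\<close>

lemma Sobolev0_2_surj:
  assumes l: "0 < l" and f: "f \<in> L2 l"
  shows "\<exists>u\<in>Sobolev0 l 2. Dx l (Dx l u) = f"
proof -
  obtain w where w: "has_L2_deriv l w f" "val l w 0 = 0" using L2_antiderivative[OF l f] by blast
  obtain u where u: "has_L2_deriv l u w" "val l u 0 = 0"
    using L2_antiderivative[OF l has_L2_derivD(1)[OF l w(1)]] by blast
  have "Dx l u = w" "Dx l w = f" using Dx_eq[OF l] u w by auto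
  then show ?thesis using u w by (intro bexI[of _ u]) (auto simp: Sobolev0_2_iff[OF l])
qed

text \<open>The boundary values \<open>u'(L)\<close> and \<open>u(L)\<close> are the \<open>L\<^sup>2\<close> inner products of \<open>u''\<close> with
  these two functions.\<close>

definition slope_rep :: "real \<Rightarrow> l2" where "slope_rep l = to_l2 (indicat_real {0<..<l})"

definition value_rep :: "real \<Rightarrow> l2" where
  "value_rep l = to_l2 (\<lambda>x. indicat_real {0<..<l} x * (l - x))"

lemma inner_slope_rep:
  assumes "f \<in> L2 l"
  shows "inner (Abs_l2 f) (slope_rep l) = prim f l"
proof -
  have "inner (Abs_l2 f) (slope_rep l) = (LINT x|lebesgue. rep_L0 f x * indicat_real {0<..<l} x)"
    unfolding slope_rep_def inner_to_l2[OF sq_integrable_indicator] rep2_def Rep_Abs_L2[OF assms] ..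
  also have "\<dots> = (LINT x|lebesgue. rep_L0 f x)"
  proof (rule integral_cong_AE)
    show "AE x in lebesgue. rep_L0 f x * indicat_real {0<..<l} x = rep_L0 f x"
      using assms[unfolded L2_iff, THEN conjunct2] by eventually_elim (auto simp: indicator_def)
    show "(\<lambda>x. rep_L0 f x * indicat_real {0<..<l} x) \<in> borel_measurable lebesgue"
      using measurable_indicator_rep_L0[of "{0<..<l}" f] by (simp add: mult.commute)
  qed simp
  finally show ?thesis using prim_eq_l[OF assms order_refl] by simp
qed

lemma slope_eq:
  assumes l: "0 < l" and u: "u \<in> Sobolev0 l 2"
  shows "val l (Dx l u) l = inner (Abs_l2 (Dx l (Dx l u))) (slope_rep l)"
proof -
  note u' = u[unfolded Sobolev0_2_iff[OF l]]
  then have "val l (Dx l u) l = prim (Dx l (Dx l u)) l"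
    using has_L2_derivD(3)[OF l, of "Dx l u" "Dx l (Dx l u)" l] l by simp
  moreover have "Dx l (Dx l u) \<in> L2 l" using u' has_L2_derivD(2)[OF l] by blast
  ultimately show ?thesis by (simp add: inner_slope_rep)
qed

lemma sq_integrable_ramp: "sq_integrable (\<lambda>x. indicat_real {0<..<l} x * (l - x))"
proof -
  have "sq_integrable (\<lambda>x. indicat_real {0<..<l} x * (l - x) )"
    unfolding sq_integrable_def
  proof (rule conjI)
    have "(\<lambda>x. indicat_real {0<..<l} x * (l - x)) \<in> borel_measurable lborel" by measurable
    then show m: "(\<lambda>x. indicat_real {0<..<l} x * (l - x)) \<in> borel_measurable lebesgue"
      by (rule measurable_completion)
    show "integrable lebesgue (\<lambda>x. (indicat_real {0<..<l} x * (l - x))\<^sup>2)"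
    proof (rule Bochner_Integration.integrable_bound)
      show "integrable lebesgue (\<lambda>x. l\<^sup>2 * indicat_real {0<..<l} x)"
        by (intro integrable_mult_right integrable_indicator_Ioo)
      show "(\<lambda>x. (indicat_real {0<..<l} x * (l - x))\<^sup>2) \<in> borel_measurable lebesgue"
        using m by simp
      show "AE x in lebesgue. norm ((indicat_real {0<..<l} x * (l - x))\<^sup>2) \<le> norm (l\<^sup>2 * indicat_real {0<..<l} x)"
        by (rule AE_I2) (auto simp: indicator_def intro!: power_mono)
    qed
  qed
  then show ?thesis .
qed

text \<open>Integration by parts against the ramp \<open>l - x\<close>. It vanishes at
  \<open>l\<close> and \<open>u'\<close> vanishes at 0, so no boundary term is left, and the
  derivative -1 of the ramp leaves the integral of \<open>u'\<close>, which is
  \<open>u(l)\<close>.\<close>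

lemma value_eq:
  assumes l: "0 < l" and u: "u \<in> Sobolev0 l 2"
  shows "val l u l = inner (Abs_l2 (Dx l (Dx l u))) (value_rep l)"
proof -
  note u' = u[unfolded Sobolev0_2_iff[OF l]]
  define one where "one = abs_L0 (indicat_real {0<..<l})"
  define ramp where "ramp = abs_L0 (\<lambda>x. indicat_real {0<..<l} x * (l - x))"
  have one: "one \<in> L2 l" unfolding one_def by (rule abs_L0_L2[OF sq_integrable_indicator]) simp
  have ramp: "ramp \<in> L2 l" unfolding ramp_def by (rule abs_L0_L2[OF sq_integrable_ramp]) simp
  have rep_one: "AE x in lebesgue. rep_L0 one x = indicat_real {0<..<l} x"
    unfolding one_def using sq_integrable_indicator by (intro rep_abs_L0) (simp add: sq_integrable_def)
  have rep_ramp: "AE x in lebesgue. rep_L0 ramp x = indicat_real {0<..<l} x * (l - x)"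
    unfolding ramp_def using sq_integrable_ramp by (intro rep_abs_L0) (simp add: sq_integrable_def)
  have prim_one: "prim one x = x" if x: "x \<in> {0..l}" for x
  proof -
    have "AE y in lebesgue. y \<noteq> (0::real) \<and> y \<noteq> l"
      using AE_completion[OF AE_lborel_singleton[of 0]] AE_completion[OF AE_lborel_singleton[of l]]
      by eventually_elim simp
    then have "prim one x = (LINT y|lebesgue. indicat_real {0..x} y)"
      unfolding prim_eq_atMost[OF one]
    proof (intro integral_cong_AE)
      assume "AE y in lebesgue. y \<noteq> (0::real) \<and> y \<noteq> l"
      with rep_one show "AE y in lebesgue. indicat_real {..x} y * rep_L0 one y = indicat_real {0..x} y"
        by eventually_elim (use x in \<open>auto simp: indicator_def\<close>)
    qed (auto simp: borel_measurable_indicator)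
    also have "\<dots> = x" using x by simp
    finally show ?thesis .
  qed
  have c: "continuous_on {0..l} (\<lambda>x. l - x)" by (intro continuous_intros)
  have ae: "AE s in lebesgue. s \<in> {0<..<l} \<longrightarrow> rep_L0 ramp s = l - s"
    using rep_ramp by eventually_elim auto
  have vr: "val l ramp l = 0" using val_eq[OF c l ae, of l] l by simp
  have dr: "has_L2_deriv l ramp ((-1) *\<^sub>R one)"
  proof (rule has_L2_derivI[OF ramp L2_scaleR[OF one]])
    show "AE s in lebesgue. s \<in> {0<..<l} \<longrightarrow> rep_L0 ramp s = l + prim ((-1) *\<^sub>R one) s"
      using ae by eventually_elim (auto simp: prim_scaleR[OF l, of "-1" one, simplified] prim_one)
  qed
  have f: "Dx l (Dx l u) \<in> L2 l" and w: "Dx l u \<in> L2 l" using u' has_L2_derivD(2)[OF l] by auto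
  have "L2_inner l (Dx l (Dx l u)) ramp + L2_inner l (Dx l u) ((-1) *\<^sub>R one) = 0"
    using L2_inner_by_parts[OF l _ dr, of "Dx l u" "Dx l (Dx l u)"] u' vr by simp
  moreover have "L2_inner l (Dx l u) ((-1) *\<^sub>R one) = - inner (Abs_l2 (Dx l u)) (Abs_l2 one)"
    by (simp only: L2_inner_eq_inner[OF l w L2_scaleR[OF one]] Abs_l2_scaleR[OF one]) simp
  moreover have "Abs_l2 one = slope_rep l" "Abs_l2 ramp = value_rep l"
    by (simp_all add: one_def ramp_def slope_rep_def value_rep_def to_l2_def)
  ultimately have "inner (Abs_l2 (Dx l (Dx l u))) (value_rep l) = prim (Dx l u) l"
    using L2_inner_eq_inner[OF l f ramp] inner_slope_rep[OF w] by simp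
  then show ?thesis
    using u' has_L2_derivD(3)[OF l, of u "Dx l u" l] l by simp
qed

type_synonym ('n, 'm) hstate = "l2 \<times> l2 \<times> (real^'n) \<times> (real^'m) \<times> real \<times> real"

text \<open>The minimum over the compact unit sphere is positive, and both sides scale
  quadratically.\<close>

lemma pos_def_lower_bound:
  fixes P :: "real^'n^'n"
  assumes "pos_def P"
  shows "\<exists>c>0. \<forall>z. c * inner z z \<le> inner z (P *v z)"
proof -
  have c: "continuous_on (sphere 0 1) (\<lambda>z. inner z (P *v z))"
    by (intro continuous_intros linear_continuous_on matrix_vector_mul_bounded_linear)
  have "sphere (0::real^'n) 1 \<noteq> {}" by simp
  then obtain w where w: "w \<in> sphere 0 1" "\<And>z. z \<in> sphere 0 1 \<Longrightarrow> inner w (P *v w) \<le> inner z (P *v z)"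
    using continuous_attains_inf[OF compact_sphere _ c] by metis
  define c where "c = inner w (P *v w)"
  have "w \<noteq> 0" using w(1) by auto
  then have "c > 0" using assms by (simp add: pos_def_def c_def)
  moreover have "c * inner z z \<le> inner z (P *v z)" for z
  proof (cases "z = 0")
    case False
    define s where "s = z /\<^sub>R norm z"
    have s: "s \<in> sphere 0 1" "z = norm z *\<^sub>R s" using False by (auto simp: s_def)
    have "inner z (P *v z) = (norm z)\<^sup>2 * inner s (P *v s)"
      by (subst (1 2) s(2)) (simp add: power2_eq_square matrix_vector_mult_scaleR)
    moreover have "c * (norm z)\<^sup>2 \<le> inner s (P *v s) * (norm z)\<^sup>2"
      using w(2)[OF s(1)] by (intro mult_right_mono) (auto simp: c_def)
    ultimately show ?thesis by (simp add: power2_norm_eq_inner mult.commute)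
  qed simp
  ultimately show ?thesis by blast
qed

lemma quadratic_form_upper_bound:
  fixes P :: "real^'n^'n"
  shows "\<exists>C>0. \<forall>z. inner z (P *v z) \<le> C * inner z z"
proof -
  obtain K where K: "K > 0" "\<And>z. norm (P *v z) \<le> norm z * K"
    using bounded_linear.pos_bounded[OF matrix_vector_mul_bounded_linear[of P]] by blast
  have "inner z (P *v z) \<le> K * inner z z" for z
  proof -
    have "inner z (P *v z) \<le> norm z * norm (P *v z)" by (rule norm_cauchy_schwarz)
    also have "\<dots> \<le> norm z * (norm z * K)" by (intro mult_left_mono K) auto
    finally show ?thesis by (simp add: power2_norm_eq_inner[symmetric] power2_eq_square mult_ac)
  qed
  then show ?thesis using K by blast
qed

section \<open>The embedding of the state space and the equivalence of norms\<close>

locale beam_params =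
  fixes p :: "('n::finite, 'm::finite) beam"
  assumes sa: "standing_assumptions p"
begin

abbreviation "l \<equiv> len p"
abbreviation "X \<equiv> state_space p"
abbreviation "N \<equiv> norm_H p"

lemma params_pos: "l > 0" "rho p > 0" "Lam p > 0" "inertia p > 0" "mass p > 0"
  using sa by (auto simp: standing_assumptions_def)

lemma adm: "admissible (ctl1 p)" "admissible (ctl2 p)"
  using sa by (auto simp: standing_assumptions_def)

lemma cK_pos: "cK (ctl1 p) > 0" "cK (ctl2 p) > 0"
  using adm by (auto simp: admissible_def cK_def)

fun embed :: "('n, 'm) state \<Rightarrow> ('n, 'm) hstate" where
  "embed (u, v, z1, z2, \<xi>, \<psi>) = (Abs_l2 (Dx l (Dx l u)), Abs_l2 v, z1, z2, \<xi>, \<psi>)"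

definition cutH :: "('n, 'm) hstate \<Rightarrow> ('n, 'm) hstate" where
  "cutH = (\<lambda>(f, g, r). (cut l f, cut l g, r))"

text \<open>Projecting first makes the inverse of \<open>embed\<close> total and linear on the whole
  Hilbert space.\<close>

definition lift :: "('n, 'm) hstate \<Rightarrow> ('n, 'm) state" where
  "lift h = inv_into X embed (cutH h)"

lemma DDx_L2: "u \<in> Sobolev0 l 2 \<Longrightarrow> Dx l (Dx l u) \<in> L2 l"
  using has_L2_derivD(2)[OF params_pos(1)] by (auto simp: Sobolev0_2_iff[OF params_pos(1)])

lemma in_X: "(u, v, z1, z2, \<xi>, \<psi>) \<in> X \<longleftrightarrow> u \<in> Sobolev0 l 2 \<and> v \<in> L2 l"
  by (simp add: state_space_def)

lemma embed_lincomb: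
  assumes "x \<in> X" "y \<in> X"
  shows "x + r *\<^sub>R y \<in> X" "embed (x + r *\<^sub>R y) = embed x + r *\<^sub>R embed y"
proof -
  obtain u v z1 z2 \<xi> \<psi> where x: "x = (u, v, z1, z2, \<xi>, \<psi>)" by (cases x) auto
  obtain u' v' z1' z2' \<xi>' \<psi>' where y: "y = (u', v', z1', z2', \<xi>', \<psi>')" by (cases y) auto
  have u: "u \<in> Sobolev0 l 2" "u' \<in> Sobolev0 l 2" and v: "v \<in> L2 l" "v' \<in> L2 l"
    using assms by (simp_all add: x y in_X)
  note S = Sobolev0_2_lincomb[OF params_pos(1) u, of r]
  have A: "Abs_l2 (f + r *\<^sub>R g) = Abs_l2 f + r *\<^sub>R Abs_l2 g" if "f \<in> L2 l" "g \<in> L2 l" for f g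
    using that by (simp add: Abs_l2_plus[OF _ L2_scaleR] Abs_l2_scaleR)
  show "x + r *\<^sub>R y \<in> X" using S(1) L2_plus[OF v(1) L2_scaleR[OF v(2)]] by (simp add: x y in_X)
  show "embed (x + r *\<^sub>R y) = embed x + r *\<^sub>R embed y"
    by (simp add: x y S(2) A[OF v] A[OF DDx_L2[OF u(1)] DDx_L2[OF u(2)]])
qed

lemma embed_plus: "x \<in> X \<Longrightarrow> y \<in> X \<Longrightarrow> x + y \<in> X" "x \<in> X \<Longrightarrow> y \<in> X \<Longrightarrow> embed (x + y) = embed x + embed y"
  using embed_lincomb[of x y 1] by simp_all

lemma embed_minus: "x \<in> X \<Longrightarrow> y \<in> X \<Longrightarrow> x - y \<in> X" "x \<in> X \<Longrightarrow> y \<in> X \<Longrightarrow> embed (x - y) = embed x - embed y"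
  using embed_lincomb[of x y "-1"] by simp_all

lemma zero_X: "0 \<in> X" and embed_zero: "embed 0 = 0"
proof -
  obtain u where "u \<in> Sobolev0 l 2" using Sobolev0_2_surj[OF params_pos(1) L2_zero] by blast
  then have "(u, 0, 0, 0, 0, 0) \<in> X" by (simp add: in_X L2_zero)
  \<comment> \<open>Zero arises as a difference of equal states, which avoids computing
    \<open>Dx l 0\<close>.\<close>
  from embed_minus[OF this this] show "0 \<in> X" "embed 0 = 0" by simp_all
qed

lemma embed_scaleR: "x \<in> X \<Longrightarrow> r *\<^sub>R x \<in> X" "x \<in> X \<Longrightarrow> embed (r *\<^sub>R x) = r *\<^sub>R embed x"
  using embed_lincomb[OF zero_X, of x r] by (simp_all add: embed_zero)

lemma embed_sum:
  assumes "finite A" "\<And>i. i \<in> A \<Longrightarrow> f i \<in> X"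
  shows "sum f A \<in> X \<and> embed (sum f A) = (\<Sum>i\<in>A. embed (f i))"
  using assms by (induction A rule: finite_induct) (auto simp: zero_X embed_zero embed_plus)

lemma inj_on_embed: "inj_on embed X"
proof (rule inj_onI)
  fix x y assume x: "x \<in> X" and y: "y \<in> X" and eq: "embed x = embed y"
  obtain u v r where x': "x = (u, v, r)" by (cases x)
  obtain u' v' r' where y': "y = (u', v', r')" by (cases y)
  obtain a1 a2 a3 a4 where r: "r = (a1, a2, a3, a4)" by (cases r)
  obtain b1 b2 b3 b4 where r': "r' = (b1, b2, b3, b4)" by (cases r')
  have "Abs_l2 (Dx l (Dx l u)) = Abs_l2 (Dx l (Dx l u'))" "Abs_l2 v = Abs_l2 v'" "r = r'"
    using eq by (auto simp: x' y' r r')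
  then have "Dx l (Dx l u) = Dx l (Dx l u')" "v = v'"
    using x y Rep_Abs_L2 DDx_L2 unfolding x' y' r r' in_X by metis+
  then show "x = y"
    using x y Sobolev0_2_eq_iff[OF params_pos(1)] \<open>r = r'\<close> unfolding x' y' r r' in_X by blast
qed

lemma cutH_embed: "x \<in> X \<Longrightarrow> cutH (embed x) = embed x"
  by (cases x) (auto simp: cutH_def in_X DDx_L2 Rep_Abs_L2[where l=l] intro!: cut_eq_self)

lemma cutH_in_range: "cutH h \<in> embed ` X"
proof -
  obtain f g z1 z2 \<xi> \<psi> where h: "h = (f, g, z1, z2, \<xi>, \<psi>)" by (cases h) auto
  obtain u where u: "u \<in> Sobolev0 l 2" "Dx l (Dx l u) = Rep_l2 (cut l f)"
    using Sobolev0_2_surj[OF params_pos(1) Rep_cut_L2] by blast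
  have "embed (u, Rep_l2 (cut l g), z1, z2, \<xi>, \<psi>) = cutH h"
    by (simp add: h cutH_def u Rep_l2_inverse)
  moreover have "(u, Rep_l2 (cut l g), z1, z2, \<xi>, \<psi>) \<in> X" by (simp add: in_X u Rep_cut_L2)
  ultimately show ?thesis by (metis imageI)
qed

lemma lift_in: "lift h \<in> X"
  unfolding lift_def by (rule inv_into_into[OF cutH_in_range])

lemma embed_lift: "embed (lift h) = cutH h"
  unfolding lift_def by (rule f_inv_into_f[OF cutH_in_range])

lemma lift_embed: "x \<in> X \<Longrightarrow> lift (embed x) = x"
  unfolding lift_def by (simp add: cutH_embed inv_into_f_f[OF inj_on_embed])

lemma bounded_linear_cutH: "bounded_linear cutH"
  unfolding cutH_def case_prod_unfold
  by (intro bounded_linear_Pair bounded_linear_compose[OF bounded_linear_cut]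
      bounded_linear_fst bounded_linear_compose[OF bounded_linear_fst bounded_linear_snd]
      bounded_linear_compose[OF bounded_linear_snd bounded_linear_snd])

lemma lift_plus: "lift (a + b) = lift a + lift b"
proof -
  have "embed (lift (a + b)) = embed (lift a + lift b)"
    by (simp add: embed_plus lift_in embed_lift linear_add[OF bounded_linear.linear[OF bounded_linear_cutH]])
  then show ?thesis using inj_onD[OF inj_on_embed] embed_plus lift_in by blast
qed

lemma lift_scaleR: "lift (r *\<^sub>R a) = r *\<^sub>R lift a"
proof -
  have "embed (lift (r *\<^sub>R a)) = embed (r *\<^sub>R lift a)"
    by (simp add: embed_scaleR lift_in embed_lift linear_scale[OF bounded_linear.linear[OF bounded_linear_cutH]])
  then show ?thesis using inj_onD[OF inj_on_embed] embed_scaleR lift_in by blast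
qed

definition quad :: "('n, 'm) hstate \<Rightarrow> real" where
  "quad = (\<lambda>(f, g, z1, z2, \<xi>, \<psi>). Lam p * inner f f + rho p * inner g g + \<xi> * \<xi> / inertia p + \<psi> * \<psi> / mass p
     + cK (ctl1 p) * (inner f (slope_rep l))\<^sup>2 + cK (ctl2 p) * (inner f (value_rep l))\<^sup>2
     + inner z1 (cP (ctl1 p) *v z1) + inner z2 (cP (ctl2 p) *v z2))"

lemma norm_H_eq:
  assumes "x \<in> X"
  shows "N x = sqrt (quad (embed x))"
  using assms
  by (cases x) (auto simp: norm_H_def quad_def Let_def in_X L2_inner_eq_inner[OF params_pos(1)] DDx_L2
      slope_eq[OF params_pos(1)] value_eq[OF params_pos(1)] power2_eq_square mult.assoc)

lemma quad_bounds: "\<exists>c>0. \<exists>C>0. \<forall>h. c * inner h h \<le> quad h \<and> quad h \<le> C * inner h h"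
proof -
  have P: "pos_def (cP (ctl1 p))" "pos_def (cP (ctl2 p))"
    using adm by (auto simp: admissible_def cP_def)
  obtain c1 where c1: "c1 > 0" "\<And>z. c1 * inner z z \<le> inner z (cP (ctl1 p) *v z)"
    using pos_def_lower_bound[OF P(1)] by blast
  obtain c2 where c2: "c2 > 0" "\<And>z. c2 * inner z z \<le> inner z (cP (ctl2 p) *v z)"
    using pos_def_lower_bound[OF P(2)] by blast
  obtain C1 where C1: "C1 > 0" "\<And>z. inner z (cP (ctl1 p) *v z) \<le> C1 * inner z z"
    using quadratic_form_upper_bound by blast
  obtain C2 where C2: "C2 > 0" "\<And>z. inner z (cP (ctl2 p) *v z) \<le> C2 * inner z z"
    using quadratic_form_upper_bound by blast
  define J where "J = 1 / inertia p" define m where "m = 1 / mass p"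
  have Jm: "J > 0" "m > 0" using params_pos by (auto simp: J_def m_def)
  define c where "c = Min {Lam p, rho p, J, m, c1, c2}"
  define k where "k = cK (ctl1 p) * inner (slope_rep l) (slope_rep l) + cK (ctl2 p) * inner (value_rep l) (value_rep l)"
  define C where "C = Lam p + rho p + J + m + C1 + C2 + k"
  have c: "c > 0" "c \<le> Lam p" "c \<le> rho p" "c \<le> J" "c \<le> m" "c \<le> c1" "c \<le> c2"
    using params_pos c1 c2 Jm by (auto simp: c_def)
  have k0: "k \<ge> 0" using cK_pos by (simp add: k_def)
  have C: "C > 0" "Lam p + k \<le> C" "rho p \<le> C" "J \<le> C" "m \<le> C" "C1 \<le> C" "C2 \<le> C"
    using params_pos C1 C2 Jm k0 by (auto simp: C_def)
  have "c * inner h h \<le> quad h \<and> quad h \<le> C * inner h h" for h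
  proof -
    obtain f g z1 z2 \<xi> \<psi> where h: "h = (f, g, z1, z2, \<xi>, \<psi>)" by (cases h) auto
    have q: "quad h = Lam p * inner f f + rho p * inner g g + J * (\<xi> * \<xi>) + m * (\<psi> * \<psi>)
     + (cK (ctl1 p) * (inner f (slope_rep l))\<^sup>2 + cK (ctl2 p) * (inner f (value_rep l))\<^sup>2)
     + inner z1 (cP (ctl1 p) *v z1) + inner z2 (cP (ctl2 p) *v z2)"
      by (simp add: h quad_def J_def m_def)
    have i: "inner h h = inner f f + inner g g + inner z1 z1 + inner z2 z2 + \<xi> * \<xi> + \<psi> * \<psi>"
      by (simp add: h inner_prod_def)
    have bnd: "0 \<le> cK (ctl1 p) * (inner f (slope_rep l))\<^sup>2 + cK (ctl2 p) * (inner f (value_rep l))\<^sup>2"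
      using cK_pos by simp
    have bnd': "cK (ctl1 p) * (inner f (slope_rep l))\<^sup>2 + cK (ctl2 p) * (inner f (value_rep l))\<^sup>2 \<le> k * inner f f"
    proof -
      have "cK (ctl1 p) * (inner f (slope_rep l))\<^sup>2 \<le> cK (ctl1 p) * (inner f f * inner (slope_rep l) (slope_rep l))"
        "cK (ctl2 p) * (inner f (value_rep l))\<^sup>2 \<le> cK (ctl2 p) * (inner f f * inner (value_rep l) (value_rep l))"
        using cK_pos by (auto intro!: mult_left_mono Cauchy_Schwarz_ineq)
      then show ?thesis by (simp add: k_def algebra_simps)
    qed
    have lo: "c * inner f f \<le> Lam p * inner f f" "c * inner g g \<le> rho p * inner g g"
      "c * (\<xi> * \<xi>) \<le> J * (\<xi> * \<xi>)" "c * (\<psi> * \<psi>) \<le> m * (\<psi> * \<psi>)"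
      "c * inner z1 z1 \<le> c1 * inner z1 z1" "c * inner z2 z2 \<le> c2 * inner z2 z2"
      using c by (auto intro!: mult_right_mono)
    have hi: "(Lam p + k) * inner f f \<le> C * inner f f" "rho p * inner g g \<le> C * inner g g"
      "J * (\<xi> * \<xi>) \<le> C * (\<xi> * \<xi>)" "m * (\<psi> * \<psi>) \<le> C * (\<psi> * \<psi>)"
      "C1 * inner z1 z1 \<le> C * inner z1 z1" "C2 * inner z2 z2 \<le> C * inner z2 z2"
      using C by (auto intro!: mult_right_mono)
    show ?thesis
      using lo hi bnd bnd' c1(2)[of z1] c2(2)[of z2] C1(2)[of z1] C2(2)[of z2]
      unfolding q i distrib_left distrib_right by argo
  qed
  then show ?thesis using c(1) C(1) by blast
qed

lemma norm_equiv: "\<exists>c>0. \<exists>C>0. \<forall>x\<in>X. c * norm (embed x) \<le> N x \<and> N x \<le> C * norm (embed x)"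
proof -
  obtain c C where cC: "c > 0" "C > 0" "\<And>h. c * inner h h \<le> quad h" "\<And>h. quad h \<le> C * inner h h"
    using quad_bounds by blast
  have "sqrt c * norm (embed x) \<le> N x \<and> N x \<le> sqrt C * norm (embed x)" if "x \<in> X" for x
    using cC(3,4)[of "embed x"] that
    by (simp add: norm_H_eq norm_eq_sqrt_inner[of "embed x"] flip: real_sqrt_mult)
  then show ?thesis using cC(1,2) by (intro exI[of _ "sqrt c"] conjI exI[of _ "sqrt C"]) auto
qed

definition norm_bounds :: "real \<times> real" where
  "norm_bounds = (SOME (c, C). c > 0 \<and> C > 0 \<and> (\<forall>x\<in>X. c * norm (embed x) \<le> N x \<and> N x \<le> C * norm (embed x)))"

abbreviation "nlo \<equiv> fst norm_bounds"
abbreviation "nhi \<equiv> snd norm_bounds"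

lemma nlo_nhi: "nlo > 0" "nhi > 0" "\<And>x. x \<in> X \<Longrightarrow> nlo * norm (embed x) \<le> N x" "\<And>x. x \<in> X \<Longrightarrow> N x \<le> nhi * norm (embed x)"
proof -
  let ?P = "\<lambda>(c, C). c > 0 \<and> C > 0 \<and> (\<forall>x\<in>X. c * norm (embed x) \<le> N x \<and> N x \<le> C * norm (embed x))"
  have "\<exists>b. ?P b" using norm_equiv by auto
  then have "?P norm_bounds" unfolding norm_bounds_def by (rule someI_ex)
  then show "nlo > 0" "nhi > 0" "\<And>x. x \<in> X \<Longrightarrow> nlo * norm (embed x) \<le> N x" "\<And>x. x \<in> X \<Longrightarrow> N x \<le> nhi * norm (embed x)"
    by (auto simp: case_prod_beta)
qed

lemma N_tendsto_iff:
  assumes "\<forall>\<^sub>F a in F. f a \<in> X"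
  shows "((\<lambda>a. N (f a)) \<longlongrightarrow> 0) F \<longleftrightarrow> ((\<lambda>a. embed (f a)) \<longlongrightarrow> 0) F"
proof
  assume "((\<lambda>a. N (f a)) \<longlongrightarrow> 0) F"
  then have t: "((\<lambda>a. N (f a) / nlo) \<longlongrightarrow> 0) F" by (rule tendsto_divide_zero)
  show "((\<lambda>a. embed (f a)) \<longlongrightarrow> 0) F"
    by (rule Lim_null_comparison[OF eventually_mono[OF assms] t]) (use nlo_nhi in \<open>simp add: field_simps\<close>)
next
  assume "((\<lambda>a. embed (f a)) \<longlongrightarrow> 0) F"
  then have t: "((\<lambda>a. nhi * norm (embed (f a))) \<longlongrightarrow> 0) F"
    by (intro tendsto_mult_right_zero tendsto_norm_zero)
  have n0: "N x \<ge> 0" if "x \<in> X" for x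
    using nlo_nhi(3)[OF that] nlo_nhi(1) by (meson mult_nonneg_nonneg norm_ge_zero order_less_imp_le order_trans)
  show "((\<lambda>a. N (f a)) \<longlongrightarrow> 0) F"
    by (rule Lim_null_comparison[OF eventually_mono[OF assms] t]) (use nlo_nhi(4) n0 in auto)
qed

text \<open>Riemann sums are finite linear combinations and so commute with \<open>embed\<close>,
  and the equivalence of norms transfers the smallness of their errors up to a constant. Thus Banach
  space integration becomes available for the integral defined through
  \<open>norm_H\<close>.\<close>

lemma has_integral_wrt_iff:
  assumes f: "\<And>s. s \<in> {a..b} \<Longrightarrow> f s \<in> X" and I: "I \<in> X"
  shows "has_integral_wrt N f I a b \<longleftrightarrow> ((\<lambda>s. embed (f s)) has_integral embed I) {a..b}"
proof -
  let ?R = "\<lambda>\<D>. (\<Sum>(x, k)\<in>\<D>. measure lborel k *\<^sub>R f x) - I"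
  let ?R' = "\<lambda>\<D>. (\<Sum>(x, k)\<in>\<D>. measure lborel k *\<^sub>R embed (f x)) - embed I"
  have R: "?R \<D> \<in> X \<and> embed (?R \<D>) = ?R' \<D>" if D: "\<D> tagged_division_of {a..b}" for \<D>
  proof -
    have fin: "finite \<D>" using D by (rule tagged_division_of_finite)
    have pt: "f x \<in> X" if "(x, k) \<in> \<D>" for x k
      using tagged_division_ofD(2,3)[OF D that] f by blast
    have "(\<lambda>(x, k). measure lborel k *\<^sub>R f x) i \<in> X \<and>
        embed ((\<lambda>(x, k). measure lborel k *\<^sub>R f x) i) = (\<lambda>(x, k). measure lborel k *\<^sub>R embed (f x)) i" if "i \<in> \<D>" for i
      using that pt by (cases i) (auto simp: embed_scaleR)
    then have "(\<Sum>(x, k)\<in>\<D>. measure lborel k *\<^sub>R f x) \<in> X \<and>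
        embed (\<Sum>(x, k)\<in>\<D>. measure lborel k *\<^sub>R f x) = (\<Sum>(x, k)\<in>\<D>. measure lborel k *\<^sub>R embed (f x))"
      using embed_sum[OF fin, of "\<lambda>(x, k). measure lborel k *\<^sub>R f x"] by (auto cong: sum.cong)
    then show ?thesis using embed_minus[OF _ I] by auto
  qed
  have transfer: "\<forall>e>0. \<exists>\<gamma>. gauge \<gamma> \<and> (\<forall>\<D>. \<D> tagged_division_of {a..b} \<and> \<gamma> fine \<D> \<longrightarrow> A \<D> < e)"
    if B: "\<forall>e>0. \<exists>\<gamma>. gauge \<gamma> \<and> (\<forall>\<D>. \<D> tagged_division_of {a..b} \<and> \<gamma> fine \<D> \<longrightarrow> B \<D> < e)"
      and c: "c > 0" and le: "\<And>\<D>. \<D> tagged_division_of {a..b} \<Longrightarrow> A \<D> \<le> c * B \<D>" for A B and c :: real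
  proof (intro allI impI)
    fix e :: real assume e: "e > 0"
    obtain \<gamma> where g: "gauge \<gamma>" "\<forall>\<D>. \<D> tagged_division_of {a..b} \<and> \<gamma> fine \<D> \<longrightarrow> B \<D> < e / c"
      using B[rule_format, of "e / c"] c e by auto
    have "A \<D> < e" if "\<D> tagged_division_of {a..b} \<and> \<gamma> fine \<D>" for \<D>
    proof -
      have "c * B \<D> < e" using g(2) that c by (simp add: field_simps)
      then show ?thesis using le[of \<D>] that by linarith
    qed
    then show "\<exists>\<gamma>. gauge \<gamma> \<and> (\<forall>\<D>. \<D> tagged_division_of {a..b} \<and> \<gamma> fine \<D> \<longrightarrow> A \<D> < e)"
      using g(1) by blast
  qed
  show ?thesis
    unfolding has_integral_wrt_def has_integral_real
  proof (intro iffI; erule transfer)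
    show "norm (?R' \<D>) \<le> 1 / nlo * N (?R \<D>)" if "\<D> tagged_division_of {a..b}" for \<D>
      using nlo_nhi(3)[of "?R \<D>"] R[OF that] nlo_nhi(1) by (simp add: field_simps)
    show "N (?R \<D>) \<le> nhi * norm (?R' \<D>)" if "\<D> tagged_division_of {a..b}" for \<D>
      using nlo_nhi(4)[of "?R \<D>"] R[OF that] by simp
  qed (use nlo_nhi in auto)
qed

end

section \<open>The beam semigroup on the Hilbert space\<close>

locale beam_system = beam_params p for p :: "('n::finite, 'm::finite) beam" +
  fixes S :: "real \<Rightarrow> ('n, 'm) state \<Rightarrow> ('n, 'm) state"
  assumes sg: "C0_contraction_semigroup X N S"
    and gen: "is_generator X N S (dom_A p) (op_L p)"
begin

lemma S_facts:
  shows "\<And>t x. t \<ge> 0 \<Longrightarrow> x \<in> X \<Longrightarrow> S t x \<in> X"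
    "\<And>t x. t \<ge> 0 \<Longrightarrow> x \<in> X \<Longrightarrow> N (S t x) \<le> N x"
    "\<And>t x y. t \<ge> 0 \<Longrightarrow> x \<in> X \<Longrightarrow> y \<in> X \<Longrightarrow> S t (x + y) = S t x + S t y"
    "\<And>t x r. t \<ge> 0 \<Longrightarrow> x \<in> X \<Longrightarrow> S t (r *\<^sub>R x) = r *\<^sub>R S t x"
    "\<And>x. x \<in> X \<Longrightarrow> S 0 x = x"
    "\<And>s t x. s \<ge> 0 \<Longrightarrow> t \<ge> 0 \<Longrightarrow> x \<in> X \<Longrightarrow> S (s + t) x = S s (S t x)"
    "\<And>x. x \<in> X \<Longrightarrow> ((\<lambda>t. N (S t x - x)) \<longlongrightarrow> 0) (at_right 0)"
  using sg unfolding C0_contraction_semigroup_def by auto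

definition St :: "real \<Rightarrow> ('n, 'm) hstate \<Rightarrow> ('n, 'm) hstate" where
  "St t h = embed (S t (lift h))"

lemma St_embed: "x \<in> X \<Longrightarrow> St t (embed x) = embed (S t x)"
  by (simp add: St_def lift_embed)

lemma St_0: "St 0 h = cutH h"
  by (simp add: St_def S_facts(5) lift_in embed_lift)

lemma bounded_semigroup_St: "\<exists>M. bounded_semigroup St M"
proof -
  obtain K where K: "K > 0" "\<And>h. norm (cutH h) \<le> norm h * K"
    using bounded_linear.pos_bounded[OF bounded_linear_cutH] by blast
  \<comment> \<open>Contraction is a property of \<open>norm_H\<close>; in the Hilbert norm it costs
    the ratio of the equivalence constants, and the projection contributes \<open>K\<close>.\<close>
  have "bounded_semigroup St (nhi / nlo * K)"
  proof (rule bounded_semigroup.intro)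
    show "nhi / nlo * K > 0" using nlo_nhi K by simp
    fix t :: real assume t: "t \<ge> 0"
    show "linear (St t)"
      by (rule linearI) (simp_all add: St_def lift_plus lift_scaleR S_facts lift_in embed_plus embed_scaleR t)
    show "norm (St t h) \<le> nhi / nlo * K * norm h" for h
    proof -
      have "nlo * norm (St t h) \<le> N (S t (lift h))"
        unfolding St_def by (rule nlo_nhi(3)[OF S_facts(1)[OF t lift_in]])
      also have "\<dots> \<le> N (lift h)" by (rule S_facts(2)[OF t lift_in])
      also have "\<dots> \<le> nhi * norm (cutH h)" using nlo_nhi(4)[OF lift_in] by (simp add: embed_lift)
      also have "\<dots> \<le> nhi * (norm h * K)" using K nlo_nhi by (intro mult_left_mono) auto
      finally show ?thesis using nlo_nhi(1) by (simp add: field_simps)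
    qed
  next
    fix s t h assume "(s::real) \<ge> 0" "(t::real) \<ge> 0"
    then show "St (s + t) h = St s (St t h)"
      by (simp add: St_def lift_embed S_facts lift_in)
  next
    fix h
    have ev: "\<forall>\<^sub>F t in at_right 0. S t (lift h) - lift h \<in> X"
      unfolding eventually_at_right_field by (intro exI[of _ 1]) (auto intro!: embed_minus(1) S_facts(1) lift_in)
    have "((\<lambda>t. embed (S t (lift h) - lift h)) \<longlongrightarrow> 0) (at_right 0)"
      using S_facts(7)[OF lift_in[of h]] N_tendsto_iff[OF ev] by simp
    then have "((\<lambda>t. St t h - St 0 h) \<longlongrightarrow> 0) (at_right 0)"
      by (rule tendsto_at_right_0_cong) (simp add: St_def embed_minus S_facts lift_in)
    then show "((\<lambda>t. St t h) \<longlongrightarrow> St 0 h) (at_right 0)" by (rule LIM_zero_cancel)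
  qed
  then show ?thesis by blast
qed

definition Mst :: real where "Mst = (SOME M. bounded_semigroup St M)"

sublocale bounded_semigroup St Mst
  unfolding Mst_def by (rule someI_ex[OF bounded_semigroup_St])

text \<open>Serves in both directions: to differentiate orbits that start in the domain, and to
  recognise a state as a member of the domain once a limit has been found.\<close>

lemma generator_iff:
  assumes x: "x \<in> X" and w: "w \<in> X"
  shows "((\<lambda>k. (St k (embed x) - embed x) /\<^sub>R k) \<longlongrightarrow> embed w) (at_right 0) \<longleftrightarrow> x \<in> dom_A p \<and> w = op_L p x"
proof -
  have ev: "\<forall>\<^sub>F k in at_right 0. (1 / k) *\<^sub>R (S k x - x) - w \<in> X"
    unfolding eventually_at_right_field
    by (intro exI[of _ 1]) (auto intro!: embed_minus(1) embed_scaleR(1) S_facts(1) x w)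
  have "x \<in> dom_A p \<and> w = op_L p x \<longleftrightarrow> ((\<lambda>h. N ((1 / h) *\<^sub>R (S h x - x) - w)) \<longlongrightarrow> 0) (at_right 0)"
    using gen x w unfolding is_generator_def by blast
  also have "\<dots> \<longleftrightarrow> ((\<lambda>k. embed ((1 / k) *\<^sub>R (S k x - x) - w)) \<longlongrightarrow> 0) (at_right 0)"
    by (rule N_tendsto_iff[OF ev])
  also have "\<dots> \<longleftrightarrow> ((\<lambda>k. (St k (embed x) - embed x) /\<^sub>R k - embed w) \<longlongrightarrow> 0) (at_right 0)"
  proof (rule tendsto_cong)
    show "\<forall>\<^sub>F k in at_right 0. embed ((1 / k) *\<^sub>R (S k x - x) - w) = (St k (embed x) - embed x) /\<^sub>R k - embed w"
      unfolding eventually_at_right_field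
      by (intro exI[of _ 1]) (auto simp: embed_minus embed_scaleR S_facts x w St_embed divide_inverse)
  qed
  also have "\<dots> \<longleftrightarrow> ((\<lambda>k. (St k (embed x) - embed x) /\<^sub>R k) \<longlongrightarrow> embed w) (at_right 0)"
    by (rule LIM_zero_iff)
  finally show ?thesis ..
qed

lemma dom_A_X: "x \<in> dom_A p \<Longrightarrow> x \<in> X"
  using Sobolev0_4D(1)[OF params_pos(1)] Sobolev0_2_iff[OF params_pos(1)] has_L2_derivD(1)[OF params_pos(1)]
  by (auto simp: dom_A_def in_X)

lemma op_L_X:
  assumes "x \<in> dom_A p"
  shows "op_L p x \<in> X"
proof -
  obtain u v z1 z2 \<xi> \<psi> where x: "x = (u, v, z1, z2, \<xi>, \<psi>)" by (cases x) auto
  have u: "u \<in> Sobolev0 l 4" and v: "v \<in> Sobolev0 l 2" using assms by (auto simp: x dom_A_def)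
  have "Dx l (Dx l (Dx l (Dx l u))) \<in> L2 l"
    using Sobolev0_4D(3)[OF params_pos(1) u] by (rule has_L2_derivD(2)[OF params_pos(1)])
  from L2_scaleR[OF this, of "- (Lam p / rho p)"] v show ?thesis
    by (simp add: x op_L_def Let_def in_X)
qed

text \<open>\<open>St t\<close> is bounded and commutes with \<open>St k\<close>, so it can be
  applied to the convergent difference quotient at 0.\<close>

lemma domain_invariant:
  assumes x: "x \<in> dom_A p" and t: "t \<ge> 0"
  shows "S t x \<in> dom_A p"
proof -
  note xX = dom_A_X[OF x] and wX = op_L_X[OF x]
  have "((\<lambda>k. (St k (embed x) - embed x) /\<^sub>R k) \<longlongrightarrow> embed (op_L p x)) (at_right 0)"
    using generator_iff[OF xX wX] x by simp
  then have "((\<lambda>k. St t ((St k (embed x) - embed x) /\<^sub>R k)) \<longlongrightarrow> St t (embed (op_L p x))) (at_right 0)"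
    by (rule bounded_linear.tendsto[OF blin[OF t]])
  then have "((\<lambda>k. (St k (embed (S t x)) - embed (S t x)) /\<^sub>R k) \<longlongrightarrow> embed (S t (op_L p x))) (at_right 0)"
    unfolding St_embed[OF wX]
  proof (rule tendsto_at_right_0_cong)
    show "St t ((St k (embed x) - embed x) /\<^sub>R k) = (St k (embed (S t x)) - embed (S t x)) /\<^sub>R k" if "k > 0" for k
    proof -
      have "St t (St k (embed x)) = St k (St t (embed x))"
        using semigroup[of t k "embed x"] semigroup[of k t "embed x"] t that by (simp add: add.commute)
      then show ?thesis
        using t that by (simp add: linear_scale[OF lin] S_diff St_embed[OF xX, symmetric])
    qed
  qed
  then show ?thesis
    using generator_iff[OF S_facts(1)[OF t xX] S_facts(1)[OF t wX]] by simp
qed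

text \<open>The averages from \<open>domain_dense\<close> are fixed by the projection and hence come
  from states; their difference quotients converge, which places these states in the domain.\<close>

lemma domain_closure:
  assumes "St 0 h = h"
  shows "h \<in> closure (embed ` dom_A p)"
  unfolding closure_approachable
proof (intro allI impI)
  fix e :: real assume "e > 0"
  from domain_dense[OF assms this] obtain J w where J: "dist J h < e" "St 0 J = J" "St 0 w = w"
    "((\<lambda>k. (St k J - J) /\<^sub>R k) \<longlongrightarrow> w) (at_right 0)" by blast
  have "embed (lift J) = J" "embed (lift w) = w" using J(2,3) by (simp_all add: St_0 embed_lift)
  then have "lift J \<in> dom_A p" using generator_iff[OF lift_in lift_in, of J w] J(4) by simp
  then show "\<exists>y\<in>embed ` dom_A p. dist y h < e" using J(1) \<open>embed (lift J) = J\<close> by force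
qed

end

section \<open>Locally Lipschitz maps and the coefficient functions\<close>

text \<open>Compact sets are used instead of neighbourhoods: continuous images of compact sets are
  compact, so compositions need no covering argument.\<close>

definition loc_lip :: "('a::metric_space \<Rightarrow> 'b::metric_space) \<Rightarrow> bool" where
  "loc_lip f \<longleftrightarrow> (\<forall>K. compact K \<longrightarrow> (\<exists>L. L-lipschitz_on K f))"

lemma loc_lipE:
  assumes "loc_lip f" "compact K"
  obtains L where "L-lipschitz_on K f"
  using assms unfolding loc_lip_def by blast

lemma loc_lip_continuous_on:
  assumes "loc_lip f" "compact K"
  shows "continuous_on K f"
  using loc_lipE[OF assms] lipschitz_on_continuous_on by blast

lemma loc_lip_const: "loc_lip (\<lambda>_. c)"
  unfolding loc_lip_def using lipschitz_on_constant by blast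

lemma loc_lip_bounded_linear: "bounded_linear f \<Longrightarrow> loc_lip f"
  unfolding loc_lip_def by (metis bounded_linear.lipschitz_boundE)

lemma loc_lip_add:
  fixes f g :: "_ \<Rightarrow> 'b::real_normed_vector"
  shows "loc_lip f \<Longrightarrow> loc_lip g \<Longrightarrow> loc_lip (\<lambda>x. f x + g x)"
  unfolding loc_lip_def by (metis lipschitz_on_add)

lemma loc_lip_diff:
  fixes f g :: "_ \<Rightarrow> 'b::real_normed_vector"
  shows "loc_lip f \<Longrightarrow> loc_lip g \<Longrightarrow> loc_lip (\<lambda>x. f x - g x)"
  unfolding loc_lip_def by (metis lipschitz_on_diff)

lemma loc_lip_Pair: "loc_lip f \<Longrightarrow> loc_lip g \<Longrightarrow> loc_lip (\<lambda>x. (f x, g x))"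
  unfolding loc_lip_def by (metis lipschitz_on_Pair)

lemma loc_lip_compose:
  fixes f :: "'a::metric_space \<Rightarrow> 'b::metric_space" and g :: "'b \<Rightarrow> 'c::metric_space"
  assumes g: "loc_lip g" and f: "loc_lip f"
  shows "loc_lip (\<lambda>x. g (f x))"
  unfolding loc_lip_def
proof (intro allI impI)
  fix K :: "'a set" assume K: "compact K"
  obtain L where L: "L-lipschitz_on K f" by (rule loc_lipE[OF f K])
  have "compact (f ` K)" by (rule compact_continuous_image[OF loc_lip_continuous_on[OF f K] K])
  then obtain L' where "L'-lipschitz_on (f ` K) g" by (rule loc_lipE[OF g])
  with L show "\<exists>L. L-lipschitz_on K (\<lambda>x. g (f x))" using lipschitz_on_compose2 by blast
qed

lemma loc_lip_scaleR:
  fixes f :: "'a::metric_space \<Rightarrow> real" and g :: "'a \<Rightarrow> 'b::real_normed_vector"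
  assumes f: "loc_lip f" and g: "loc_lip g"
  shows "loc_lip (\<lambda>x. f x *\<^sub>R g x)"
  unfolding loc_lip_def
proof (intro allI impI)
  fix K :: "'a set" assume K: "compact K"
  obtain L where L: "L-lipschitz_on K f" by (rule loc_lipE[OF f K])
  obtain L' where L': "L'-lipschitz_on K g" by (rule loc_lipE[OF g K])
  obtain B where B: "B > 0" "\<And>x. x \<in> K \<Longrightarrow> norm (f x) \<le> B"
    using compact_imp_bounded[OF compact_continuous_image[OF loc_lip_continuous_on[OF f K] K]]
    unfolding bounded_pos by blast
  obtain B' where B': "B' > 0" "\<And>x. x \<in> K \<Longrightarrow> norm (g x) \<le> B'"
    using compact_imp_bounded[OF compact_continuous_image[OF loc_lip_continuous_on[OF g K] K]]
    unfolding bounded_pos by blast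
  have "(B * L' + L * B')-lipschitz_on K (\<lambda>x. f x *\<^sub>R g x)"
  proof (rule lipschitz_onI)
    fix x y assume xy: "x \<in> K" "y \<in> K"
    have "f x *\<^sub>R g x - f y *\<^sub>R g y = f x *\<^sub>R (g x - g y) + (f x - f y) *\<^sub>R g y"
      by (simp add: algebra_simps)
    also have "norm \<dots> \<le> norm (f x) * dist (g x) (g y) + dist (f x) (f y) * norm (g y)"
      unfolding dist_norm by (rule order_trans[OF norm_triangle_ineq]) simp
    also have "\<dots> \<le> B * (L' * dist x y) + (L * dist x y) * B'"
      using B B' xy lipschitz_onD[OF L xy] lipschitz_onD[OF L' xy] lipschitz_on_nonneg[OF L]
      by (intro add_mono mult_mono) auto
    finally show "dist (f x *\<^sub>R g x) (f y *\<^sub>R g y) \<le> (B * L' + L * B') * dist x y"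
      by (simp add: dist_norm algebra_simps)
  qed (use B B' lipschitz_on_nonneg[OF L] lipschitz_on_nonneg[OF L'] in auto)
  then show "\<exists>L. L-lipschitz_on K (\<lambda>x. f x *\<^sub>R g x)" by blast
qed

section \<open>Coefficients of class C2\<close>

lemma C2_derivative:
  assumes "C2 f"
  obtains f' where "\<And>x. (f has_derivative blinfun_apply (f' x)) (at x)" "continuous_on UNIV f'"
proof -
  obtain f' f'' where f: "\<And>x. (f has_derivative blinfun_apply (f' x)) (at x)"
    "\<And>x. (f' has_derivative blinfun_apply (f'' x)) (at x)"
    using assms unfolding C2_def by blast
  have "continuous_on UNIV f'"
    using f(2) by (intro continuous_at_imp_continuous_on) (auto intro: has_derivative_continuous)
  then show ?thesis using f(1) that by blast
qed

lemma C2_continuous: "C2 f \<Longrightarrow> continuous_on UNIV f"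
  by (erule C2_derivative) (auto intro!: continuous_at_imp_continuous_on intro: has_derivative_continuous)

text \<open>An enclosing closed ball is both compact and convex, so a bound for the derivative on it
  is a Lipschitz constant there and on the given set.\<close>

lemma C2_loc_lip:
  fixes f :: "'a::euclidean_space \<Rightarrow> 'b::real_normed_vector"
  assumes "C2 f"
  shows "loc_lip f"
proof -
  obtain f' where f: "\<And>x. (f has_derivative blinfun_apply (f' x)) (at x)" "continuous_on UNIV f'"
    using C2_derivative[OF assms] by blast
  show ?thesis
    unfolding loc_lip_def
  proof (intro allI impI)
    fix K :: "'a set" assume "compact K"
    then obtain R where R: "K \<subseteq> cball 0 R"
      using bounded_subset_ballD[OF compact_imp_bounded, of K 0] ball_subset_cball by blast
    have "bounded (f' ` cball 0 R)"
      by (intro compact_imp_bounded compact_continuous_image compact_cball continuous_on_subset[OF f(2)]) auto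
    then obtain B where B: "B > 0" "\<And>x. x \<in> cball 0 R \<Longrightarrow> norm (f' x) \<le> B"
      unfolding bounded_pos by blast
    have "B-lipschitz_on (cball 0 R) f"
      by (rule bounded_derivative_imp_lipschitz[OF has_derivative_at_withinI[OF f(1)] convex_cball])
        (use B in \<open>auto simp flip: norm_blinfun.rep_eq\<close>)
    then show "\<exists>L. L-lipschitz_on K f" using lipschitz_on_subset[OF _ R] by blast
  qed
qed

text \<open>The values of the derivative on the standard basis are the coordinates of its Riesz
  vector; hence the definite description in \<open>grad\<close> denotes and depends continuously on
  the point.\<close>

lemma C2_grad:
  fixes V :: "'a::euclidean_space \<Rightarrow> real"
  assumes "C2 V"
  shows "(V has_derivative (\<lambda>h. inner (grad V x) h)) (at x)" "continuous_on UNIV (grad V)"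
proof -
  obtain f' where f: "\<And>x. (V has_derivative blinfun_apply (f' x)) (at x)" "continuous_on UNIV f'"
    using C2_derivative[OF assms] by blast
  define D where "D x = (\<Sum>b\<in>Basis. blinfun_apply (f' x) b *\<^sub>R b)" for x
  have D: "blinfun_apply (f' x) h = inner (D x) h" for x h
  proof -
    have "blinfun_apply (f' x) h = blinfun_apply (f' x) (\<Sum>b\<in>Basis. inner h b *\<^sub>R b)"
      by (simp add: euclidean_representation)
    also have "\<dots> = (\<Sum>b\<in>Basis. inner h b * blinfun_apply (f' x) b)"
      by (simp add: blinfun.sum_right blinfun.scaleR_right)
    also have "\<dots> = inner (D x) h"
      unfolding D_def inner_sum_left inner_scaleR_left
      by (intro sum.cong refl) (simp add: inner_commute)
    finally show ?thesis .
  qed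
  have G: "GDERIV V x :> D x" for x
    using f(1)[of x] by (simp add: gderiv_def D[abs_def] inner_commute)
  have grad: "grad V x = D x" for x
    unfolding grad_def
  proof (rule the_equality)
    show "GDERIV V x :> D x" by (rule G)
    fix D' assume "GDERIV V x :> D'"
    with G[of x] have "(\<lambda>h. inner h (D x)) = (\<lambda>h. inner h D')"
      unfolding gderiv_def by (rule has_derivative_unique)
    then show "D' = D x" by (metis vector_eq_ldot)
  qed
  then show "(V has_derivative (\<lambda>h. inner (grad V x) h)) (at x)"
    using G[of x] by (simp add: gderiv_def inner_commute)
  have "continuous_on UNIV D"
    unfolding D_def by (intro continuous_intros blinfun.continuous_on f(2))
  then show "continuous_on UNIV (grad V)" using grad by (simp add: fun_eq_iff[symmetric] cong: continuous_on_cong)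
qed

lemma potential_derivative:
  assumes "continuous_on UNIV k"
  shows "(potential k has_real_derivative k s) (at s)"
proof -
  \<comment> \<open>The interval has to contain the base point 0 of the integral as well as a
    neighbourhood of \<open>s\<close>.\<close>
  define a where "a = - \<bar>s\<bar> - 1" define b where "b = \<bar>s\<bar> + 1"
  have ab: "a < s" "s < b" "a < 0" "0 < b" by (auto simp: a_def b_def)
  have "((\<lambda>u. LBINT y=ereal 0..ereal u. k y) has_vector_derivative k s) (at s within {a..b})"
    using ab by (intro interval_integral_FTC2 continuous_on_subset[OF assms]) auto
  then have "(potential k has_vector_derivative k s) (at s within {a..b})"
    by (simp add: potential_def[abs_def])
  then have "(potential k has_vector_derivative k s) (at s)"
    using ab by (simp add: at_within_Icc_at)
  then show ?thesis by (simp add: has_real_derivative_iff_has_vector_derivative)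
qed

lemma potential_0: "potential k 0 = 0"
  by (simp add: potential_def)

text \<open>The strict inequalities are assumed away from the origin; at the origin
  \<open>potential\<close>, \<open>fV\<close> and \<open>fa\<close> vanish, so the weak forms hold
  everywhere. The sign of \<open>s * fd C s\<close> comes from monotonicity and
  \<open>fd C 0 = 0\<close>.\<close>

lemma admissible_facts:
  assumes "admissible C"
  shows "s * fd C s \<ge> 0" "potential (fk C) s \<ge> 0" "fV C z \<ge> 0" "inner (grad (fV C) z) (fa C z) \<le> 0"
    "inner (grad (fV C) z) (fb C z) = fc C z"
    "\<exists>r. \<forall>z. fV C z \<le> E \<longrightarrow> norm z \<le> r"
proof -
  show "s * fd C s \<ge> 0"
  proof -
    obtain f' where f: "\<And>x. (fd C has_derivative blinfun_apply (f' x)) (at x)"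
      using C2_derivative[of "fd C"] assms unfolding admissible_def by metis
    have d: "DERIV (fd C) x :> deriv (fd C) x" for x
      using f[of x] by (metis DERIV_deriv_iff_real_differentiable differentiableI)
    have mono: "fd C x \<le> fd C y" if "x \<le> y" for x y
      by (rule DERIV_nonneg_imp_nondecreasing[OF that]) (use d assms in \<open>auto simp: admissible_def\<close>)
    have "fd C 0 = 0" using assms by (simp add: admissible_def)
    then show ?thesis using mono[of 0 s] mono[of s 0] by (cases "s \<ge> 0") (auto simp: mult_nonpos_nonpos)
  qed
  show "potential (fk C) s \<ge> 0"
    using assms by (cases "s = 0") (auto simp: potential_0 admissible_def intro: less_imp_le)
  show "fV C z \<ge> 0" using assms by (cases "z = 0") (auto simp: admissible_def intro: less_imp_le)
  show "inner (grad (fV C) z) (fa C z) \<le> 0"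
    using assms by (cases "z = 0") (auto simp: admissible_def intro: less_imp_le)
  show "inner (grad (fV C) z) (fb C z) = fc C z" using assms by (simp add: admissible_def)
  have "filterlim (fV C) at_top at_infinity" using assms by (simp add: admissible_def)
  then have "\<forall>\<^sub>F z in at_infinity. E < fV C z" by (simp add: filterlim_at_top_dense)
  then obtain b where "\<And>z. norm z \<ge> b \<Longrightarrow> E < fV C z" by (auto simp: eventually_at_infinity)
  then show "\<exists>r. \<forall>z. fV C z \<le> E \<longrightarrow> norm z \<le> r" by (metis linorder_not_le nle_le)
qed

lemma admissible_C2:
  assumes "admissible C"
  shows "C2 (fd C)" "C2 (fk C)" "C2 (fV C)" "C2 (fa C)" "C2 (fb C)" "C2 (fc C)"
  using assms by (auto simp: admissible_def)

lemma remainder_loc_lip: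
  assumes "admissible C"
  shows "loc_lip (r\<alpha> C)" "loc_lip (r\<beta> C)" "loc_lip (r\<gamma> C)" "loc_lip (r\<delta> C)" "loc_lip (r\<kappa> C)"
  unfolding r\<alpha>_def[abs_def] r\<beta>_def[abs_def] r\<gamma>_def[abs_def] r\<delta>_def[abs_def] r\<kappa>_def[abs_def]
  by (intro loc_lip_diff C2_loc_lip[OF admissible_C2(4)[OF assms]] C2_loc_lip[OF admissible_C2(5)[OF assms]]
      C2_loc_lip[OF admissible_C2(6)[OF assms]] C2_loc_lip[OF admissible_C2(1)[OF assms]]
      C2_loc_lip[OF admissible_C2(2)[OF assms]] loc_lip_const loc_lip_bounded_linear
      matrix_vector_mul_bounded_linear bounded_linear_inner_right bounded_linear_mult_right)+

section \<open>Energy and dissipation\<close>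

type_synonym ('n, 'm) observation = "(real^'n) \<times> (real^'m) \<times> real \<times> real \<times> real \<times> real"

context beam_params
begin

definition tip_slope :: "('n, 'm) hstate \<Rightarrow> real" where "tip_slope h = inner (fst h) (slope_rep l)"
definition tip_value :: "('n, 'm) hstate \<Rightarrow> real" where "tip_value h = inner (fst h) (value_rep l)"

definition observe :: "('n, 'm) hstate \<Rightarrow> ('n, 'm) observation" where
  "observe h = (case h of (f, g, z1, z2, \<xi>, \<psi>) \<Rightarrow> (z1, z2, \<xi>, \<psi>, tip_slope h, tip_value h))"

definition remainder :: "('n, 'm) observation \<Rightarrow> ('n, 'm) hstate" where
  "remainder = (\<lambda>(z1, z2, \<xi>, \<psi>, s, r). (0, 0,
     r\<alpha> (ctl1 p) z1 + (1 / inertia p * \<xi>) *\<^sub>R r\<beta> (ctl1 p) z1,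
     r\<alpha> (ctl2 p) z2 + (1 / mass p * \<psi>) *\<^sub>R r\<beta> (ctl2 p) z2,
     - r\<gamma> (ctl1 p) z1 - r\<delta> (ctl1 p) (\<xi> / inertia p) - r\<kappa> (ctl1 p) s,
     - r\<gamma> (ctl2 p) z2 - r\<delta> (ctl2 p) (\<psi> / mass p) - r\<kappa> (ctl2 p) r))"

lemma bounded_linear_observe: "bounded_linear observe"
  unfolding observe_def tip_slope_def tip_value_def case_prod_unfold
  by (intro bounded_linear_Pair bounded_linear_inner_left_comp bounded_linear_fst
      bounded_linear_compose[OF bounded_linear_fst] bounded_linear_compose[OF bounded_linear_snd]
      bounded_linear_snd)

lemma loc_lip_remainder: "loc_lip remainder"
  unfolding remainder_def case_prod_unfold
  by (intro loc_lip_Pair loc_lip_const loc_lip_add loc_lip_diff loc_lip_scaleR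
      loc_lip_compose[OF remainder_loc_lip(1)[OF adm(1)]] loc_lip_compose[OF remainder_loc_lip(2)[OF adm(1)]]
      loc_lip_compose[OF remainder_loc_lip(1)[OF adm(2)]] loc_lip_compose[OF remainder_loc_lip(2)[OF adm(2)]]
      loc_lip_diff[OF loc_lip_const[of 0], simplified]
      loc_lip_compose[OF remainder_loc_lip(3)[OF adm(1)]] loc_lip_compose[OF remainder_loc_lip(4)[OF adm(1)]]
      loc_lip_compose[OF remainder_loc_lip(5)[OF adm(1)]]
      loc_lip_compose[OF remainder_loc_lip(3)[OF adm(2)]] loc_lip_compose[OF remainder_loc_lip(4)[OF adm(2)]]
      loc_lip_compose[OF remainder_loc_lip(5)[OF adm(2)]]
      loc_lip_bounded_linear bounded_linear_fst bounded_linear_snd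
      bounded_linear_compose[OF bounded_linear_fst] bounded_linear_compose[OF bounded_linear_snd]
      bounded_linear_compose[OF bounded_linear_divide] bounded_linear_compose[OF bounded_linear_mult_right])

lemma Abs_l2_0: "Abs_l2 0 = 0" "Abs_l2 (Dx l (Dx l 0)) = 0"
  using embed_zero by (simp_all add: zero_prod_def)

lemma op_N_embed:
  assumes "x \<in> X"
  shows "op_N p x \<in> X" "embed (op_N p x) = remainder (observe (embed x))"
proof -
  obtain u v z1 z2 \<xi> \<psi> where x: "x = (u, v, z1, z2, \<xi>, \<psi>)" by (cases x) auto
  have u: "u \<in> Sobolev0 l 2" using assms by (simp add: x in_X)
  have "0 \<in> Sobolev0 l 2" using zero_X by (simp add: zero_prod_def in_X)
  then show "op_N p x \<in> X" by (simp add: x Let_def in_X L2_zero)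
  show "embed (op_N p x) = remainder (observe (embed x))"
    by (simp add: x Let_def remainder_def observe_def tip_slope_def tip_value_def Abs_l2_0
        slope_eq[OF params_pos(1) u] value_eq[OF params_pos(1) u])
qed

text \<open>The two function components of the remainder are 0, so the forcing never leaves the
  embedded state space.\<close>

lemma cutH_remainder: "cutH (remainder q) = remainder q"
  using linear_0[OF bounded_linear.linear[OF bounded_linear_cut]]
  by (cases q) (simp add: cutH_def remainder_def)

text \<open>The energy in embedded coordinates, extended to the whole Hilbert space so that Frechet
  differentiability makes sense at every point.\<close>

definition W :: "('n, 'm) hstate \<Rightarrow> real" where
  "W h = (case h of (f, g, z1, z2, \<xi>, \<psi>) \<Rightarrow>
     1 / 2 * (Lam p * inner f f + rho p * inner g g) + \<xi>\<^sup>2 / (2 * inertia p) + \<psi>\<^sup>2 / (2 * mass p)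
     + potential (fk (ctl1 p)) (tip_slope h) + potential (fk (ctl2 p)) (tip_value h) + fV (ctl1 p) z1 + fV (ctl2 p) z2)"

definition W' :: "('n, 'm) hstate \<Rightarrow> ('n, 'm) hstate \<Rightarrow> real" where
  "W' h k = (case h of (f, g, z1, z2, \<xi>, \<psi>) \<Rightarrow> case k of (f', g', z1', z2', \<xi>', \<psi>') \<Rightarrow>
     Lam p * inner f f' + rho p * inner g g' + \<xi> * \<xi>' / inertia p + \<psi> * \<psi>' / mass p
     + fk (ctl1 p) (tip_slope h) * tip_slope k + fk (ctl2 p) (tip_value h) * tip_value k
     + inner (grad (fV (ctl1 p)) z1) z1' + inner (grad (fV (ctl2 p)) z2) z2')"

text \<open>The derivative of \<^const>\<open>W\<close> along the linear flow.  Integrating by parts and using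
  \<open>\<xi> = J v'(L)\<close>, \<open>\<psi> = M v(L)\<close> removes the boundary terms with \<open>u''(L)\<close> and
  \<open>u'''(L)\<close>, so that it is continuous on the whole space.\<close>

definition linear_rate :: "('n, 'm) hstate \<Rightarrow> real" where
  "linear_rate h = (case h of (f, g, z1, z2, \<xi>, \<psi>) \<Rightarrow>
     fk (ctl1 p) (tip_slope h) * (\<xi> / inertia p) + fk (ctl2 p) (tip_value h) * (\<psi> / mass p)
     + inner (grad (fV (ctl1 p)) z1) (cA (ctl1 p) *v z1 + (1 / inertia p * \<xi>) *\<^sub>R cB (ctl1 p))
     + inner (grad (fV (ctl2 p)) z2) (cA (ctl2 p) *v z2 + (1 / mass p * \<psi>) *\<^sub>R cB (ctl2 p))
     - \<xi> / inertia p * (inner (cC (ctl1 p)) z1 + cD (ctl1 p) * (\<xi> / inertia p) + cK (ctl1 p) * tip_slope h)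
     - \<psi> / mass p * (inner (cC (ctl2 p)) z2 + cD (ctl2 p) * (\<psi> / mass p) + cK (ctl2 p) * tip_value h))"

lemma has_derivative_quad:
  assumes "bounded_linear (L :: 'a::real_normed_vector \<Rightarrow> 'b::real_inner)"
  shows "((\<lambda>h. inner (L h) (L h)) has_derivative (\<lambda>k. 2 * inner (L h) (L k))) (at h)"
  using has_derivative_inner[OF bounded_linear_imp_has_derivative[OF assms] bounded_linear_imp_has_derivative[OF assms], of h UNIV]
  by (simp add: inner_commute)

lemma bounded_linear_parts:
  "bounded_linear (\<lambda>h :: ('n, 'm) hstate. fst h)"
  "bounded_linear (\<lambda>h :: ('n, 'm) hstate. fst (snd h))"
  "bounded_linear (\<lambda>h :: ('n, 'm) hstate. fst (snd (snd h)))"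
  "bounded_linear (\<lambda>h :: ('n, 'm) hstate. fst (snd (snd (snd h))))"
  "bounded_linear (\<lambda>h :: ('n, 'm) hstate. fst (snd (snd (snd (snd h)))))"
  "bounded_linear (\<lambda>h :: ('n, 'm) hstate. snd (snd (snd (snd (snd h)))))"
  "bounded_linear tip_slope" "bounded_linear tip_value"
  unfolding tip_slope_def[abs_def] tip_value_def[abs_def]
  by (intro bounded_linear_fst bounded_linear_snd bounded_linear_compose[OF bounded_linear_fst]
      bounded_linear_compose[OF bounded_linear_snd] bounded_linear_inner_left_comp)+

lemma W_has_derivative: "(W has_derivative W' h) (at h)"
proof -
  note C2s = admissible_C2[OF adm(1)] admissible_C2[OF adm(2)]
  have pot: "((\<lambda>h. potential k (B h)) has_derivative (\<lambda>v. k (B h) * B v)) (at h)"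
    if "continuous_on UNIV k" "bounded_linear B" for k and B :: "('n, 'm) hstate \<Rightarrow> real"
    using has_derivative_compose[OF bounded_linear_imp_has_derivative[OF that(2)]
        potential_derivative[OF that(1), unfolded has_field_derivative_def], of h UNIV] by simp
  have V: "((\<lambda>h. V (B h)) has_derivative (\<lambda>v. inner (grad V (B h)) (B v))) (at h)"
    if "C2 V" "bounded_linear B" for V :: "'a::euclidean_space \<Rightarrow> real" and B :: "('n, 'm) hstate \<Rightarrow> 'a"
    by (rule has_derivative_compose[OF bounded_linear_imp_has_derivative[OF that(2)] C2_grad(1)[OF that(1)]])
  have sq: "((\<lambda>h. (B h)\<^sup>2 / (2 * c)) has_derivative (\<lambda>v. B h * B v / c)) (at h)"
    if "bounded_linear B" for c and B :: "('n, 'm) hstate \<Rightarrow> real"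
    using has_derivative_mult_left[OF has_derivative_quad[OF that, of h], of "1 / (2 * c)"]
    by (simp add: power2_eq_square)
  have "((\<lambda>h. 1 / 2 * (Lam p * inner (fst h) (fst h) + rho p * inner (fst (snd h)) (fst (snd h)))
     + (fst (snd (snd (snd (snd h)))))\<^sup>2 / (2 * inertia p) + (snd (snd (snd (snd (snd h)))))\<^sup>2 / (2 * mass p)
     + potential (fk (ctl1 p)) (tip_slope h) + potential (fk (ctl2 p)) (tip_value h)
     + fV (ctl1 p) (fst (snd (snd h))) + fV (ctl2 p) (fst (snd (snd (snd h)))))
    has_derivative (\<lambda>k. 1 / 2 * (Lam p * (2 * inner (fst h) (fst k)) + rho p * (2 * inner (fst (snd h)) (fst (snd k))))
     + fst (snd (snd (snd (snd h)))) * fst (snd (snd (snd (snd k)))) / inertia p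
     + snd (snd (snd (snd (snd h)))) * snd (snd (snd (snd (snd k)))) / mass p
     + fk (ctl1 p) (tip_slope h) * tip_slope k + fk (ctl2 p) (tip_value h) * tip_value k
     + inner (grad (fV (ctl1 p)) (fst (snd (snd h)))) (fst (snd (snd k)))
     + inner (grad (fV (ctl2 p)) (fst (snd (snd (snd h))))) (fst (snd (snd (snd k)))))) (at h)"
    by (intro has_derivative_add has_derivative_mult_right has_derivative_quad sq pot V bounded_linear_parts C2s C2_continuous)
  then show ?thesis
    by (simp add: W_def[abs_def] W'_def[abs_def] case_prod_unfold algebra_simps)
qed

lemma continuous_on_parts:
  "continuous_on A (\<lambda>h :: ('n, 'm) hstate. tip_slope h)" "continuous_on A (\<lambda>h :: ('n, 'm) hstate. tip_value h)"
  by (auto intro!: linear_continuous_on bounded_linear_parts)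

lemma W'_continuous: "continuous_on UNIV (\<lambda>(h, k). W' h k)"
proof -
  note C2s = admissible_C2[OF adm(1)] admissible_C2[OF adm(2)]
  show ?thesis
    unfolding W'_def case_prod_unfold
    by (intro continuous_intros continuous_on_compose2[OF C2_continuous[OF C2s(2)]]
        continuous_on_compose2[OF C2_continuous[OF C2s(8)]]
        continuous_on_compose2[OF C2_grad(2)[OF C2s(3)]] continuous_on_compose2[OF C2_grad(2)[OF C2s(9)]]
        continuous_on_compose2[OF continuous_on_parts(1)[of UNIV]] continuous_on_compose2[OF continuous_on_parts(2)[of UNIV]]
        subset_UNIV) (use params_pos in auto)
qed

lemma linear_rate_continuous: "continuous_on UNIV linear_rate"
proof -
  note C2s = admissible_C2[OF adm(1)] admissible_C2[OF adm(2)]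
  have mv: "continuous_on A (\<lambda>h. P *v f h)" if "continuous_on A f" for P :: "real^'k^'k" and f :: "('n, 'm) hstate \<Rightarrow> real^'k" and A
    by (rule continuous_on_compose2[OF linear_continuous_on[OF matrix_vector_mul_bounded_linear] that subset_UNIV])
  show ?thesis
    unfolding linear_rate_def case_prod_unfold
    by (intro continuous_intros mv continuous_on_compose2[OF C2_continuous[OF C2s(2)]]
        continuous_on_compose2[OF C2_continuous[OF C2s(8)]]
        continuous_on_compose2[OF C2_grad(2)[OF C2s(3)]] continuous_on_compose2[OF C2_grad(2)[OF C2s(9)]]
        continuous_on_parts subset_UNIV) (use params_pos in auto)
qed

text \<open>The linear and the remainder parts recombine to the full coefficients. Then the spring
  terms \<open>fk\<close> cancel between potential and kinetic energy, and each \<open>fc\<close>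
  term cancels against the derivative of \<open>fV\<close> along \<open>fb\<close>; only the signed
  terms in \<open>fa\<close> and \<open>fd\<close> are left.\<close>

lemma dissipation: "linear_rate h + W' h (remainder (observe h)) \<le> 0"
proof -
  obtain f g z1 z2 \<xi> \<psi> where h: "h = (f, g, z1, z2, \<xi>, \<psi>)" by (cases h) auto
  \<comment> \<open>These are the velocities belonging to the momenta \<xi> and \<psi>; in them the
    divisions by \<open>inertia p\<close> and \<open>mass p\<close> disappear.\<close>
  define s where "s = \<xi> / inertia p" define r where "r = \<psi> / mass p"
  have h': "h = (f, g, z1, z2, inertia p * s, mass p * r)" and nz: "inertia p \<noteq> 0" "mass p \<noteq> 0"
    using params_pos by (auto simp: h s_def r_def)
  have cancel: "inertia p * a * b / inertia p = a * b" "mass p * a * b / mass p = a * b" for a b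
    using nz by auto
  note a1 = admissible_facts[OF adm(1)] and a2 = admissible_facts[OF adm(2)]
  have "linear_rate h + W' h (remainder (observe h))
      = inner (grad (fV (ctl1 p)) z1) (fa (ctl1 p) z1) + s * inner (grad (fV (ctl1 p)) z1) (fb (ctl1 p) z1)
      + inner (grad (fV (ctl2 p)) z2) (fa (ctl2 p) z2) + r * inner (grad (fV (ctl2 p)) z2) (fb (ctl2 p) z2)
      - s * fc (ctl1 p) z1 - r * fc (ctl2 p) z2 - s * fd (ctl1 p) s - r * fd (ctl2 p) r"
    by (simp add: h' nz cancel linear_rate_def W'_def remainder_def observe_def tip_slope_def tip_value_def
          r\<alpha>_def r\<beta>_def r\<gamma>_def r\<delta>_def r\<kappa>_def inner_add_right inner_diff_right)
      (simp add: algebra_simps)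
  also have "\<dots> \<le> 0"
    using a1(4)[of z1] a2(4)[of z2] a1(1)[of s] a2(1)[of r] by (simp add: a1(5) a2(5))
  finally show ?thesis .
qed

text \<open>All summands of \<open>W\<close> are nonnegative, so each is at most \<open>E\<close>.
  The quadratic ones bound \<open>f\<close>, \<open>g\<close>, \<xi> and \<psi>, the sublevel sets
  of \<open>fV\<close> bound \<open>z1\<close> and \<open>z2\<close>, and \<open>B2\<close> adds up
  these six bounds.\<close>

lemma W_coercive: "\<exists>B. \<forall>h. W h \<le> E \<longrightarrow> norm h \<le> B"
proof -
  note a1 = admissible_facts[OF adm(1)] and a2 = admissible_facts[OF adm(2)]
  obtain r1 where r1: "\<And>z. fV (ctl1 p) z \<le> E \<Longrightarrow> norm z \<le> r1" using a1(6)[of E] by blast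
  obtain r2 where r2: "\<And>z. fV (ctl2 p) z \<le> E \<Longrightarrow> norm z \<le> r2" using a2(6)[of E] by blast
  define B2 where "B2 = 2 * E / Lam p + 2 * E / rho p + r1\<^sup>2 + r2\<^sup>2 + 2 * inertia p * E + 2 * mass p * E"
  have "norm h \<le> sqrt B2" if WE: "W h \<le> E" for h
  proof -
    obtain f g z1 z2 \<xi> \<psi> where h: "h = (f, g, z1, z2, \<xi>, \<psi>)" by (cases h) auto
    have nn: "0 \<le> Lam p * inner f f" "0 \<le> rho p * inner g g" "0 \<le> \<xi>\<^sup>2 / (2 * inertia p)" "0 \<le> \<psi>\<^sup>2 / (2 * mass p)"
      using params_pos by auto
    have eq: "W h = 1 / 2 * (Lam p * inner f f) + 1 / 2 * (rho p * inner g g) + \<xi>\<^sup>2 / (2 * inertia p) + \<psi>\<^sup>2 / (2 * mass p)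
      + potential (fk (ctl1 p)) (tip_slope h) + potential (fk (ctl2 p)) (tip_value h) + fV (ctl1 p) z1 + fV (ctl2 p) z2"
      by (simp add: W_def h algebra_simps)
    note pos = a1(2)[of "tip_slope h"] a2(2)[of "tip_value h"] a1(3)[of z1] a2(3)[of z2]
    have b: "Lam p * inner f f \<le> 2 * E" "rho p * inner g g \<le> 2 * E" "\<xi>\<^sup>2 / (2 * inertia p) \<le> E" "\<psi>\<^sup>2 / (2 * mass p) \<le> E"
      "fV (ctl1 p) z1 \<le> E" "fV (ctl2 p) z2 \<le> E"
      using WE nn pos unfolding eq by argo+
    have "inner f f \<le> 2 * E / Lam p" "inner g g \<le> 2 * E / rho p" "\<xi> * \<xi> \<le> 2 * inertia p * E" "\<psi> * \<psi> \<le> 2 * mass p * E"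
      using b(1-4) params_pos by (auto simp: field_simps power2_eq_square)
    moreover have "inner z1 z1 \<le> r1\<^sup>2" "inner z2 z2 \<le> r2\<^sup>2"
      using r1[OF b(5)] r2[OF b(6)] by (auto simp: power2_norm_eq_inner[symmetric] intro!: power_mono)
    ultimately have "inner h h \<le> B2" by (simp add: h inner_prod_def B2_def)
    then show ?thesis by (simp add: norm_eq_sqrt_inner)
  qed
  then show ?thesis by blast
qed

lemma energy_eq:
  assumes "x \<in> X"
  shows "energy p x = W (embed x)"
proof -
  obtain u v z1 z2 \<xi> \<psi> where x: "x = (u, v, z1, z2, \<xi>, \<psi>)" by (cases x) auto
  have u: "u \<in> Sobolev0 l 2" and v: "v \<in> L2 l" using assms by (simp_all add: x in_X)
  let ?f = "Dx l (Dx l u)"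
  have int: "set_integrable lebesgue {0..l} (\<lambda>x. c * (rep_L0 f x)\<^sup>2)" if "f \<in> L2 l" for f c
    unfolding set_integrable_def using that
    by (intro integrable_mult_indicator) (auto simp: L2_iff sq_integrable_def)
  have sq: "(LINT x:{0..l}|lebesgue. (rep_L0 f x)\<^sup>2) = inner (Abs_l2 f) (Abs_l2 f)" if "f \<in> L2 l" for f
    using L2_inner_eq_inner[OF params_pos(1) that that] by (simp add: L2_inner_def power2_eq_square)
  have "(LINT x:{0..l}|lebesgue. Lam p * (rep_L0 ?f x)\<^sup>2 + rho p * (rep_L0 v x)\<^sup>2)
      = Lam p * inner (Abs_l2 ?f) (Abs_l2 ?f) + rho p * inner (Abs_l2 v) (Abs_l2 v)"
    by (simp add: set_integral_add(2)[OF int[OF DDx_L2[OF u]] int[OF v]] sq[OF DDx_L2[OF u]] sq[OF v])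
  then show ?thesis
    by (simp add: x W_def Let_def tip_slope_def tip_value_def slope_eq[OF params_pos(1) u] value_eq[OF params_pos(1) u])
qed

lemma W'_op_L:
  assumes x: "x \<in> dom_A p"
  shows "W' (embed x) (embed (op_L p x)) = linear_rate (embed x)"
proof -
  obtain u v z1 z2 \<xi> \<psi> where x': "x = (u, v, z1, z2, \<xi>, \<psi>)" by (cases x) auto
  note l = params_pos(1)
  let ?D = "Dx l"
  have u: "u \<in> Sobolev0 l 4" and v: "v \<in> Sobolev0 l 2"
    and \<xi>: "\<xi> = inertia p * val l (?D v) l" and \<psi>: "\<psi> = mass p * val l v l"
    using x by (auto simp: x' dom_A_def)
  note u4 = Sobolev0_4D[OF l u]
  note v2 = v[unfolded Sobolev0_2_iff[OF l]]
  have L2s: "?D (?D u) \<in> L2 l" "?D (?D v) \<in> L2 l" "v \<in> L2 l" "?D (?D (?D (?D u))) \<in> L2 l"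
    using DDx_L2[OF u4(1)] DDx_L2[OF v] has_L2_derivD(1)[OF l, of v "?D v"] v2 has_L2_derivD(2)[OF l u4(3)] by auto
  \<comment> \<open>Two integrations by parts move two derivatives from \<open>u\<close> to
    \<open>v\<close>. The boundary terms at 0 vanish because \<open>v\<close> and its derivative do,
    so only those at the tip survive.\<close>
  have 1: "L2_inner l (?D (?D (?D (?D u)))) v + L2_inner l (?D (?D (?D u))) (?D v) = val l (?D (?D (?D u))) l * val l v l"
    using L2_inner_by_parts[OF l u4(3), of v "?D v"] v2 by simp
  have 2: "L2_inner l (?D (?D (?D u))) (?D v) + L2_inner l (?D (?D u)) (?D (?D v)) = val l (?D (?D u)) l * val l (?D v) l"
    using L2_inner_by_parts[OF l u4(2), of "?D v" "?D (?D v)"] v2 by simp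
  have ibp: "inner (Abs_l2 (?D (?D u))) (Abs_l2 (?D (?D v)))
      = val l (?D (?D u)) l * val l (?D v) l - val l (?D (?D (?D u))) l * val l v l
        + inner (Abs_l2 v) (Abs_l2 (?D (?D (?D (?D u)))))"
    using 1 2 by (simp add: L2_inner_eq_inner[OF l] L2s inner_commute)
  \<comment> \<open>The generator has \<open>v\<close> as its first component, so the tip
    functionals applied to its value give \<open>v'(L)\<close> and \<open>v(L)\<close>, which the
    domain conditions tie to \<xi> and \<psi>.\<close>
  have sl: "inner (Abs_l2 (?D (?D v))) (slope_rep l) = \<xi> / inertia p"
    "inner (Abs_l2 (?D (?D v))) (value_rep l) = \<psi> / mass p"
    using slope_eq[OF l v] value_eq[OF l v] params_pos by (auto simp: \<xi> \<psi>)
  have vals: "val l (?D v) l = \<xi> / inertia p" "val l v l = \<psi> / mass p"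
    using params_pos by (auto simp: \<xi> \<psi>)
  have e: "embed (op_L p x) = (Abs_l2 (?D (?D v)), - (Lam p / rho p) *\<^sub>R Abs_l2 (?D (?D (?D (?D u)))),
     cA (ctl1 p) *v z1 + (1 / inertia p * \<xi>) *\<^sub>R cB (ctl1 p),
     cA (ctl2 p) *v z2 + (1 / mass p * \<psi>) *\<^sub>R cB (ctl2 p),
     - Lam p * val l (?D (?D u)) l - (inner (cC (ctl1 p)) z1 + cD (ctl1 p) * (\<xi> / inertia p) + cK (ctl1 p) * tip_slope (embed x)),
     Lam p * val l (?D (?D (?D u))) l - (inner (cC (ctl2 p)) z2 + cD (ctl2 p) * (\<psi> / mass p) + cK (ctl2 p) * tip_value (embed x)))"
    using Abs_l2_scaleR[OF L2s(4), of "- (Lam p / rho p)"]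
    by (simp add: x' op_L_def linearized_def Let_def tip_slope_def tip_value_def slope_eq[OF l u4(1)] value_eq[OF l u4(1)])
  have U: "tip_slope (embed (op_L p x)) = \<xi> / inertia p" "tip_value (embed (op_L p x)) = \<psi> / mass p"
    unfolding e tip_slope_def tip_value_def by (simp_all add: sl)
  have emb: "embed x = (Abs_l2 (?D (?D u)), Abs_l2 v, z1, z2, \<xi>, \<psi>)" by (simp add: x')
  define a where "a = tip_slope (embed x)" define b where "b = tip_value (embed x)"
  have "W' (embed x) (embed (op_L p x))
    = Lam p * inner (Abs_l2 (?D (?D u))) (Abs_l2 (?D (?D v))) + rho p * inner (Abs_l2 v) (- (Lam p / rho p) *\<^sub>R Abs_l2 (?D (?D (?D (?D u)))))
     + \<xi> * (- Lam p * val l (?D (?D u)) l - (inner (cC (ctl1 p)) z1 + cD (ctl1 p) * (\<xi> / inertia p) + cK (ctl1 p) * a)) / inertia p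
     + \<psi> * (Lam p * val l (?D (?D (?D u))) l - (inner (cC (ctl2 p)) z2 + cD (ctl2 p) * (\<psi> / mass p) + cK (ctl2 p) * b)) / mass p
     + fk (ctl1 p) a * (\<xi> / inertia p) + fk (ctl2 p) b * (\<psi> / mass p)
     + inner (grad (fV (ctl1 p)) z1) (cA (ctl1 p) *v z1 + (1 / inertia p * \<xi>) *\<^sub>R cB (ctl1 p))
     + inner (grad (fV (ctl2 p)) z2) (cA (ctl2 p) *v z2 + (1 / mass p * \<psi>) *\<^sub>R cB (ctl2 p))"
    unfolding W'_def U unfolding e unfolding emb a_def b_def by simp
  \<comment> \<open>The tip terms from the integrations by parts cancel against
    \<open>u''(L)\<close> and \<open>u'''(L)\<close> in the momentum equations, and the interior
    products cancel because \<open>rho p * (Lam p / rho p) = Lam p\<close>.\<close>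
  also have "\<dots> = linear_rate (embed x)"
    unfolding linear_rate_def a_def[symmetric] b_def[symmetric] ibp vals
    unfolding emb using params_pos by (simp add: field_simps)
  finally show ?thesis .
qed

end

section \<open>Global existence\<close>

context beam_system
begin

text \<open>Only the finite-dimensional observation enters the remainder; clamping it to a ball makes
  the remainder globally Lipschitz and bounded.\<close>

definition clamped_remainder :: "real \<Rightarrow> ('n, 'm) hstate \<Rightarrow> ('n, 'm) hstate" where
  "clamped_remainder R h = remainder (closest_point (cball 0 R) (observe h))"

lemma clamped_remainder_eq: "norm (observe h) \<le> R \<Longrightarrow> clamped_remainder R h = remainder (observe h)"
  by (simp add: clamped_remainder_def closest_point_self)

lemma St_0_clamped_remainder: "St 0 (clamped_remainder R h) = clamped_remainder R h"
  by (simp add: St_0 clamped_remainder_def cutH_remainder)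

lemma clamped_remainder_bounded:
  assumes "R \<ge> 0"
  shows "bounded (range (clamped_remainder R))"
proof (rule bounded_subset)
  show "bounded (remainder ` cball 0 R)"
    by (intro compact_imp_bounded compact_continuous_image loc_lip_continuous_on[OF loc_lip_remainder] compact_cball)
  show "range (clamped_remainder R) \<subseteq> remainder ` cball 0 R"
    unfolding clamped_remainder_def using assms closest_point_in_set[OF closed_cball, of "0::('n, 'm) observation" R]
    by (intro image_subsetI imageI) simp
qed

lemma clamped_remainder_lipschitz:
  assumes R: "R \<ge> 0"
  obtains C where "C-lipschitz_on UNIV (clamped_remainder R)"
proof -
  obtain L where L: "L-lipschitz_on (cball 0 R) remainder" by (rule loc_lipE[OF loc_lip_remainder compact_cball])
  obtain K where K: "K-lipschitz_on UNIV observe"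
    using bounded_linear.lipschitz_boundE[OF bounded_linear_observe] by metis
  let ?c = "closest_point (cball (0::('n, 'm) observation) R)"
  have c: "1-lipschitz_on UNIV ?c"
    using closest_point_lipschitz[OF convex_cball closed_cball, of "0::('n, 'm) observation" R] R
    by (intro lipschitz_onI) auto
  have "?c ` UNIV \<subseteq> cball 0 R"
    using closest_point_in_set[OF closed_cball, of "0::('n, 'm) observation" R] R by auto
  then have "(L * 1)-lipschitz_on UNIV (\<lambda>q. remainder (?c q))"
    by (rule lipschitz_on_compose2[OF c lipschitz_on_subset[OF L]])
  then have "(L * 1 * K)-lipschitz_on UNIV (\<lambda>h. remainder (?c (observe h)))"
    by (rule lipschitz_on_compose2[OF K lipschitz_on_subset[OF _ subset_UNIV]])
  then show ?thesis using that by (simp add: clamped_remainder_def[abs_def])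
qed

lemma continuous_on_clamped_remainder:
  assumes "R \<ge> 0" "continuous_on A h"
  shows "continuous_on A (\<lambda>s. clamped_remainder R (h s))"
  using clamped_remainder_lipschitz[OF assms(1)] continuous_on_compose2[OF lipschitz_on_continuous_on assms(2) subset_UNIV]
  by metis

text \<open>On the domain the chain rule yields \<open>W'\<close> applied to the generator, which is
  unbounded. Only its rewritten form from \<open>W'_op_L\<close> is continuous in the state, as
  \<open>right_derivative_extend\<close> demands.\<close>

lemma W_rate:
  assumes h: "St 0 h = h"
  shows "((\<lambda>k. (W (St k h) - W h) / k) \<longlongrightarrow> linear_rate h) (at_right 0)"
proof (rule right_derivative_extend[where D="embed ` dom_A p"])
  show "continuous_on UNIV W"
    by (intro continuous_at_imp_continuous_on ballI has_derivative_continuous[OF W_has_derivative])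
  show "continuous_on UNIV linear_rate" by (rule linear_rate_continuous)
  show "St 0 x = x" if x: "x \<in> embed ` dom_A p" for x
  proof -
    obtain y where "y \<in> dom_A p" "x = embed y" using x by blast
    then show ?thesis by (simp add: St_0 cutH_embed dom_A_X)
  qed
  show "St t x \<in> embed ` dom_A p" if x: "x \<in> embed ` dom_A p" and t: "t \<ge> 0" for x t
  proof -
    obtain y where y: "y \<in> dom_A p" "x = embed y" using x by blast
    then show ?thesis using domain_invariant[OF y(1) t] by (simp add: St_embed dom_A_X)
  qed
  show "((\<lambda>k. (W (St k x) - W x) / k) \<longlongrightarrow> linear_rate x) (at_right 0)" if x: "x \<in> embed ` dom_A p" for x
  proof -
    obtain y where y: "y \<in> dom_A p" "x = embed y" using x by blast
    have "((\<lambda>k. (St k (embed y) - embed y) /\<^sub>R k) \<longlongrightarrow> embed (op_L p y)) (at_right 0)"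
      using generator_iff[OF dom_A_X[OF y(1)] op_L_X[OF y(1)]] y(1) by simp
    from right_derivative_chain[OF W_has_derivative this] show ?thesis
      by (simp add: W'_op_L[OF y(1)] y(2))
  qed
qed (use h domain_closure in auto)

text \<open>While the observation stays in the ball, clamping changes nothing and
  \<open>dissipation\<close> gives the sign of the right derivative. The bound is asked for on
  \<open>[a, b)\<close> only, so that \<open>b\<close> may be the first time at which the
  observation reaches radius \<open>R\<close>.\<close>

lemma energy_decrease:
  assumes R: "R \<ge> 0" and hc: "continuous_on {0..} h"
    and h: "\<And>t. t \<ge> 0 \<Longrightarrow> h t = St t h0 + conv (\<lambda>s. clamped_remainder R (h s)) t"
    and ab: "0 \<le> a" "a \<le> b" and small: "\<And>t. t \<in> {a..<b} \<Longrightarrow> norm (observe (h t)) \<le> R"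
  shows "W (h b) \<le> W (h a)"
proof -
  have "continuous_on {a..b} (\<lambda>t. W (h t))"
  proof (rule continuous_on_compose2[of UNIV W])
    show "continuous_on UNIV W"
      by (intro continuous_at_imp_continuous_on ballI has_derivative_continuous[OF W_has_derivative])
    show "continuous_on {a..b} h" by (rule continuous_on_subset[OF hc]) (use ab in auto)
  qed simp
  then have "W (h b) \<le> W (h a) + 0 * (b - a)"
  proof (rule right_derivative_increment_le[OF _ ab(2)])
    fix t assume t: "t \<in> {a..<b}"
    then have t0: "t \<ge> 0" using ab by auto
    show "((\<lambda>k. (W (h (t + k)) - W (h t)) / k) \<longlongrightarrow> linear_rate (h t) + W' (h t) (clamped_remainder R (h t))) (at_right 0)"
      by (rule mild_right_derivative[OF W_has_derivative W'_continuous W_rate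
            continuous_on_clamped_remainder[OF R hc] St_0_clamped_remainder h t0])
    show "linear_rate (h t) + W' (h t) (clamped_remainder R (h t)) \<le> 0"
      using dissipation[of "h t"] clamped_remainder_eq[OF small[OF t]] by simp
  qed
  then show ?thesis by simp
qed

text \<open>A continuity argument: until the observation first reaches radius \<open>R\<close> the
  energy does not increase, and on the sublevel set of the initial energy the observation is
  strictly shorter than \<open>R\<close>. So \<open>R\<close> is never reached, and along the
  solution the clamped equation is the original one.\<close>

lemma global_solution:
  assumes h0: "St 0 h0 = h0"
  shows "\<exists>h B. continuous_on {0..} h \<and> (\<forall>t\<ge>0. St 0 (h t) = h t \<and> h t = St t h0 + conv (\<lambda>s. remainder (observe (h s))) t \<and> norm (h t) \<le> B)
     \<and> (\<forall>a b. 0 \<le> a \<and> a \<le> b \<longrightarrow> W (h b) \<le> W (h a))"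
proof -
  obtain B where B: "\<And>h. W h \<le> W h0 \<Longrightarrow> norm h \<le> B" using W_coercive[of "W h0"] by blast
  obtain K where K: "K > 0" "\<And>h. norm (observe h) \<le> norm h * K"
    using bounded_linear.pos_bounded[OF bounded_linear_observe] by blast
  \<comment> \<open>\<open>B\<close> bounds all states of at most the initial energy and
    \<open>B * K\<close> their observations; the added 1 makes the inequality strict, as the
    contradiction at the first hitting time requires.\<close>
  define R where "R = B * K + 1"
  have B0: "B \<ge> 0" using B[of h0] norm_ge_zero[of h0] by linarith
  then have R: "R \<ge> 0" using K by (simp add: R_def)
  have smallW: "norm (observe h) < R" if "W h \<le> W h0" for h
  proof -
    have "norm (observe h) \<le> norm h * K" by (rule K(2))
    also have "\<dots> \<le> B * K" using B[OF that] K(1) by (intro mult_right_mono) auto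
    finally show ?thesis by (simp add: R_def)
  qed
  obtain C where C: "C-lipschitz_on UNIV (clamped_remainder R)" by (rule clamped_remainder_lipschitz[OF R])
  obtain h where hc: "continuous_on {0..} h" and h: "\<And>t. t \<ge> 0 \<Longrightarrow> h t = St t h0 + conv (\<lambda>s. clamped_remainder R (h s)) t"
    using mild_exists[OF C clamped_remainder_bounded[OF R], of h0] by blast
  have h_0: "h 0 = h0" using h[of 0] h0 by simp
  have dec: "W (h b) \<le> W (h a)" if "0 \<le> a" "a \<le> b" "\<And>t. t \<in> {a..<b} \<Longrightarrow> norm (observe (h t)) \<le> R" for a b
    using energy_decrease[OF R hc h that] by blast
  have small: "norm (observe (h t)) < R" if t: "t \<ge> 0" for t
  proof (rule ccontr)
    assume neg: "\<not> norm (observe (h t)) < R"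
    define A where "A = {s \<in> {0..t}. R \<le> norm (observe (h s))}"
    have "continuous_on {0..t} (\<lambda>s. norm (observe (h s)))"
      by (intro continuous_on_norm continuous_on_compose2[OF linear_continuous_on[OF bounded_linear_observe]]
          continuous_on_subset[OF hc]) auto
    then have "closed A" unfolding A_def by (intro continuous_on_closed_Collect_le continuous_on_const) auto
    moreover have "A = {0..t} \<inter> A" by (auto simp: A_def)
    ultimately have "compact A" by (metis compact_Int_closed compact_Icc)
    moreover have "t \<in> A" using neg t by (auto simp: A_def)
    ultimately obtain s where s: "s \<in> A" "\<And>r. r \<in> A \<Longrightarrow> s \<le> r"
      using compact_attains_inf[of A] by auto
    have "norm (observe (h r)) \<le> R" if "r \<in> {0..<s}" for r
      using s(2)[of r] s(1) that by (force simp: A_def)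
    then have "W (h s) \<le> W (h 0)" using s(1) by (intro dec) (auto simp: A_def)
    then have "norm (observe (h s)) < R" by (intro smallW) (simp add: h_0)
    then show False using s(1) by (simp add: A_def)
  qed
  have eq: "conv (\<lambda>s. clamped_remainder R (h s)) t = conv (\<lambda>s. remainder (observe (h s))) t" for t
    by (rule conv_cong, rule clamped_remainder_eq) (simp add: small less_imp_le)
  have "St 0 (h t) = h t" if "t \<ge> 0" for t
    using S_0_mild[OF continuous_on_clamped_remainder[OF R hc] that, of h0] h[OF that] by simp
  moreover have decall: "W (h b) \<le> W (h a)" if "0 \<le> a" "a \<le> b" for a b
    using that small by (intro dec) (auto intro: less_imp_le)
  moreover have "norm (h t) \<le> B" if "t \<ge> 0" for t using B decall[of 0 t] that by (simp add: h_0)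
  moreover have "h t = St t h0 + conv (\<lambda>s. remainder (observe (h s))) t" if "t \<ge> 0" for t
    using h[OF that] eq[of t] by (rule trans[OF _ arg_cong])
  ultimately show ?thesis using hc by (intro exI[of _ h] exI[of _ B]) blast
qed

text \<open>Continuity makes the integrand integrable, so the assertion that the integral exists
  with a given value becomes an equation for \<open>conv\<close>, to which the semigroup theory
  applies.\<close>

lemma mild_solution_iff:
  assumes y0: "y0 \<in> X" and yX: "\<And>t. 0 \<le> t \<Longrightarrow> ereal t < T \<Longrightarrow> y t \<in> X"
    and T: "\<And>t. 0 \<le> t \<Longrightarrow> ereal t < T \<Longrightarrow> continuous_on {0..t} (\<lambda>s. embed (y s))"
    and t: "0 \<le> t" "ereal t < T"
  shows "has_integral_wrt N (\<lambda>s. S (t - s) (op_N p (y s))) (y t - S t y0) 0 t \<longleftrightarrow>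
    embed (y t) = St t (embed y0) + conv (\<lambda>s. remainder (observe (embed (y s)))) t"
proof -
  have lt: "ereal s < T" if "s \<in> {0..t}" for s
    using that t by (metis atLeastAtMost_iff ereal_less_eq(3) le_less_trans)
  have sX: "y s \<in> X" if "s \<in> {0..t}" for s using yX[of s] lt[OF that] that by simp
  have "continuous_on {0..t} (\<lambda>s. observe (embed (y s)))"
    by (rule continuous_on_compose2[OF linear_continuous_on[OF bounded_linear_observe] T[OF t] subset_UNIV])
  then have "continuous_on {0..t} (\<lambda>s. remainder (observe (embed (y s))))"
    using continuous_on_compose2[OF loc_lip_continuous_on[OF loc_lip_remainder] _ order_refl]
      compact_continuous_image compact_Icc by metis
  then have int: "(\<lambda>s. St (t - s) (remainder (observe (embed (y s))))) integrable_on {0..t}"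
    by (rule conv_integrable) simp
  have e: "embed (S (t - s) (op_N p (y s))) = St (t - s) (remainder (observe (embed (y s))))" if "s \<in> {0..t}" for s
    using op_N_embed[OF sX[OF that]] by (simp add: St_embed[symmetric])
  have Sy: "S t y0 \<in> X" by (rule S_facts(1)[OF t(1) y0])
  have tX: "y t \<in> X" using t by (rule yX)
  have "has_integral_wrt N (\<lambda>s. S (t - s) (op_N p (y s))) (y t - S t y0) 0 t \<longleftrightarrow>
      ((\<lambda>s. embed (S (t - s) (op_N p (y s)))) has_integral embed (y t - S t y0)) {0..t}"
    by (rule has_integral_wrt_iff[OF _ embed_minus(1)[OF tX Sy]])
      (auto intro!: S_facts(1) op_N_embed(1) sX)
  also have "\<dots> \<longleftrightarrow> ((\<lambda>s. St (t - s) (remainder (observe (embed (y s))))) has_integral embed (y t - S t y0)) {0..t}"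
    by (rule has_integral_cong) (rule e)
  also have "\<dots> \<longleftrightarrow> conv (\<lambda>s. remainder (observe (embed (y s)))) t = embed (y t - S t y0)"
    unfolding conv_def using int has_integral_iff by blast
  also have "embed (y t - S t y0) = embed (y t) - St t (embed y0)"
    by (simp only: embed_minus(2)[OF tX Sy] St_embed[OF y0])
  finally show ?thesis by (auto simp: algebra_simps)
qed

lemma global_mild_solution:
  assumes y0: "y0 \<in> X"
  obtains w B where "mild_solution p S y0 \<infinity> w" "continuous_on {0..} (\<lambda>t. embed (w t))"
    "\<And>t. t \<ge> 0 \<Longrightarrow> w t \<in> X"
    "\<And>t. t \<ge> 0 \<Longrightarrow> embed (w t) = St t (embed y0) + conv (\<lambda>s. remainder (observe (embed (w s)))) t"
    "antimono_on {0..} (\<lambda>t. energy p (w t))" "\<And>t. t \<ge> 0 \<Longrightarrow> N (w t) \<le> B"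
proof -
  have "St 0 (embed y0) = embed y0" by (simp add: St_0 cutH_embed y0)
  from global_solution[OF this] obtain h B where hc: "continuous_on {0..} h"
    and h: "\<And>t. t \<ge> 0 \<Longrightarrow> St 0 (h t) = h t" "\<And>t. t \<ge> 0 \<Longrightarrow> h t = St t (embed y0) + conv (\<lambda>s. remainder (observe (h s))) t"
      "\<And>t. t \<ge> 0 \<Longrightarrow> norm (h t) \<le> B"
    and dec: "\<And>a b. 0 \<le> a \<Longrightarrow> a \<le> b \<Longrightarrow> W (h b) \<le> W (h a)" by blast
  define w where "w t = lift (h t)" for t
  have wX: "w t \<in> X" for t by (simp add: w_def lift_in)
  have e: "embed (w t) = h t" if "t \<ge> 0" for t using h(1)[OF that] by (simp add: w_def embed_lift St_0)
  have c: "continuous_on {0..} (\<lambda>t. embed (w t))" by (rule continuous_on_eq[OF hc]) (simp add: e)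
  have eq: "embed (w t) = St t (embed y0) + conv (\<lambda>s. remainder (observe (embed (w s)))) t" if "t \<ge> 0" for t
  proof -
    have "conv (\<lambda>s. remainder (observe (embed (w s)))) t = conv (\<lambda>s. remainder (observe (h s))) t"
      by (rule conv_cong) (simp add: e)
    then show ?thesis using h(2)[OF that] e[OF that] by simp
  qed
  have "mild_solution p S y0 \<infinity> w"
    unfolding mild_solution_def
  proof (intro allI impI conjI wX)
    fix t assume t: "0 \<le> t \<and> ereal t < \<infinity>"
    have "((\<lambda>s. embed (w s - w t)) \<longlongrightarrow> 0) (at t within {0..})"
      using c t by (simp add: continuous_on_def embed_minus wX LIM_zero)
    then have "((\<lambda>s. N (w s - w t)) \<longlongrightarrow> 0) (at t within {0..})"
      by (subst N_tendsto_iff) (auto intro: always_eventually embed_minus(1) wX)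
    moreover have "{s. 0 \<le> s \<and> ereal s < \<infinity>} = {0..}" by auto
    ultimately show "((\<lambda>s. N (w s - w t)) \<longlongrightarrow> 0) (at t within {s. 0 \<le> s \<and> ereal s < \<infinity>})" by simp
    show "has_integral_wrt N (\<lambda>s. S (t - s) (op_N p (w s))) (w t - S t y0) 0 t"
      using t by (subst mild_solution_iff[OF y0 wX, of \<infinity>]) (auto intro: continuous_on_subset[OF c] eq)
  qed
  moreover have "antimono_on {0..} (\<lambda>t. energy p (w t))"
    by (auto intro!: monotone_onI simp: energy_eq wX e dec)
  moreover have "N (w t) \<le> nhi * B" if "t \<ge> 0" for t
    using order_trans[OF nlo_nhi(4)[OF wX, of t] mult_left_mono[of "norm (embed (w t))" B nhi]] h(3)[OF that] nlo_nhi(2)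
    by (simp add: e[OF that])
  ultimately show ?thesis using that[of w "nhi * B"] c wX eq by blast
qed

text \<open>On \<open>[0, t]\<close> both curves are continuous, so a single \<open>R\<close> bounds
  their observations. Both then solve the equation clamped at \<open>R\<close>, whose nonlinearity
  is globally Lipschitz.\<close>

lemma mild_solution_unique:
  assumes y0: "y0 \<in> X" and y: "mild_solution p S y0 T y" 
    and wc: "continuous_on {0..} (\<lambda>t. embed (w t))" and wX: "\<And>t. t \<ge> 0 \<Longrightarrow> w t \<in> X"
    and weq: "\<And>t. t \<ge> 0 \<Longrightarrow> embed (w t) = St t (embed y0) + conv (\<lambda>s. remainder (observe (embed (w s)))) t"
    and t: "0 \<le> t" "ereal t < T"
  shows "y t = w t"
proof -
  have yX: "y s \<in> X" if "0 \<le> s" "ereal s < T" for s using y that by (simp add: mild_solution_def)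
  have lt: "ereal s < T" if "s \<le> r" "ereal r < T" for s r
    using that by (metis ereal_less_eq(3) le_less_trans)
  have yc: "continuous_on {0..r} (\<lambda>s. embed (y s))" if r: "0 \<le> r" "ereal r < T" for r
    unfolding continuous_on_def
  proof
    fix s assume s: "s \<in> {0..r}"
    then have s': "0 \<le> s" "ereal s < T" using lt[of s r] r by auto
    have "((\<lambda>a. N (y a - y s)) \<longlongrightarrow> 0) (at s within {s. 0 \<le> s \<and> ereal s < T})"
      using y s' by (simp add: mild_solution_def)
    then have "((\<lambda>a. N (y a - y s)) \<longlongrightarrow> 0) (at s within {0..r})"
      by (rule tendsto_within_subset) (use lt r in auto)
    moreover have ev: "\<forall>\<^sub>F a in at s within {0..r}. y a \<in> X"
      by (auto simp: eventually_at_filter intro!: always_eventually yX lt[OF _ r(2)])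
    moreover have "\<forall>\<^sub>F a in at s within {0..r}. y a - y s \<in> X"
      using ev by eventually_elim (auto intro: embed_minus(1) yX s')
    ultimately have "((\<lambda>a. embed (y a - y s)) \<longlongrightarrow> 0) (at s within {0..r})"
      by (simp add: N_tendsto_iff)
    then have "((\<lambda>a. embed (y a) - embed (y s)) \<longlongrightarrow> 0) (at s within {0..r})"
      by (rule Lim_transform_eventually)
        (use ev in \<open>eventually_elim, simp add: embed_minus yX s'\<close>)
    then show "((\<lambda>a. embed (y a)) \<longlongrightarrow> embed (y s)) (at s within {0..r})" by (rule LIM_zero_cancel)
  qed
  have yeq: "embed (y s) = St s (embed y0) + conv (\<lambda>r. remainder (observe (embed (y r)))) s" if s: "s \<in> {0..t}" for s
  proof -
    have s': "0 \<le> s" "ereal s < T" using s lt[of s t] t by auto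
    have "has_integral_wrt N (\<lambda>r. S (s - r) (op_N p (y r))) (y s - S s y0) 0 s"
      using y s' unfolding mild_solution_def by blast
    then show ?thesis using mild_solution_iff[OF y0 yX yc s'] by simp
  qed
  have wc': "continuous_on {0..t} (\<lambda>s. embed (w s))" by (rule continuous_on_subset[OF wc]) auto
  have bd: "\<exists>R\<ge>0. \<forall>s\<in>{0..t}. norm (observe (f s)) \<le> R" if "continuous_on {0..t} f" for f
  proof -
    have "continuous_on {0..t} (\<lambda>s. observe (f s))"
      by (rule continuous_on_compose2[OF linear_continuous_on[OF bounded_linear_observe] that subset_UNIV])
    then have "bounded ((\<lambda>s. observe (f s)) ` {0..t})"
      by (intro compact_imp_bounded compact_continuous_image compact_Icc)
    then obtain R where "R > 0" "\<forall>s\<in>{0..t}. norm (observe (f s)) \<le> R" unfolding bounded_pos by auto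
    then show ?thesis by (intro exI[of _ R]) auto
  qed
  obtain R1 where R1: "R1 \<ge> 0" "\<And>s. s \<in> {0..t} \<Longrightarrow> norm (observe (embed (y s))) \<le> R1" using bd[OF yc[OF t]] by blast
  obtain R2 where R2: "R2 \<ge> 0" "\<And>s. s \<in> {0..t} \<Longrightarrow> norm (observe (embed (w s))) \<le> R2" using bd[OF wc'] by blast
  define R where "R = max R1 R2"
  have R: "R \<ge> 0" using R1(1) by (simp add: R_def)
  obtain C where C: "C-lipschitz_on UNIV (clamped_remainder R)" by (rule clamped_remainder_lipschitz[OF R])
  have "embed (y t) = embed (w t)"
  proof (rule mild_unique[OF C t(1)])
    show "continuous_on {0..t} (\<lambda>s. embed (y s))" by (rule yc[OF t])
    show "embed (y s) = St s (embed y0) + conv (\<lambda>s. clamped_remainder R (embed (y s))) s" if s: "s \<in> {0..t}" for s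
    proof -
      have "conv (\<lambda>s. clamped_remainder R (embed (y s))) s = conv (\<lambda>s. remainder (observe (embed (y s)))) s"
        by (rule conv_cong, rule clamped_remainder_eq) (use R1(2) s in \<open>force simp: R_def intro: le_max_iff_disj[THEN iffD2]\<close>)
      then show ?thesis using yeq[OF s] by simp
    qed
    show "embed (w s) = St s (embed y0) + conv (\<lambda>s. clamped_remainder R (embed (w s))) s" if s: "s \<in> {0..t}" for s
    proof -
      have "conv (\<lambda>s. clamped_remainder R (embed (w s))) s = conv (\<lambda>s. remainder (observe (embed (w s)))) s"
        by (rule conv_cong, rule clamped_remainder_eq) (use R2(2) s in \<open>force simp: R_def intro: le_max_iff_disj[THEN iffD2]\<close>)
      then show ?thesis using weq[of s] s by simp
    qed
  qed (use wc' t in auto)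
  then show ?thesis using inj_onD[OF inj_on_embed] yX[OF t] wX[OF t(1)] by blast
qed

end

theorem theorem4p7:
  fixes p :: "('n::finite, 'm::finite) beam"
    and S :: "real \<Rightarrow> ('n, 'm) state \<Rightarrow> ('n, 'm) state"
    and y0 :: "('n, 'm) state"
  assumes "standing_assumptions p"
    and "C0_contraction_semigroup (state_space p) (norm_H p) S"
    and "is_generator (state_space p) (norm_H p) S (dom_A p) (op_L p)"
    and "y0 \<in> state_space p"
  shows "(\<exists>y. maximal_mild_solution p S y0 \<infinity> y) \<and>
    (\<forall>T y. maximal_mild_solution p S y0 T y \<longrightarrow>
       T = \<infinity> \<and>
       antimono_on {0..} (\<lambda>t. energy p (y t)) \<and>
       (\<exists>B. \<forall>t\<ge>0. norm_H p (y t) \<le> B))"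
proof -
  interpret beam_system p S by unfold_locales (fact assms)+
  obtain w B where w: "mild_solution p S y0 \<infinity> w" "continuous_on {0..} (\<lambda>t. embed (w t))"
    "\<And>t. t \<ge> 0 \<Longrightarrow> w t \<in> X"
    "\<And>t. t \<ge> 0 \<Longrightarrow> embed (w t) = St t (embed y0) + conv (\<lambda>s. remainder (observe (embed (w s)))) t"
    and w': "antimono_on {0..} (\<lambda>t. energy p (w t))" "\<And>t. t \<ge> 0 \<Longrightarrow> N (w t) \<le> B"
    using global_mild_solution[OF assms(4)] by blast
  have "maximal_mild_solution p S y0 \<infinity> w"
    using w(1) by (simp add: maximal_mild_solution_def)
  moreover have "T = \<infinity> \<and> antimono_on {0..} (\<lambda>t. energy p (y t)) \<and> (\<exists>B. \<forall>t\<ge>0. N (y t) \<le> B)"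
    if y: "maximal_mild_solution p S y0 T y" for T y
  proof -
    have "y t = w t" if "0 \<le> t" "ereal t < T" for t
      using mild_solution_unique[OF assms(4) _ w(2-4) that] y by (simp add: maximal_mild_solution_def)
    note eq = this
    \<comment> \<open>For finite \<open>T\<close> the global solution \<open>w\<close> would be a
      proper extension of \<open>y\<close>, against maximality.\<close>
    have T: "T = \<infinity>"
    proof (rule ccontr)
      assume "T \<noteq> \<infinity>"
      then have "T < \<infinity>" by simp
      moreover have "\<forall>t. 0 \<le> t \<and> ereal t < T \<longrightarrow> w t = y t" using eq by auto
      ultimately show False using y w(1) unfolding maximal_mild_solution_def by blast
    qed
    have "y t = w t" if "t \<ge> 0" for t using eq[OF that] T by simp
    then show ?thesis using T w' by (auto simp: monotone_on_def)
  qed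
  ultimately show ?thesis by blast
qed

end
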